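(* There is a constant $\gamma_0>0$, depending only on the coefficients $r,q,\kappa,\theta,\rho,\sigma$ of $A$, such that for $\gamma\in(0,\gamma_0)$ the following holds. Let $f\in L^2(\mathcal O,\mathfrak w)$, let $\psi\in H^1(\mathcal O,\mathfrak w)$ with $\psi^+\in H^1_0(\mathcal O\cup\Gamma_0,\mathfrak w)$, and let $\varepsilon>0$. Then there exists a unique $u_\varepsilon\in H^1_0(\mathcal O\cup\Gamma_0,\mathfrak w)$ solving the penalized equation $$a_\lambda(u_\varepsilon,v)+(\beta_\varepsilon(u_\varepsilon),v)_{L^2(\mathcal O,\mathfrak w)}=(f,v)_{L^2(\mathcal O,\mathfrak w)}\qquad\forall v\in H^1_0(\mathcal O\cup\Gamma_0,\mathfrak w),$$ where $\beta_\varepsilon(w):=-\tfrac1\varepsilon(\psi-w)^+$.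
   Context: $\mathbb H=\mathbb R\times(0,\infty)$ with coordinates $(x,y)$. The constants satisfy $\sigma\ne0$, $-1<\rho<1$, $\kappa>0$, $\theta>0$, $r\ge0$, $q\ge0$, and (standing normalization) $b_1:=r-q-\kappa\theta\rho/\sigma=0$; they are the coefficients of the Heston operator $$Av=-\tfrac y2\left(v_{xx}+2\rho\sigma v_{xy}+\sigma^2v_{yy}\right)-\left(r-q-\tfrac y2\right)v_x-\kappa(\theta-y)v_y+rv .$$ Put $\beta=2\kappa\theta/\sigma^2$, $\mu=2\kappa/\sigma^2$, $a_1=\kappa\rho/\sigma-\tfrac12$ and $\mathfrak w(x,y)=y^{\beta-1}e^{-\gamma|x|-\mu y}$ on $\mathbb H$. $\mathcal O\subset\mathbb H$ is a possibly unbounded domain; $\Gamma_0$ is the interior (in $\{y=0\}$) of $\{y=0\}\cap\partial\mathcal O$, assumed non-empty. $L^2(\mathcal O,\mathfrak w)$ is the $L^2$ space for $\mathfrak w\,dx\,dy$; $H^1(\mathcal O,\mathfrak w)$ is the space with finite norm $\|u\|_{H^1(\mathcal O,\mathfrak w)}^2=\int_{\mathcal O}(y|Du|^2+(1+y)u^2)\mathfrak w\,dx\,dy$ (distributional derivatives); $H^1_0(\mathcal O\cup\Gamma_0,\mathfrak w)$ is the closure in $H^1(\mathcal O,\mathfrak w)$ of $C^\infty_0(\mathcal O\cup\Gamma_0)$ (smooth functions with compact support in $\mathcal O\cup\Gamma_0$). $w^+=\max\{w,0\}$. The Heston bilinear form is $$a(u,v)=\tfrac12\int_{\mathcal O}\left(u_xv_x+\rho\sigma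 u_yv_x+\rho\sigma u_xv_y+\sigma^2u_yv_y\right)y\,\mathfrak w\,dx\,dy-\tfrac\gamma2\int_{\mathcal O}(u_x+\rho\sigma u_y)v\,\operatorname{sign}(x)\,y\,\mathfrak w\,dx\,dy$$ $$\qquad-\int_{\mathcal O}a_1y\,u_xv\,\mathfrak w\,dx\,dy+\int_{\mathcal O}ruv\,\mathfrak w\,dx\,dy,$$ and $a_\lambda(u,v)=a(u,v)+\lambda((1+y)u,v)_{L^2(\mathcal O,\mathfrak w)}$. Here $\lambda>0$ is a fixed constant depending only on the coefficients of $A$, chosen so large that $a_\lambda$ is continuous and coercive on $V=H^1_0(\mathcal O\cup\Gamma_0,\mathfrak w)$: $|a_\lambda(u,v)|\le C\|u\|_V\|v\|_V$ and $a_\lambda(v,v)\ge\nu_1\|v\|_V^2$ for all $u,v\in V$, with constants $C,\nu_1>0$ depending only on the coefficients of $A$. *)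

theory Defs
  imports "HOL-Analysis.Analysis"
begin

definition half_plane :: "(real \<times> real) set" where
  "half_plane = {p. snd p > 0}"

definition is_domain :: "(real \<times> real) set \<Rightarrow> bool" where
  "is_domain \<O> \<longleftrightarrow> open \<O> \<and> connected \<O> \<and> \<O> \<noteq> {} \<and> \<O> \<subseteq> half_plane"

text \<open>The interior is taken relative to the line y = 0, not in the plane.\<close>

definition Gamma0 :: "(real \<times> real) set \<Rightarrow> (real \<times> real) set" where
  "Gamma0 \<O> = (top_of_set {p. snd p = 0}) interior_of ({p. snd p = 0} \<inter> frontier \<O>)"


text \<open>
  \<open>Ck_upto k \<O> T \<phi>\<close>: the function is of class \<open>C\<^sup>k\<close> on the open set \<open>\<O>\<close> and all its partial
  derivatives up to order \<open>k\<close> extend continuously to \<open>\<O> \<union> T\<close>, where \<open>T\<close> is a part of the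
  boundary of \<open>\<O>\<close>.  On \<open>T\<close> the functions \<open>\<phi>\<^sub>x\<close> and \<open>\<phi>\<^sub>y\<close> below are determined by continuity.
\<close>

primrec Ck_upto ::
  "nat \<Rightarrow> (real \<times> real) set \<Rightarrow> (real \<times> real) set \<Rightarrow> (real \<times> real \<Rightarrow> real) \<Rightarrow> bool" where
  "Ck_upto 0 \<O> T \<phi> \<longleftrightarrow> continuous_on (\<O> \<union> T) \<phi>"
| "Ck_upto (Suc k) \<O> T \<phi> \<longleftrightarrow> continuous_on (\<O> \<union> T) \<phi> \<and>
     (\<exists>\<phi>\<^sub>x \<phi>\<^sub>y.
        (\<forall>p\<in>\<O>. (\<phi> has_derivative (\<lambda>h. fst h * \<phi>\<^sub>x p + snd h * \<phi>\<^sub>y p)) (at p)) \<and>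
        Ck_upto k \<O> T \<phi>\<^sub>x \<and> Ck_upto k \<O> T \<phi>\<^sub>y)"

text \<open>
  Smooth functions with compact support in \<open>\<O> \<union> T\<close>.  For \<open>T = {}\<close> these are the usual test
  functions on \<open>\<O>\<close>; for \<open>T = Gamma0 \<O>\<close> they need not vanish on the degenerate boundary.
\<close>

definition Cinf0 ::
  "(real \<times> real) set \<Rightarrow> (real \<times> real) set \<Rightarrow> (real \<times> real \<Rightarrow> real) set" where
  "Cinf0 \<O> T = {\<phi>. (\<forall>k. Ck_upto k \<O> T \<phi>) \<and>
     (\<exists>K. compact K \<and> K \<subseteq> \<O> \<union> T \<and> (\<forall>p \<in> (\<O> \<union> T) - K. \<phi> p = 0))}"


definition locally_integrable :: "(real \<times> real) set \<Rightarrow> (real \<times> real \<Rightarrow> real) \<Rightarrow> bool" where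
  "locally_integrable \<O> u \<longleftrightarrow> (\<forall>K. compact K \<and> K \<subseteq> \<O> \<longrightarrow> set_integrable lborel K u)"

text \<open>\<open>g\<close> is the distributional derivative of \<open>u\<close> on \<open>\<O>\<close> in the direction \<open>e\<close>.\<close>

definition has_weak_deriv ::
  "(real \<times> real) set \<Rightarrow> real \<times> real \<Rightarrow> (real \<times> real \<Rightarrow> real) \<Rightarrow> (real \<times> real \<Rightarrow> real) \<Rightarrow> bool" where
  "has_weak_deriv \<O> e u g \<longleftrightarrow> locally_integrable \<O> u \<and> locally_integrable \<O> g \<and>
     (\<forall>\<phi> \<in> Cinf0 \<O> {}.
        (LINT p:\<O>|lborel. u p * frechet_derivative \<phi> (at p) e) = - (LINT p:\<O>|lborel. g p * \<phi> p))"

text \<open>Representatives of the weak partial derivatives, unique up to null sets when they exist.\<close>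

definition weak_dx :: "(real \<times> real) set \<Rightarrow> (real \<times> real \<Rightarrow> real) \<Rightarrow> real \<times> real \<Rightarrow> real" where
  "weak_dx \<O> u = (SOME g. has_weak_deriv \<O> (1, 0) u g)"

definition weak_dy :: "(real \<times> real) set \<Rightarrow> (real \<times> real \<Rightarrow> real) \<Rightarrow> real \<times> real \<Rightarrow> real" where
  "weak_dy \<O> u = (SOME g. has_weak_deriv \<O> (0, 1) u g)"


text \<open>
  Elements of the weighted spaces are represented by functions on the plane of which only the values
  on \<open>\<O>\<close>, up to null sets, are relevant.
\<close>

definition wmeasure :: "(real \<times> real \<Rightarrow> real) \<Rightarrow> (real \<times> real) set \<Rightarrow> (real \<times> real) measure" where
  "wmeasure w \<O> = density (restrict_space lborel \<O>) (\<lambda>p. ennreal (w p))"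

definition L2 :: "(real \<times> real \<Rightarrow> real) \<Rightarrow> (real \<times> real) set \<Rightarrow> (real \<times> real \<Rightarrow> real) set" where
  "L2 w \<O> = {u \<in> borel_measurable (wmeasure w \<O>). integrable (wmeasure w \<O>) (\<lambda>p. (u p)\<^sup>2)}"

definition L2_inner ::
  "(real \<times> real \<Rightarrow> real) \<Rightarrow> (real \<times> real) set \<Rightarrow>
   (real \<times> real \<Rightarrow> real) \<Rightarrow> (real \<times> real \<Rightarrow> real) \<Rightarrow> real" where
  "L2_inner w \<O> u v = (LINT p|wmeasure w \<O>. u p * v p)"

definition H1_density ::
  "(real \<times> real) set \<Rightarrow> (real \<times> real \<Rightarrow> real) \<Rightarrow> real \<times> real \<Rightarrow> real" where
  "H1_density \<O> u p =
     snd p * ((weak_dx \<O> u p)\<^sup>2 + (weak_dy \<O> u p)\<^sup>2) + (1 + snd p) * (u p)\<^sup>2"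

definition H1 :: "(real \<times> real \<Rightarrow> real) \<Rightarrow> (real \<times> real) set \<Rightarrow> (real \<times> real \<Rightarrow> real) set" where
  "H1 w \<O> = {u \<in> borel_measurable (wmeasure w \<O>).
     (\<exists>g. has_weak_deriv \<O> (1, 0) u g) \<and> (\<exists>g. has_weak_deriv \<O> (0, 1) u g) \<and>
     integrable (wmeasure w \<O>) (H1_density \<O> u)}"

definition H1_norm ::
  "(real \<times> real \<Rightarrow> real) \<Rightarrow> (real \<times> real) set \<Rightarrow> (real \<times> real \<Rightarrow> real) \<Rightarrow> real" where
  "H1_norm w \<O> u = sqrt (LINT p|wmeasure w \<O>. H1_density \<O> u p)"

definition H10 :: "(real \<times> real \<Rightarrow> real) \<Rightarrow> (real \<times> real) set \<Rightarrow> (real \<times> real \<Rightarrow> real) set" where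
  "H10 w \<O> = {u \<in> H1 w \<O>.
     \<forall>e>0. \<exists>\<phi> \<in> Cinf0 \<O> (Gamma0 \<O>). H1_norm w \<O> (\<lambda>p. u p - \<phi> p) < e}"


definition heston_weight :: "real \<Rightarrow> real \<Rightarrow> real \<Rightarrow> real \<Rightarrow> real \<times> real \<Rightarrow> real" where
  "heston_weight \<kappa> \<theta> \<sigma> \<gamma> p =
     (let \<beta> = 2 * \<kappa> * \<theta> / \<sigma>\<^sup>2; \<mu> = 2 * \<kappa> / \<sigma>\<^sup>2
      in snd p powr (\<beta> - 1) * exp (- \<gamma> * \<bar>fst p\<bar> - \<mu> * snd p))"

definition heston_form ::
  "real \<Rightarrow> real \<Rightarrow> real \<Rightarrow> real \<Rightarrow> real \<Rightarrow> real \<Rightarrow> (real \<times> real) set \<Rightarrow>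
   (real \<times> real \<Rightarrow> real) \<Rightarrow> (real \<times> real \<Rightarrow> real) \<Rightarrow> real" where
  "heston_form r \<kappa> \<theta> \<rho> \<sigma> \<gamma> \<O> u v =
     (let M = wmeasure (heston_weight \<kappa> \<theta> \<sigma> \<gamma>) \<O>;
          a\<^sub>1 = \<kappa> * \<rho> / \<sigma> - 1 / 2;
          u\<^sub>x = weak_dx \<O> u; u\<^sub>y = weak_dy \<O> u; v\<^sub>x = weak_dx \<O> v; v\<^sub>y = weak_dy \<O> v
      in 1 / 2 * (LINT p|M. (u\<^sub>x p * v\<^sub>x p + \<rho> * \<sigma> * u\<^sub>y p * v\<^sub>x p + \<rho> * \<sigma> * u\<^sub>x p * v\<^sub>y p
                               + \<sigma>\<^sup>2 * u\<^sub>y p * v\<^sub>y p) * snd p)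
         - \<gamma> / 2 * (LINT p|M. (u\<^sub>x p + \<rho> * \<sigma> * u\<^sub>y p) * v p * sgn (fst p) * snd p)
         - (LINT p|M. a\<^sub>1 * snd p * u\<^sub>x p * v p)
         + (LINT p|M. r * u p * v p))"

definition heston_form_shift ::
  "real \<Rightarrow> real \<Rightarrow> real \<Rightarrow> real \<Rightarrow> real \<Rightarrow> real \<Rightarrow> real \<Rightarrow> (real \<times> real) set \<Rightarrow>
   (real \<times> real \<Rightarrow> real) \<Rightarrow> (real \<times> real \<Rightarrow> real) \<Rightarrow> real" where
  "heston_form_shift r \<kappa> \<theta> \<rho> \<sigma> lam \<gamma> \<O> u v =
     heston_form r \<kappa> \<theta> \<rho> \<sigma> \<gamma> \<O> u v
     + lam * L2_inner (heston_weight \<kappa> \<theta> \<sigma> \<gamma>) \<O> (\<lambda>p. (1 + snd p) * u p) v"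

text \<open>
  \<open>lam\<close> is large enough that the shifted form is continuous and coercive.  The constants \<open>C\<close> and
  \<open>\<nu>\<^sub>1\<close> are chosen before \<open>\<gamma>\<close> and \<open>\<O>\<close>: they depend on the coefficients of the operator only.
\<close>

definition coercive_shift ::
  "real \<Rightarrow> real \<Rightarrow> real \<Rightarrow> real \<Rightarrow> real \<Rightarrow> real \<Rightarrow> real \<Rightarrow> bool" where
  "coercive_shift r \<kappa> \<theta> \<rho> \<sigma> \<gamma>\<^sub>0 lam \<longleftrightarrow> lam > 0 \<and>
     (\<exists>C>0. \<exists>\<nu>\<^sub>1>0. \<forall>\<gamma> \<O>. 0 < \<gamma> \<and> \<gamma> < \<gamma>\<^sub>0 \<and> is_domain \<O> \<and> Gamma0 \<O> \<noteq> {} \<longrightarrow>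
        (let w = heston_weight \<kappa> \<theta> \<sigma> \<gamma>; V = H10 w \<O>
         in (\<forall>u\<in>V. \<forall>v\<in>V. \<bar>heston_form_shift r \<kappa> \<theta> \<rho> \<sigma> lam \<gamma> \<O> u v\<bar>
                             \<le> C * H1_norm w \<O> u * H1_norm w \<O> v) \<and>
            (\<forall>v\<in>V. heston_form_shift r \<kappa> \<theta> \<rho> \<sigma> lam \<gamma> \<O> v v \<ge> \<nu>\<^sub>1 * (H1_norm w \<O> v)\<^sup>2)))"

definition penalty ::
  "(real \<times> real \<Rightarrow> real) \<Rightarrow> real \<Rightarrow> (real \<times> real \<Rightarrow> real) \<Rightarrow> real \<times> real \<Rightarrow> real" where
  "penalty \<psi> \<epsilon> u p = - (1 / \<epsilon>) * max (\<psi> p - u p) 0"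

definition solves_penalized ::
  "real \<Rightarrow> real \<Rightarrow> real \<Rightarrow> real \<Rightarrow> real \<Rightarrow> real \<Rightarrow> real \<Rightarrow> (real \<times> real) set \<Rightarrow>
   (real \<times> real \<Rightarrow> real) \<Rightarrow> (real \<times> real \<Rightarrow> real) \<Rightarrow> real \<Rightarrow> (real \<times> real \<Rightarrow> real) \<Rightarrow> bool" where
  "solves_penalized r \<kappa> \<theta> \<rho> \<sigma> lam \<gamma> \<O> f \<psi> \<epsilon> u \<longleftrightarrow>
     (let w = heston_weight \<kappa> \<theta> \<sigma> \<gamma>
      in u \<in> H10 w \<O> \<and>
         (\<forall>v \<in> H10 w \<O>.
            heston_form_shift r \<kappa> \<theta> \<rho> \<sigma> lam \<gamma> \<O> u v + L2_inner w \<O> (penalty \<psi> \<epsilon> u) v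
            = L2_inner w \<O> f v))"

end

theory Submission
  imports Defs "HOL-Library.Function_Algebras"
begin

text \<open>
  The idea.  Write \<open>\<Phi> u = (\<surd>y u\<^sub>x, \<surd>y u\<^sub>y, \<surd>(1 + y) u)\<close> for the weighted jet of a function \<open>u\<close>.
  Its \<open>L\<^sup>2\<close> norm for the measure \<open>w dx dy\<close> is the norm of \<open>H\<^sup>1\<close>, and the shifted
  Heston form is the integral of \<open>B\<^sub>p (\<Phi> u(p)) (\<Phi> v(p))\<close>, where \<open>B\<^sub>p\<close> is a bilinear form on
  three-dimensional space whose coefficients are bounded uniformly in \<open>p\<close>, in \<open>\<O>\<close> and in
  \<open>0 < \<gamma> < 1\<close>.  Continuity of \<open>a\<^sub>\<lambda>\<close> is therefore the Cauchy--Schwarz inequality, and coercivity is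
  a pointwise statement: the second-order part of \<open>B\<^sub>p\<close> is positive definite in the first two
  entries because \<open>|\<rho>| < 1\<close> and \<open>\<sigma> \<noteq> 0\<close>, and a large \<open>\<lambda>\<close> absorbs the mixed terms, all of which
  contain the third entry (lemma \<open>heston_integrand_coercive\<close>).  This gives \<open>\<gamma>\<^sub>0 = 1\<close>.

  For the penalized equation, the map \<open>u \<mapsto> a\<^sub>\<lambda>(u, \<cdot>) + (\<beta>\<^sub>\<epsilon>(u), \<cdot>) - (f, \<cdot>)\<close> from \<open>V\<close> to its
  dual is Lipschitz continuous and strongly monotone: \<open>a\<^sub>\<lambda>\<close> is bounded and coercive, while
  \<open>w \<mapsto> -(\<psi> - w)\<^sup>+ / \<epsilon>\<close> is nondecreasing and has Lipschitz constant \<open>1/\<epsilon>\<close>.  Such a map has a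
  zero (Zarantonello's theorem, \<open>strongly_monotone_solvable\<close>), and strong monotonicity leaves
  room for only one up to null sets.  Since neither symmetry nor
  linearity is available, the zero is found as the fixed point of a contraction, with the Riesz
  representation theorem turning functionals into vectors.

  What remains is that \<open>V = H\<^sup>1\<^sub>0(\<O> \<union> \<Gamma>\<^sub>0, w)\<close> is a Hilbert space up to null functions.
  Linearity rests on the uniqueness of weak derivatives, that is, on test functions separating
  locally integrable functions (\<open>test_functions_separate\<close>).  Completeness of \<open>H\<^sup>1\<close>
  (\<open>H1_complete\<close>) is the Riesz--Fischer theorem for the jets, together with the fact that the
  weights are bounded away from zero on compact subsets of \<open>\<O>\<close>, so that weak derivatives survive
  the limit.  Finally \<open>V\<close> is a closed subspace because the smooth functions that define it belong
  to \<open>H\<^sup>1\<close> (\<open>Cinf0_in_H1\<close>); they need not vanish on \<open>\<Gamma>\<^sub>0\<close>, and it is the condition \<open>\<beta> > 0\<close>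
  that makes the weight \<open>y\<^bsup>\<beta> - 1\<^esup>\<close> integrable there.
\<close>

section \<open>Strongly monotone equations in a Hilbert space\<close>

text \<open>
  Applied to the square of the norm of \<open>u + t v\<close>, this is the Cauchy--Schwarz inequality, once for abstract
  semi-inner products and once for integrals.
\<close>

lemma discriminant_le:
  fixes a b c :: real
  assumes q: "\<And>t. 0 \<le> a + 2 * t * b + t\<^sup>2 * c" and c: "0 \<le> c"
  shows "b\<^sup>2 \<le> a * c"
proof (cases "c = 0")
  case True
  have "b = 0"
  proof (rule ccontr)
    assume n: "b \<noteq> 0"
    have "0 \<le> a + 2 * (- (a + 1) / (2 * b)) * b" using q[of "- (a + 1) / (2 * b)"] True by simp
    with n show False by (simp add: field_simps)
  qed
  with True show ?thesis by simp
next
  case False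
  have "0 \<le> a - b\<^sup>2 / c"
    using q[of "- b / c"] False by (simp add: power2_eq_square field_simps)
  then show ?thesis using c False by (simp add: field_simps)
qed

text \<open>
  The form is only semidefinite, because functions that agree almost everywhere are at distance
  zero without being equal; limits are accordingly not unique.
\<close>

locale semi_hilbert =
  fixes V :: "'v::real_vector set" and ip :: "'v \<Rightarrow> 'v \<Rightarrow> real" and nrm :: "'v \<Rightarrow> real"
  assumes nrm_def: "\<And>u. nrm u = sqrt (ip u u)"
    and V: "subspace V"
    and ip_commute: "\<And>u v. u \<in> V \<Longrightarrow> v \<in> V \<Longrightarrow> ip u v = ip v u"
    and ip_add_left: "\<And>u v x. u \<in> V \<Longrightarrow> v \<in> V \<Longrightarrow> x \<in> V \<Longrightarrow> ip (u + v) x = ip u x + ip v x"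
    and ip_scale_left: "\<And>c u x. u \<in> V \<Longrightarrow> x \<in> V \<Longrightarrow> ip (c *\<^sub>R u) x = c * ip u x"
    and ip_nonneg: "\<And>u. u \<in> V \<Longrightarrow> 0 \<le> ip u u"
    and complete: "\<And>X :: nat \<Rightarrow> 'v. (\<And>n. X n \<in> V) \<Longrightarrow>
        (\<And>e. e > 0 \<Longrightarrow> \<exists>N. \<forall>m\<ge>N. \<forall>n\<ge>N. nrm (X m - X n) < e) \<Longrightarrow>
        \<exists>u\<in>V. (\<lambda>n. nrm (X n - u)) \<longlonglongrightarrow> 0"
begin

lemma V_add: "u \<in> V \<Longrightarrow> v \<in> V \<Longrightarrow> u + v \<in> V"
  and V_scale: "u \<in> V \<Longrightarrow> c *\<^sub>R u \<in> V"
  and V_diff: "u \<in> V \<Longrightarrow> v \<in> V \<Longrightarrow> u - v \<in> V"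
  and V_0: "0 \<in> V"
  using V by (auto intro: subspace_add subspace_scale subspace_diff subspace_0)

lemma ip_diff_left:
  assumes "u \<in> V" "v \<in> V" "x \<in> V" shows "ip (u - v) x = ip u x - ip v x"
  using ip_add_left[of u "(-1) *\<^sub>R v" x] ip_scale_left[of v x "-1"] assms V_scale[of v "-1"] by simp

lemma ip_right:
  assumes "u \<in> V" "v \<in> V" "x \<in> V"
  shows "ip x (u + v) = ip x u + ip x v" "ip x (u - v) = ip x u - ip x v"
    "ip x (c *\<^sub>R u) = c * ip x u"
  using assms by (simp_all add: ip_commute[of x] V_add V_scale V_diff ip_add_left ip_scale_left ip_diff_left)

lemma nrm_sq: "u \<in> V \<Longrightarrow> (nrm u)\<^sup>2 = ip u u"
  unfolding nrm_def using ip_nonneg by simp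

lemma nrm_nonneg: "u \<in> V \<Longrightarrow> 0 \<le> nrm u"
  unfolding nrm_def using ip_nonneg by simp

lemma ip_cauchy_schwarz:
  assumes u: "u \<in> V" and v: "v \<in> V" shows "\<bar>ip u v\<bar> \<le> nrm u * nrm v"
proof -
  have q: "0 \<le> ip u u + 2 * t * ip u v + t\<^sup>2 * ip v v" for t
    using ip_nonneg[of "u + t *\<^sub>R v"] u v
    by (simp add: V_add V_scale ip_add_left ip_right ip_scale_left ip_commute[of v u]
        power2_eq_square algebra_simps)
  have "(ip u v)\<^sup>2 \<le> ip u u * ip v v" by (rule discriminant_le[OF q ip_nonneg[OF v]])
  then have "sqrt ((ip u v)\<^sup>2) \<le> sqrt (ip u u * ip v v)" by (rule real_sqrt_le_mono)
  then show ?thesis by (simp add: nrm_def real_sqrt_mult)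
qed

lemma nrm_add_sq:
  assumes "u \<in> V" "v \<in> V" shows "(nrm (u + v))\<^sup>2 = (nrm u)\<^sup>2 + 2 * ip u v + (nrm v)\<^sup>2"
  using assms by (simp add: nrm_sq V_add ip_add_left ip_right ip_commute[of v u])

lemma nrm_diff_sq:
  assumes "u \<in> V" "v \<in> V" shows "(nrm (u - v))\<^sup>2 = (nrm u)\<^sup>2 - 2 * ip u v + (nrm v)\<^sup>2"
  using assms by (simp add: nrm_sq V_diff ip_diff_left ip_right ip_commute[of v u])

lemma nrm_scale: "u \<in> V \<Longrightarrow> nrm (c *\<^sub>R u) = \<bar>c\<bar> * nrm u"
  by (simp add: nrm_def ip_scale_left ip_right V_scale real_sqrt_mult power2_eq_square
      flip: mult.assoc)

lemma nrm_triangle: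
  assumes "u \<in> V" "v \<in> V" shows "nrm (u + v) \<le> nrm u + nrm v"
proof (rule power2_le_imp_le)
  show "(nrm (u + v))\<^sup>2 \<le> (nrm u + nrm v)\<^sup>2"
    using ip_cauchy_schwarz[OF assms] by (simp add: nrm_add_sq assms power2_sum)
  show "0 \<le> nrm u + nrm v" using assms by (simp add: nrm_nonneg)
qed

lemma nrm_minus_commute: "u \<in> V \<Longrightarrow> v \<in> V \<Longrightarrow> nrm (u - v) = nrm (v - u)"
  using nrm_scale[of "u - v" "-1"] V_diff by simp

lemma nrm_diff_triangle:
  assumes "u \<in> V" "v \<in> V" "x \<in> V" shows "nrm (u - x) \<le> nrm (u - v) + nrm (v - x)"
  using nrm_triangle[of "u - v" "v - x"] assms V_diff by simp

text \<open>
  The representing vector is a minimizer of \<open>J v = \<parallel>v\<parallel>\<^sup>2 / 2 - l v\<close>: the functional is bounded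
  below, minimizing sequences converge by completeness, and the vanishing of the first variation
  of \<open>J\<close> at the minimizer is the claim.
\<close>

lemma riesz_representation:
  fixes l :: "'v \<Rightarrow> real"
  assumes add: "\<And>u v. u \<in> V \<Longrightarrow> v \<in> V \<Longrightarrow> l (u + v) = l u + l v"
    and scale: "\<And>c u. u \<in> V \<Longrightarrow> l (c *\<^sub>R u) = c * l u"
    and bnd: "\<And>u. u \<in> V \<Longrightarrow> \<bar>l u\<bar> \<le> K * nrm u"
  shows "\<exists>z\<in>V. \<forall>v\<in>V. l v = ip z v"
proof -
  define J where "J v = (nrm v)\<^sup>2 / 2 - l v" for v
  define m where "m = Inf (J ` V)"
  have lb: "- K\<^sup>2 / 2 \<le> J v" if "v \<in> V" for v
  proof -
    have "l v \<le> K * nrm v" using bnd[OF that] by linarith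
    moreover have "0 \<le> (nrm v - K)\<^sup>2" by simp
    ultimately show ?thesis unfolding J_def by (simp add: power2_eq_square algebra_simps)
  qed
  have bdd: "bdd_below (J ` V)" using lb by (auto intro!: bdd_belowI2)
  have m_le: "m \<le> J v" if "v \<in> V" for v
    unfolding m_def using that bdd by (auto intro: cInf_lower)
  have "\<exists>v\<in>V. J v < m + d" if "d > 0" for d
    using cInf_lessD[of "J ` V" "m + d"] V_0 that unfolding m_def by force
  then have "\<exists>v\<in>V. J v < m + inverse (real (Suc n))" for n by simp
  then obtain X where X: "\<And>n. X n \<in> V" "\<And>n. J (X n) < m + inverse (real (Suc n))" by metis
  have l_diff: "l (u - v) = l u - l v" if "u \<in> V" "v \<in> V" for u v
    using add[of u "(-1) *\<^sub>R v"] scale[of v "-1"] that V_scale[of v "-1"] by simp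
  \<comment> \<open>By the parallelogram law two almost minimizers of \<open>J\<close> are close to one another.\<close>
  have par: "(nrm (u - v))\<^sup>2 \<le> 4 * (J u - m) + 4 * (J v - m)" if "u \<in> V" "v \<in> V" for u v
  proof -
    define w where "w = (1/2) *\<^sub>R (u + v)"
    have w: "w \<in> V" using that by (simp add: w_def V_add V_scale)
    have "(nrm w)\<^sup>2 = (nrm (u + v))\<^sup>2 / 4"
      unfolding w_def nrm_scale[OF V_add[OF that]] by (simp add: power_mult_distrib power2_eq_square)
    moreover have "l w = (l u + l v) / 2" unfolding w_def using that by (simp add: scale add V_add)
    ultimately have "8 * J w = (nrm (u + v))\<^sup>2 - 4 * (l u + l v)" unfolding J_def by simp
    moreover have "m \<le> J w" by (rule m_le[OF w])
    ultimately show ?thesis unfolding J_def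
      using nrm_add_sq[OF that] nrm_diff_sq[OF that] by (simp add: field_simps)
  qed
  have "\<exists>N. \<forall>i\<ge>N. \<forall>j\<ge>N. nrm (X i - X j) < e" if "e > 0" for e
  proof -
    have "e\<^sup>2 / 8 > 0" using that by simp
    then obtain N where N: "inverse (real (Suc N)) < e\<^sup>2 / 8"
      using reals_Archimedean by blast
    have "nrm (X i - X j) < e" if ij: "i \<ge> N" "j \<ge> N" for i j
    proof -
      have "inverse (real (Suc k)) \<le> inverse (real (Suc N))" if "k \<ge> N" for k
        using that by (simp add: divide_simps)
      then have "J (X i) - m < e\<^sup>2 / 8" "J (X j) - m < e\<^sup>2 / 8"
        using X(2)[of i] X(2)[of j] N ij by (smt (verit))+
      then have "(nrm (X i - X j))\<^sup>2 < e\<^sup>2" using par[OF X(1) X(1), of i j] by simp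
      then show ?thesis using \<open>e > 0\<close> by (simp add: power2_less_imp_less)
    qed
    then show ?thesis by blast
  qed
  from complete[OF X(1) this] obtain z where z: "z \<in> V" and lim: "(\<lambda>n. nrm (X n - z)) \<longlonglongrightarrow> 0"
    by blast
  have Jz: "J z \<le> m"
  proof -
    have "J z \<le> J (X n) + nrm (X n - z) * (K + nrm z)" for n
    proof -
      have d: "X n - z \<in> V" using X z V_diff by blast
      have "(nrm z)\<^sup>2 + 2 * ip z (X n - z) \<le> (nrm (X n))\<^sup>2" using nrm_add_sq[OF z d] by simp
      then have "J z \<le> J (X n) - ip z (X n - z) + l (X n - z)"
        unfolding J_def using l_diff[OF X(1) z, of n] by simp
      moreover have "l (X n - z) \<le> K * nrm (X n - z)" using bnd[OF d] by linarith
      moreover have "- ip z (X n - z) \<le> nrm z * nrm (X n - z)"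
        using ip_cauchy_schwarz[OF z d] by linarith
      ultimately show ?thesis by (simp add: algebra_simps)
    qed
    then have "J z \<le> (m + inverse (real (Suc n))) + nrm (X n - z) * (K + nrm z)" for n
      using X(2)[of n] by (meson add_le_cancel_right less_eq_real_def order_trans)
    moreover have "(\<lambda>n. (m + inverse (real (Suc n))) + nrm (X n - z) * (K + nrm z)) \<longlonglongrightarrow> (m + 0) + 0 * (K + nrm z)"
      by (intro tendsto_intros lim LIMSEQ_inverse_real_of_nat)
    ultimately show ?thesis by (intro LIMSEQ_le_const[of _ m "J z"]) auto
  qed
  have "l v = ip z v" if v: "v \<in> V" for v
  proof -
    define b where "b = ip z v - l v"
    have q: "0 \<le> t * b + t\<^sup>2 * (nrm v)\<^sup>2 / 2" for t
    proof -
      have "J z \<le> J (z + t *\<^sub>R v)" using Jz m_le[of "z + t *\<^sub>R v"] z v by (simp add: V_add V_scale)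
      then show ?thesis unfolding J_def b_def using z v
        by (simp add: nrm_add_sq V_scale add scale nrm_scale ip_right power_mult_distrib algebra_simps)
    qed
    have "b = 0"
    proof (cases "nrm v = 0")
      case True
      with q[of "-b"] have "b * b \<le> 0" by simp
      then show ?thesis by (auto simp: mult_le_0_iff)
    next
      case False
      have "0 \<le> (- b / (nrm v)\<^sup>2) * b + (- b / (nrm v)\<^sup>2)\<^sup>2 * (nrm v)\<^sup>2 / 2" by (rule q)
      also have "\<dots> = - (b\<^sup>2 / (2 * (nrm v)\<^sup>2))" using False by (simp add: field_simps power2_eq_square)
      finally have "b\<^sup>2 / (2 * (nrm v)\<^sup>2) \<le> 0" by simp
      then have "b\<^sup>2 \<le> 0" using False by (simp add: divide_le_0_iff)
      then show ?thesis by simp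
    qed
    then show ?thesis by (simp add: b_def)
  qed
  with z show ?thesis by blast
qed

text \<open>
  Zarantonello's theorem.  If \<open>R u\<close> represents the functional \<open>T u\<close>, the zeros of \<open>T\<close> are the
  fixed points of \<open>S u = u - t R u\<close>, and expanding the square gives
  \<open>\<parallel>S u - S u'\<parallel>\<^sup>2 \<le> (1 - 2 t \<nu> + t\<^sup>2 L\<^sup>2) \<parallel>u - u'\<parallel>\<^sup>2\<close>.  The factor is smallest for
  \<open>t = \<nu> / L\<^sup>2\<close>, where it is \<open>1 - \<nu>\<^sup>2 / L\<^sup>2\<close>.
\<close>

theorem strongly_monotone_solvable:
  fixes T :: "'v \<Rightarrow> 'v \<Rightarrow> real"
  assumes add: "\<And>u v w. u \<in> V \<Longrightarrow> v \<in> V \<Longrightarrow> w \<in> V \<Longrightarrow> T u (v + w) = T u v + T u w"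
    and scale: "\<And>c u v. u \<in> V \<Longrightarrow> v \<in> V \<Longrightarrow> T u (c *\<^sub>R v) = c * T u v"
    and bnd: "\<And>u. u \<in> V \<Longrightarrow> \<exists>K. \<forall>v\<in>V. \<bar>T u v\<bar> \<le> K * nrm v"
    and lip: "\<And>u u' v. u \<in> V \<Longrightarrow> u' \<in> V \<Longrightarrow> v \<in> V \<Longrightarrow> \<bar>T u v - T u' v\<bar> \<le> L * nrm (u - u') * nrm v"
    and mono: "\<And>u u'. u \<in> V \<Longrightarrow> u' \<in> V \<Longrightarrow> \<nu> * (nrm (u - u'))\<^sup>2 \<le> T u (u - u') - T u' (u - u')"
    and \<nu>: "0 < \<nu>" and L: "0 < L"
  shows "\<exists>u\<in>V. \<forall>v\<in>V. T u v = 0"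
proof -
  have "\<exists>z\<in>V. \<forall>v\<in>V. T u v = ip z v" if u: "u \<in> V" for u
  proof -
    obtain K where "\<forall>v\<in>V. \<bar>T u v\<bar> \<le> K * nrm v" using bnd[OF u] by blast
    then show ?thesis using u by (intro riesz_representation[where K=K]) (auto simp: add scale)
  qed
  then obtain R where R: "\<And>u. u \<in> V \<Longrightarrow> R u \<in> V" "\<And>u v. u \<in> V \<Longrightarrow> v \<in> V \<Longrightarrow> T u v = ip (R u) v"
    by metis
  have R_lip: "nrm (R u - R u') \<le> L * nrm (u - u')" if u: "u \<in> V" "u' \<in> V" for u u'
  proof -
    have d: "R u - R u' \<in> V" using R u V_diff by blast
    have "(nrm (R u - R u'))\<^sup>2 = T u (R u - R u') - T u' (R u - R u')"
      using u R(1) d by (simp add: R(2) nrm_sq ip_diff_left)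
    also have "\<dots> \<le> L * nrm (u - u') * nrm (R u - R u')" using lip[OF u d] by linarith
    finally have *: "nrm (R u - R u') * nrm (R u - R u') \<le> (L * nrm (u - u')) * nrm (R u - R u')"
      by (simp add: power2_eq_square)
    show ?thesis
    proof (cases "nrm (R u - R u') = 0")
      case True then show ?thesis using L nrm_nonneg[of "u - u'"] V_diff u by simp
    next
      case False
      then have "0 < nrm (R u - R u')" using nrm_nonneg[OF d] by simp
      then show ?thesis using * by (simp only: mult_le_cancel_right_pos)
    qed
  qed
  \<comment> \<open>enlarging the Lipschitz constant to at least \<open>\<nu>\<close> keeps \<open>1 - \<nu>\<^sup>2 / M\<^sup>2\<close> nonnegative\<close>
  define M where "M = max L \<nu>"
  have M: "M > 0" "L \<le> M" "\<nu> \<le> M" using L by (auto simp: M_def)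
  define t where "t = \<nu> / M\<^sup>2"
  define k where "k = sqrt (1 - \<nu>\<^sup>2 / M\<^sup>2)"
  have "\<nu>\<^sup>2 / M\<^sup>2 \<le> 1" "\<nu>\<^sup>2 / M\<^sup>2 > 0" using M \<nu> by (simp_all add: power_mono)
  then have k: "0 \<le> k" "k < 1" "k\<^sup>2 = 1 - \<nu>\<^sup>2 / M\<^sup>2" unfolding k_def by (auto simp: real_sqrt_lt_1_iff)
  define S where "S u = u - t *\<^sub>R R u" for u
  have S: "S u \<in> V" if "u \<in> V" for u unfolding S_def using that R V_diff V_scale by blast
  have S_contr: "nrm (S u - S u') \<le> k * nrm (u - u')" if u: "u \<in> V" "u' \<in> V" for u u'
  proof (rule power2_le_imp_le)
    define d g where "d = u - u'" and "g = R u - R u'"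
    have dg: "d \<in> V" "g \<in> V" using u R V_diff by (auto simp: d_def g_def)
    have "S u - S u' = d - t *\<^sub>R g" by (simp add: S_def d_def g_def algebra_simps)
    then have "(nrm (S u - S u'))\<^sup>2 = (nrm d)\<^sup>2 - 2 * t * ip d g + t\<^sup>2 * (nrm g)\<^sup>2"
      using dg by (simp add: nrm_diff_sq V_scale ip_right nrm_scale power_mult_distrib)
    moreover have "\<nu> * (nrm d)\<^sup>2 \<le> ip d g"
      using mono[OF u] u R dg unfolding d_def[symmetric]
      by (simp add: R(2) ip_commute[OF dg]) (simp add: g_def ip_diff_left)
    then have "2 * t * (\<nu> * (nrm d)\<^sup>2) \<le> 2 * t * ip d g"
      by (intro mult_left_mono) (use \<nu> in \<open>auto simp: t_def\<close>)
    moreover have "nrm g \<le> M * nrm d"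
      using R_lip[OF u] M nrm_nonneg[OF dg(1)] unfolding d_def g_def
      by (meson mult_right_mono order_trans)
    then have "t\<^sup>2 * (nrm g)\<^sup>2 \<le> t\<^sup>2 * (M * nrm d)\<^sup>2"
      by (intro mult_left_mono power_mono nrm_nonneg dg) auto
    ultimately have "(nrm (S u - S u'))\<^sup>2 \<le> (nrm d)\<^sup>2 - 2 * t * (\<nu> * (nrm d)\<^sup>2) + t\<^sup>2 * (M * nrm d)\<^sup>2"
      by linarith
    also have "\<dots> = (k * nrm d)\<^sup>2"
      using M by (simp add: t_def power_mult_distrib k(3)) (simp add: field_simps power2_eq_square)
    finally show "(nrm (S u - S u'))\<^sup>2 \<le> (k * nrm (u - u'))\<^sup>2" by (simp add: d_def)
    show "0 \<le> k * nrm (u - u')" using dg k nrm_nonneg by (auto simp: d_def)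
  qed
  define X where "X n = (S ^^ n) 0" for n
  have X: "X n \<in> V" for n by (induction n) (auto simp: X_def V_0 S)
  define D where "D = nrm (X 1 - X 0)"
  have D: "0 \<le> D" unfolding D_def by (intro nrm_nonneg V_diff X)
  have step: "nrm (X (Suc n) - X n) \<le> k ^ n * D" for n
  proof (induction n)
    case (Suc n)
    have "nrm (X (Suc (Suc n)) - X (Suc n)) \<le> k * nrm (X (Suc n) - X n)"
      using S_contr[OF X X, of "Suc n" n] by (simp add: X_def)
    also have "\<dots> \<le> k * (k ^ n * D)" using Suc k by (intro mult_left_mono)
    finally show ?case by (simp add: mult_ac)
  qed (simp add: D_def)
  have tail: "nrm (X (n + j) - X n) \<le> k ^ n * (D / (1 - k))" for n j
  proof -
    have "nrm (X (n + j) - X n) \<le> (\<Sum>i<j. k ^ (n + i) * D)"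
    proof (induction j)
      case 0 then show ?case using V_0 by (simp add: nrm_def ip_scale_left[of 0 0 0, simplified])
    next
      case (Suc j)
      have "nrm (X (n + Suc j) - X n) \<le> nrm (X (n + Suc j) - X (n + j)) + nrm (X (n + j) - X n)"
        by (intro nrm_diff_triangle X)
      then show ?case using Suc step[of "n + j"] by simp
    qed
    also have "\<dots> = k ^ n * D * (\<Sum>i<j. k ^ i)" by (simp add: power_add sum_distrib_left mult_ac)
    also have "\<dots> \<le> k ^ n * D * (1 / (1 - k))"
    proof (intro mult_left_mono)
      show "(\<Sum>i<j. k ^ i) \<le> 1 / (1 - k)"
        using sum_le_suminf[of "\<lambda>i. k ^ i" "{..<j}"] k summable_geometric[of k] suminf_geometric[of k]
        by auto
    qed (use k D in auto)
    finally show ?thesis by simp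
  qed
  have "\<exists>N. \<forall>m\<ge>N. \<forall>n\<ge>N. nrm (X m - X n) < e" if e: "e > 0" for e
  proof -
    have "(\<lambda>n. k ^ n * (D / (1 - k))) \<longlonglongrightarrow> 0 * (D / (1 - k))"
      by (intro tendsto_intros LIMSEQ_realpow_zero k)
    then have "\<forall>\<^sub>F n in sequentially. k ^ n * (D / (1 - k)) < e / 2"
      using e by (intro order_tendstoD(2)) auto
    then obtain N where N: "k ^ N * (D / (1 - k)) < e / 2" by (auto simp: eventually_sequentially)
    have "nrm (X m - X n) < e" if "m \<ge> N" "n \<ge> N" for m n
    proof -
      have "nrm (X i - X N) < e / 2" if "i \<ge> N" for i
        using tail[of N "i - N"] N that by (metis le_add_diff_inverse order_le_less_trans)
      from this[OF that(1)] this[OF that(2)] show ?thesis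
        using nrm_diff_triangle[of "X m" "X N" "X n"] nrm_minus_commute[of "X n" "X N"] X by simp
    qed
    then show ?thesis by blast
  qed
  from complete[OF X this] obtain u where u: "u \<in> V" and lim: "(\<lambda>n. nrm (X n - u)) \<longlonglongrightarrow> 0" by blast
  have "nrm (R u) = 0"
  proof -
    have "t * nrm (R u) \<le> (k + 1) * nrm (X n - u) + k ^ n * D" for n
    proof -
      have s: "t *\<^sub>R R u = (u - X (Suc n)) + (X (Suc n) - S u)" by (simp add: S_def)
      have "t * nrm (R u) = nrm (t *\<^sub>R R u)" using \<nu> R(1)[OF u] by (simp add: nrm_scale t_def)
      also have "\<dots> \<le> nrm (u - X (Suc n)) + nrm (X (Suc n) - S u)"
        unfolding s by (intro nrm_triangle V_diff X u S)
      also have "nrm (X (Suc n) - S u) \<le> k * nrm (X n - u)"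
        using S_contr[OF X u, of n] by (simp add: X_def)
      also have "nrm (u - X (Suc n)) \<le> nrm (u - X n) + nrm (X n - X (Suc n))"
        by (intro nrm_diff_triangle X u)
      finally show ?thesis
        using step[of n] nrm_minus_commute[OF X X, of n "Suc n"] nrm_minus_commute[OF u X, of n]
        by (simp add: algebra_simps)
    qed
    moreover have "(\<lambda>n. (k + 1) * nrm (X n - u) + k ^ n * D) \<longlonglongrightarrow> (k + 1) * 0 + 0 * D"
      by (intro tendsto_intros lim LIMSEQ_realpow_zero k)
    ultimately have "t * nrm (R u) \<le> 0" by (intro LIMSEQ_le_const[of _ 0 "t * nrm (R u)"]) auto
    then show ?thesis using \<nu> M nrm_nonneg[OF R(1)[OF u]] by (simp add: t_def mult_le_0_iff divide_le_0_iff zero_less_power)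
  qed
  then have "T u v = 0" if "v \<in> V" for v
    using ip_cauchy_schwarz[OF R(1)[OF u] that] R(2)[OF u that] by simp
  with u show ?thesis by blast
qed

end

section \<open>Square integrable functions\<close>

lemma integrable_mult_of_squares:
  fixes f g :: "'a \<Rightarrow> real"
  assumes [measurable]: "f \<in> borel_measurable M" "g \<in> borel_measurable M"
    and "integrable M (\<lambda>x. (f x)\<^sup>2)" "integrable M (\<lambda>x. (g x)\<^sup>2)"
  shows "integrable M (\<lambda>x. f x * g x)"
proof (rule Bochner_Integration.integrable_bound)
  show "integrable M (\<lambda>x. (f x)\<^sup>2 + (g x)\<^sup>2)" using assms by simp
  have "\<bar>a * b\<bar> \<le> a\<^sup>2 + b\<^sup>2" for a b :: real
  proof -
    have "2 * (\<bar>a\<bar> * \<bar>b\<bar>) \<le> a\<^sup>2 + b\<^sup>2" using sum_squares_bound[of "\<bar>a\<bar>" "\<bar>b\<bar>"] by simp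
    moreover have "0 \<le> \<bar>a\<bar> * \<bar>b\<bar>" by simp
    ultimately show ?thesis unfolding abs_mult by linarith
  qed
  then show "AE x in M. norm (f x * g x) \<le> norm ((f x)\<^sup>2 + (g x)\<^sup>2)" by simp
qed simp

lemma integral_cauchy_schwarz:
  fixes f g :: "'a \<Rightarrow> real"
  assumes [measurable]: "f \<in> borel_measurable M" "g \<in> borel_measurable M"
    and f: "integrable M (\<lambda>x. (f x)\<^sup>2)" and g: "integrable M (\<lambda>x. (g x)\<^sup>2)"
  shows "\<bar>\<integral>x. f x * g x \<partial>M\<bar> \<le> sqrt (\<integral>x. (f x)\<^sup>2 \<partial>M) * sqrt (\<integral>x. (g x)\<^sup>2 \<partial>M)"
proof -
  have fg: "integrable M (\<lambda>x. f x * g x)" by (rule integrable_mult_of_squares[OF _ _ f g]) auto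
  have "(\<integral>x. f x * g x \<partial>M)\<^sup>2 \<le> (\<integral>x. (f x)\<^sup>2 \<partial>M) * (\<integral>x. (g x)\<^sup>2 \<partial>M)"
  proof (rule discriminant_le)
    fix t :: real
    have "0 \<le> (\<integral>x. (f x + t * g x)\<^sup>2 \<partial>M)" by simp
    also have "\<dots> = (\<integral>x. (f x)\<^sup>2 + 2 * t * (f x * g x) + t\<^sup>2 * (g x)\<^sup>2 \<partial>M)"
      by (intro Bochner_Integration.integral_cong) (auto simp: power2_eq_square algebra_simps)
    also have "\<dots> = (\<integral>x. (f x)\<^sup>2 \<partial>M) + 2 * t * (\<integral>x. f x * g x \<partial>M) + t\<^sup>2 * (\<integral>x. (g x)\<^sup>2 \<partial>M)"
      using f g fg by simp
    finally show "0 \<le> \<dots>" .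
  qed simp
  then have "sqrt ((\<integral>x. f x * g x \<partial>M)\<^sup>2) \<le> sqrt ((\<integral>x. (f x)\<^sup>2 \<partial>M) * (\<integral>x. (g x)\<^sup>2 \<partial>M))"
    by (rule real_sqrt_le_mono)
  then show ?thesis by (simp add: real_sqrt_mult)
qed

lemma norm_add_sq_le:
  fixes a b :: "'b::real_normed_vector"
  shows "(norm (a + b))\<^sup>2 \<le> 2 * (norm a)\<^sup>2 + 2 * (norm b)\<^sup>2"
proof -
  have "(norm (a + b))\<^sup>2 \<le> (norm a + norm b)\<^sup>2" by (intro power_mono norm_triangle_ineq) auto
  also have "\<dots> \<le> 2 * (norm a)\<^sup>2 + 2 * (norm b)\<^sup>2"
    using sum_squares_bound[of "norm a" "norm b"] by (simp add: power2_sum)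
  finally show ?thesis .
qed

lemma norm_sq_integrable_add:
  fixes F G :: "'a \<Rightarrow> 'b::{banach, second_countable_topology}"
  assumes [measurable]: "F \<in> borel_measurable M" "G \<in> borel_measurable M"
    and "integrable M (\<lambda>x. (norm (F x))\<^sup>2)" "integrable M (\<lambda>x. (norm (G x))\<^sup>2)"
  shows "integrable M (\<lambda>x. (norm (F x + G x))\<^sup>2)"
  by (rule Bochner_Integration.integrable_bound[of _ "\<lambda>x. 2 * (norm (F x))\<^sup>2 + 2 * (norm (G x))\<^sup>2"])
    (use assms norm_add_sq_le in auto)

lemma norm_sq_integrable_diff:
  fixes F G :: "'a \<Rightarrow> 'b::{banach, second_countable_topology}"
  assumes "F \<in> borel_measurable M" "G \<in> borel_measurable M"
    and "integrable M (\<lambda>x. (norm (F x))\<^sup>2)" "integrable M (\<lambda>x. (norm (G x))\<^sup>2)"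
  shows "integrable M (\<lambda>x. (norm (F x - G x))\<^sup>2)"
  using norm_sq_integrable_add[of F M "\<lambda>x. - G x"] assms by simp

text \<open>
  A subsequence whose consecutive distances decrease geometrically converges almost everywhere;
  Fatou's lemma then identifies its pointwise limit as the limit in the mean of the whole
  sequence.
\<close>

theorem riesz_fischer_L2:
  fixes F :: "nat \<Rightarrow> 'a \<Rightarrow> 'b::{banach, second_countable_topology}"
  assumes [measurable]: "\<And>n. F n \<in> borel_measurable M"
    and int: "\<And>n. integrable M (\<lambda>x. (norm (F n x))\<^sup>2)"
    and cauchy: "\<And>e. e > 0 \<Longrightarrow> \<exists>N. \<forall>m\<ge>N. \<forall>n\<ge>N. (\<integral>x. (norm (F m x - F n x))\<^sup>2 \<partial>M) < e"
  shows "\<exists>G \<in> borel_measurable M. integrable M (\<lambda>x. (norm (G x))\<^sup>2) \<and>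
           (\<lambda>n. \<integral>x. (norm (F n x - G x))\<^sup>2 \<partial>M) \<longlonglongrightarrow> 0"
proof -
  have nn: "(\<integral>\<^sup>+x. ennreal ((norm (F m x - F n x))\<^sup>2) \<partial>M) = ennreal (\<integral>x. (norm (F m x - F n x))\<^sup>2 \<partial>M)" for m n
    by (intro nn_integral_eq_integral norm_sq_integrable_diff int) auto
  have "\<exists>N. \<forall>m\<ge>N. \<forall>n\<ge>N. (\<integral>x. (norm (F m x - F n x))\<^sup>2 \<partial>M) < (1/4) ^ k" for k :: nat
    by (rule cauchy) simp
  then obtain N where N: "\<And>k m n. m \<ge> N k \<Longrightarrow> n \<ge> N k \<Longrightarrow> (\<integral>x. (norm (F m x - F n x))\<^sup>2 \<partial>M) < (1/4) ^ k"
    by metis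
  \<comment> \<open>nondecreasing, unbounded, and beyond each \<open>N k\<close>\<close>
  define r where "r k = (\<Sum>i\<le>k. N i) + k" for k
  have rN: "N k \<le> r k" for k unfolding r_def by (simp add: member_le_sum trans_le_add1)
  have r_le: "r k \<le> r (Suc k)" "k \<le> r k" for k unfolding r_def by auto
  define D where "D k x = F (r (Suc k)) x - F (r k) x" for k x
  have [measurable]: "D k \<in> borel_measurable M" for k unfolding D_def by measurable
  have D: "(\<integral>\<^sup>+x. ennreal ((norm (D k x))\<^sup>2) \<partial>M) \<le> ennreal ((1/4) ^ k)" for k
    unfolding D_def nn using N[of k "r (Suc k)" "r k"] rN[of k] r_le(1)[of k] by (intro ennreal_leI) auto
  \<comment> \<open>The factor \<open>2 ^ k\<close> is affordable, and it turns square summability into absolute summability.\<close>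
  have "(\<integral>\<^sup>+x. (\<Sum>k. ennreal (2 ^ k * (norm (D k x))\<^sup>2)) \<partial>M) = (\<Sum>k. \<integral>\<^sup>+x. ennreal (2 ^ k * (norm (D k x))\<^sup>2) \<partial>M)"
    by (intro nn_integral_suminf) auto
  also have "\<dots> \<le> (\<Sum>k. ennreal ((1/2) ^ k))"
  proof (intro suminf_le allI)
    fix k
    have "(\<integral>\<^sup>+x. ennreal (2 ^ k * (norm (D k x))\<^sup>2) \<partial>M) = ennreal (2 ^ k) * (\<integral>\<^sup>+x. ennreal ((norm (D k x))\<^sup>2) \<partial>M)"
      by (simp add: ennreal_mult nn_integral_cmult)
    also have "\<dots> \<le> ennreal (2 ^ k) * ennreal ((1/4) ^ k)" by (intro mult_left_mono D) auto
    also have "\<dots> = ennreal ((1/2) ^ k)" by (simp add: ennreal_mult[symmetric] power_mult_distrib[symmetric])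
    finally show "(\<integral>\<^sup>+x. ennreal (2 ^ k * (norm (D k x))\<^sup>2) \<partial>M) \<le> ennreal ((1/2) ^ k)" .
  qed auto
  also have "\<dots> = ennreal (\<Sum>k. (1/2) ^ k)" by (intro suminf_ennreal2) auto
  finally have "(\<integral>\<^sup>+x. (\<Sum>k. ennreal (2 ^ k * (norm (D k x))\<^sup>2)) \<partial>M) \<noteq> \<infinity>"
    by (auto simp: top_unique)
  then have "AE x in M. (\<Sum>k. ennreal (2 ^ k * (norm (D k x))\<^sup>2)) \<noteq> \<infinity>"
    by (intro nn_integral_noteq_infinite) auto
  then have conv: "AE x in M. convergent (\<lambda>k. F (r k) x)"
  proof eventually_elim
    case (elim x)
    then have s: "summable (\<lambda>k. 2 ^ k * (norm (D k x))\<^sup>2)"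
      by (intro summable_suminf_not_top) auto
    have "summable (\<lambda>k. norm (D k x))"
    proof (rule summable_comparison_test')
      show "summable (\<lambda>k. 2 ^ k * (norm (D k x))\<^sup>2 + (1/2) ^ k)"
        by (intro summable_add s summable_geometric) auto
      fix k :: nat
      define d where "d = norm (D k x)"
      have "0 \<le> (2 ^ k * d - 1)\<^sup>2" by simp
      also have "\<dots> = 2 ^ k * (2 ^ k * d\<^sup>2 + (1/2)^k - 2 * d)"
        by (simp add: power2_eq_square algebra_simps power_divide)
      finally have "2 * d \<le> 2 ^ k * d\<^sup>2 + (1/2)^k"
        using mult_le_cancel_left_pos[of "2 ^ k" 0 "2 ^ k * d\<^sup>2 + (1/2)^k - 2 * d"] by simp
      moreover have "0 \<le> d" by (simp add: d_def)
      ultimately have "d \<le> 2 ^ k * d\<^sup>2 + (1/2)^k" by linarith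
      then show "norm (norm (D k x)) \<le> 2 ^ k * (norm (D k x))\<^sup>2 + (1/2) ^ k"
        by (simp add: d_def)
    qed
    then have "summable (\<lambda>k. D k x)" by (rule summable_norm_cancel)
    then have "convergent (\<lambda>n. F (r 0) x + (\<Sum>k<n. D k x))"
      by (intro convergent_add convergent_const) (simp add: summable_iff_convergent)
    moreover have "F (r 0) x + (\<Sum>k<n. D k x) = F (r n) x" for n
      unfolding D_def by (subst sum_lessThan_telescope) simp
    ultimately show ?case by simp
  qed
  define G where "G x = lim (\<lambda>k. F (r k) x)" for x
  have G[measurable]: "G \<in> borel_measurable M" unfolding G_def by measurable
  have lim: "AE x in M. (\<lambda>k. F (r k) x) \<longlonglongrightarrow> G x"
    using conv by eventually_elim (simp add: G_def convergent_LIMSEQ_iff)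
  have fatou: "(\<integral>\<^sup>+x. ennreal ((norm (F m x - G x))\<^sup>2) \<partial>M) \<le> ennreal e"
    if e: "e > 0" and N: "\<forall>m\<ge>N. \<forall>n\<ge>N. (\<integral>x. (norm (F m x - F n x))\<^sup>2 \<partial>M) < e" and m: "m \<ge> N" for e m N
  proof -
    have "(\<integral>\<^sup>+x. ennreal ((norm (F m x - G x))\<^sup>2) \<partial>M)
        = (\<integral>\<^sup>+x. liminf (\<lambda>k. ennreal ((norm (F m x - F (r k) x))\<^sup>2)) \<partial>M)"
    proof (intro nn_integral_cong_AE, use lim in eventually_elim)
      case (elim x)
      have "(\<lambda>k. ennreal ((norm (F m x - F (r k) x))\<^sup>2)) \<longlonglongrightarrow> ennreal ((norm (F m x - G x))\<^sup>2)"
        by (intro tendsto_intros elim)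
      then show ?case by (rule lim_imp_Liminf[OF sequentially_bot, symmetric])
    qed
    also have "\<dots> \<le> liminf (\<lambda>k. \<integral>\<^sup>+x. ennreal ((norm (F m x - F (r k) x))\<^sup>2) \<partial>M)"
      by (intro nn_integral_liminf) auto
    also have "\<dots> \<le> limsup (\<lambda>k. \<integral>\<^sup>+x. ennreal ((norm (F m x - F (r k) x))\<^sup>2) \<partial>M)"
      by (intro Liminf_le_Limsup) simp
    also have "\<dots> \<le> ennreal e"
    proof (rule Limsup_bounded)
      show "\<forall>\<^sub>F k in sequentially. (\<integral>\<^sup>+x. ennreal ((norm (F m x - F (r k) x))\<^sup>2) \<partial>M) \<le> ennreal e"
        unfolding nn eventually_sequentially
      proof (intro exI[of _ N] allI impI ennreal_leI)
        fix k assume "k \<ge> N"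
        then have "r k \<ge> N" using r_le(2)[of k] by linarith
        then show "(\<integral>x. (norm (F m x - F (r k) x))\<^sup>2 \<partial>M) \<le> e" using N m by (simp add: less_imp_le)
      qed
    qed
    finally show ?thesis .
  qed
  have FG: "integrable M (\<lambda>x. (norm (F m x - G x))\<^sup>2)" if "m \<ge> N 0" for m
  proof (rule integrableI_bounded)
    have "\<forall>m\<ge>N 0. \<forall>n\<ge>N 0. (\<integral>x. (norm (F m x - F n x))\<^sup>2 \<partial>M) < 1" using N[of 0] by simp
    from fatou[OF _ this that] show "(\<integral>\<^sup>+x. ennreal (norm ((norm (F m x - G x))\<^sup>2)) \<partial>M) < \<infinity>"
      by (simp add: order_le_less_trans ennreal_less_top)
  qed measurable
  have intG: "integrable M (\<lambda>x. (norm (G x))\<^sup>2)"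
    using norm_sq_integrable_diff[OF _ _ int[of "N 0"] FG[of "N 0"]] by simp
  have "(\<lambda>n. \<integral>x. (norm (F n x - G x))\<^sup>2 \<partial>M) \<longlonglongrightarrow> 0"
  proof (rule LIMSEQ_I)
    fix e :: real assume e: "e > 0"
    then obtain K where K: "\<forall>m\<ge>K. \<forall>n\<ge>K. (\<integral>x. (norm (F m x - F n x))\<^sup>2 \<partial>M) < e / 2"
      using cauchy[of "e / 2"] by auto
    have "norm ((\<integral>x. (norm (F m x - G x))\<^sup>2 \<partial>M) - 0) < e" if "m \<ge> max K (N 0)" for m
    proof -
      have "ennreal (\<integral>x. (norm (F m x - G x))\<^sup>2 \<partial>M) \<le> ennreal (e / 2)"
        using fatou[OF _ K, of m] e that FG[of m] by (subst nn_integral_eq_integral[symmetric]) auto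
      then show ?thesis using e by (simp add: ennreal_le_iff)
    qed
    then show "\<exists>no. \<forall>n\<ge>no. norm ((\<integral>x. (norm (F n x - G x))\<^sup>2 \<partial>M) - 0) < e" by blast
  qed
  with intG G show ?thesis by blast
qed

section \<open>Smooth functions and test functions\<close>

text \<open>
  Unfolding the recursive equation exposes existential quantifiers over the partial derivatives,
  which have to be instantiated by hand; the next rules package the two directions.
\<close>

declare Ck_upto.simps(2) [simp del]

lemma Ck_upto_continuous: "Ck_upto k \<O> T \<phi> \<Longrightarrow> continuous_on (\<O> \<union> T) \<phi>"
  by (cases k) (auto simp: Ck_upto.simps(2))

lemma Ck_upto_SucI:
  assumes "continuous_on (\<O> \<union> T) \<phi>"
    and "\<And>p. p \<in> \<O> \<Longrightarrow> (\<phi> has_derivative (\<lambda>h. fst h * \<phi>x p + snd h * \<phi>y p)) (at p)"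
    and "Ck_upto k \<O> T \<phi>x" "Ck_upto k \<O> T \<phi>y"
  shows "Ck_upto (Suc k) \<O> T \<phi>"
proof -
  have D: "\<forall>p\<in>\<O>. (\<phi> has_derivative (\<lambda>h. fst h * \<phi>x p + snd h * \<phi>y p)) (at p)"
    using assms(2) by (rule ballI)
  show ?thesis unfolding Ck_upto.simps(2)
    by (rule conjI[OF assms(1)], rule exI[of _ \<phi>x], rule exI[of _ \<phi>y],
        rule conjI[OF D], rule conjI[OF assms(3,4)])
qed

lemma Ck_upto_SucE:
  assumes "Ck_upto (Suc k) \<O> T \<phi>"
  obtains \<phi>x \<phi>y where "continuous_on (\<O> \<union> T) \<phi>"
    and "\<And>p. p \<in> \<O> \<Longrightarrow> (\<phi> has_derivative (\<lambda>h. fst h * \<phi>x p + snd h * \<phi>y p)) (at p)"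
    and "Ck_upto k \<O> T \<phi>x" "Ck_upto k \<O> T \<phi>y"
proof -
  from assms[unfolded Ck_upto.simps(2)] obtain \<phi>x \<phi>y where "continuous_on (\<O> \<union> T) \<phi>"
    "\<forall>p\<in>\<O>. (\<phi> has_derivative (\<lambda>h. fst h * \<phi>x p + snd h * \<phi>y p)) (at p)"
    "Ck_upto k \<O> T \<phi>x" "Ck_upto k \<O> T \<phi>y"
    by (elim conjE exE)
  then show thesis by (intro that[of \<phi>x \<phi>y]) simp_all
qed

lemma Ck_upto_decrease: "Ck_upto (Suc k) \<O> T \<phi> \<Longrightarrow> Ck_upto k \<O> T \<phi>"
proof (induction k arbitrary: \<phi>)
  case 0
  then have "continuous_on (\<O> \<union> T) \<phi>" by (rule Ck_upto_continuous)
  then show ?case by simp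
next
  case (Suc k)
  obtain \<phi>x \<phi>y where \<phi>: "continuous_on (\<O> \<union> T) \<phi>"
    "\<And>p. p \<in> \<O> \<Longrightarrow> (\<phi> has_derivative (\<lambda>h. fst h * \<phi>x p + snd h * \<phi>y p)) (at p)"
    "Ck_upto (Suc k) \<O> T \<phi>x" "Ck_upto (Suc k) \<O> T \<phi>y"
    using Suc.prems by (rule Ck_upto_SucE) (rule that)
  show ?case
  proof (rule Ck_upto_SucI[where \<phi>x = \<phi>x and \<phi>y = \<phi>y])
    show "Ck_upto k \<O> T \<phi>x" "Ck_upto k \<O> T \<phi>y"
      using \<phi>(3,4) by (simp_all only: Suc.IH)
  qed (rule \<phi>; assumption)+
qed

lemma Ck_upto_const: "Ck_upto k \<O> T (\<lambda>_. c)"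
proof (induction k arbitrary: c)
  case (Suc k)
  show ?case
  proof (rule Ck_upto_SucI[where \<phi>x = "\<lambda>_. 0" and \<phi>y = "\<lambda>_. 0"])
    show "((\<lambda>_. c) has_derivative (\<lambda>h. fst h * 0 + snd h * 0)) (at p)" for p by simp
  qed (rule Suc.IH continuous_on_const)+
qed simp

lemma Ck_upto_linear: "Ck_upto k \<O> T (\<lambda>p. a * fst p + b * snd p + c)"
proof (cases k)
  case 0
  have "continuous_on (\<O> \<union> T) (\<lambda>p. a * fst p + b * snd p + c)" by (intro continuous_intros)
  then show ?thesis by (simp add: 0)
next
  case (Suc n)
  show ?thesis unfolding Suc
  proof (rule Ck_upto_SucI[where \<phi>x = "\<lambda>_. a" and \<phi>y = "\<lambda>_. b"])
    show "continuous_on (\<O> \<union> T) (\<lambda>p. a * fst p + b * snd p + c)" by (intro continuous_intros)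
    show "((\<lambda>p. a * fst p + b * snd p + c) has_derivative (\<lambda>h. fst h * a + snd h * b)) (at p)" for p
      by (rule derivative_eq_intros refl)+ (simp add: algebra_simps)
  qed (rule Ck_upto_const)+
qed

lemma Ck_upto_add:
  "Ck_upto k \<O> T \<phi> \<Longrightarrow> Ck_upto k \<O> T \<psi> \<Longrightarrow> Ck_upto k \<O> T (\<lambda>p. \<phi> p + \<psi> p)"
proof (induction k arbitrary: \<phi> \<psi>)
  case 0 then show ?case by (simp add: continuous_on_add continuous_on_mult)
next
  case (Suc k)
  obtain \<phi>x \<phi>y where \<phi>: "continuous_on (\<O> \<union> T) \<phi>"
    "\<And>p. p \<in> \<O> \<Longrightarrow> (\<phi> has_derivative (\<lambda>h. fst h * \<phi>x p + snd h * \<phi>y p)) (at p)"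
    "Ck_upto k \<O> T \<phi>x" "Ck_upto k \<O> T \<phi>y"
    using Suc.prems(1) by (rule Ck_upto_SucE) (rule that)
  obtain \<psi>x \<psi>y where \<psi>: "continuous_on (\<O> \<union> T) \<psi>"
    "\<And>p. p \<in> \<O> \<Longrightarrow> (\<psi> has_derivative (\<lambda>h. fst h * \<psi>x p + snd h * \<psi>y p)) (at p)"
    "Ck_upto k \<O> T \<psi>x" "Ck_upto k \<O> T \<psi>y"
    using Suc.prems(2) by (rule Ck_upto_SucE) (rule that)
  show ?case
  proof (rule Ck_upto_SucI)
    show "((\<lambda>p. \<phi> p + \<psi> p) has_derivative (\<lambda>h. fst h * (\<phi>x p + \<psi>x p) + snd h * (\<phi>y p + \<psi>y p))) (at p)"
      if "p \<in> \<O>" for p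
      using has_derivative_add[OF \<phi>(2)[OF that] \<psi>(2)[OF that]] by (simp add: algebra_simps)
  qed (rule Suc.IH continuous_on_add \<phi> \<psi>)+
qed

lemma Ck_upto_mult:
  "Ck_upto k \<O> T \<phi> \<Longrightarrow> Ck_upto k \<O> T \<psi> \<Longrightarrow> Ck_upto k \<O> T (\<lambda>p. \<phi> p * \<psi> p)"
proof (induction k arbitrary: \<phi> \<psi>)
  case 0 then show ?case by (simp add: continuous_on_add continuous_on_mult)
next
  case (Suc k)
  obtain \<phi>x \<phi>y where \<phi>: "continuous_on (\<O> \<union> T) \<phi>"
    "\<And>p. p \<in> \<O> \<Longrightarrow> (\<phi> has_derivative (\<lambda>h. fst h * \<phi>x p + snd h * \<phi>y p)) (at p)"
    "Ck_upto k \<O> T \<phi>x" "Ck_upto k \<O> T \<phi>y"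
    using Suc.prems(1) by (rule Ck_upto_SucE) (rule that)
  obtain \<psi>x \<psi>y where \<psi>: "continuous_on (\<O> \<union> T) \<psi>"
    "\<And>p. p \<in> \<O> \<Longrightarrow> (\<psi> has_derivative (\<lambda>h. fst h * \<psi>x p + snd h * \<psi>y p)) (at p)"
    "Ck_upto k \<O> T \<psi>x" "Ck_upto k \<O> T \<psi>y"
    using Suc.prems(2) by (rule Ck_upto_SucE) (rule that)
  have k: "Ck_upto k \<O> T \<phi>" "Ck_upto k \<O> T \<psi>" using Suc.prems by (auto intro: Ck_upto_decrease)
  show ?case
  proof (rule Ck_upto_SucI)
    show "((\<lambda>p. \<phi> p * \<psi> p) has_derivative (\<lambda>h. fst h * (\<phi> p * \<psi>x p + \<phi>x p * \<psi> p)
        + snd h * (\<phi> p * \<psi>y p + \<phi>y p * \<psi> p))) (at p)"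
      if "p \<in> \<O>" for p
      using has_derivative_mult[OF \<phi>(2)[OF that] \<psi>(2)[OF that]] by (simp add: algebra_simps)
    show "Ck_upto k \<O> T (\<lambda>p. \<phi> p * \<psi>x p + \<phi>x p * \<psi> p)" "Ck_upto k \<O> T (\<lambda>p. \<phi> p * \<psi>y p + \<phi>y p * \<psi> p)"
      by (intro Ck_upto_add Suc.IH k \<phi> \<psi>)+
  qed (rule continuous_on_mult \<phi> \<psi>)+
qed

text \<open>
  The functions \<open>t\<^bsup>-m\<^esup> e\<^bsup>-1/t\<^esup>\<close> are closed under differentiation up to linear combinations, so that
  the smoothness of \<open>e\<^bsup>-1/t\<^esup>\<close> becomes an induction on the order that treats all of them at once.
\<close>

definition flat :: "nat \<Rightarrow> real \<Rightarrow> real" where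
  "flat m t = (if t > 0 then exp (- 1 / t) / t ^ m else 0)"

lemma flat_nonneg: "0 \<le> flat m t" by (simp add: flat_def)

text \<open>
  A single term of the exponential series for \<open>1/t\<close>, of order two more than the pole that it has
  to beat.  The quadratic decay makes the derivative at the origin vanish.
\<close>

lemma flat_le: "flat m t \<le> fact (m + 2) * t\<^sup>2"
proof (cases "t > 0")
  case True
  define c :: real where "c = fact (m + 2)"
  have c: "c > 0" unfolding c_def by (rule fact_gt_zero)
  have "(1/t) ^ (m + 2) /\<^sub>R c \<le> (\<Sum>n. (1/t) ^ n /\<^sub>R fact n)"
    using sum_le_suminf[OF summable_exp_generic, of "{m + 2}" "1/t"] True by (simp add: c_def)
  also have "\<dots> = exp (1/t)" by (simp add: exp_def)
  finally have "1 \<le> exp (1/t) * (c * (t ^ m * t\<^sup>2))"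
    using True c by (simp add: field_simps power_add power2_eq_square)
  then have "exp (- 1/t) * 1 \<le> exp (- 1/t) * (exp (1/t) * (c * (t ^ m * t\<^sup>2)))"
    by (intro mult_left_mono) auto
  also have "\<dots> = c * (t ^ m * t\<^sup>2)" by (simp add: exp_minus)
  finally show ?thesis unfolding c_def[symmetric] using True by (simp add: flat_def divide_le_eq mult_ac)
qed (simp add: flat_def)

lemma flat_has_derivative:
  "(flat m has_real_derivative (flat (m + 2) t - m * flat (m + 1) t)) (at t)"
proof -
  consider "t > 0" | "t < 0" | "t = 0" by linarith
  then show ?thesis
  proof cases
    case 1
    have "((\<lambda>t. exp (- 1 / t) / t ^ m) has_real_derivative
        (exp (- 1 / t) / t ^ (m + 2) - m * (exp (- 1 / t) / t ^ (m + 1)))) (at t)"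
      using 1 by (auto intro!: derivative_eq_intros simp: field_simps power_add power2_eq_square)
        (cases m; simp add: field_simps)
    then show ?thesis
      by (rule has_field_derivative_transform_within_open[where S = "{0<..}", THEN DERIV_cong])
        (use 1 in \<open>auto simp: flat_def\<close>)
  next
    case 2
    have "((\<lambda>_. 0) has_real_derivative 0) (at t)" by simp
    then show ?thesis
      by (rule has_field_derivative_transform_within_open[where S = "{..<0}", THEN DERIV_cong])
        (use 2 in \<open>auto simp: flat_def\<close>)
  next
    case 3
    have "((\<lambda>h. flat m h / h) \<longlongrightarrow> 0) (at 0)"
    proof (rule Lim_null_comparison)
      show "\<forall>\<^sub>F h in at 0. norm (flat m h / h) \<le> fact (m + 2) * \<bar>h\<bar>"
        unfolding eventually_at_filter
      proof (intro always_eventually allI impI)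
        fix h :: real assume "h \<noteq> 0"
        then show "norm (flat m h / h) \<le> fact (m + 2) * \<bar>h\<bar>"
          using flat_le[of m h] flat_nonneg[of m h]
          by (simp add: abs_divide divide_le_eq power2_eq_square mult.assoc abs_mult_self_eq)
      qed
      have "((\<lambda>h::real. fact (m + 2) * \<bar>h\<bar>) \<longlongrightarrow> fact (m + 2) * \<bar>0\<bar>) (at 0)" by (intro tendsto_intros)
      then show "((\<lambda>h::real. fact (m + 2) * \<bar>h\<bar>) \<longlongrightarrow> 0) (at 0)" by simp
    qed
    then show ?thesis unfolding 3 by (simp add: DERIV_def flat_def)
  qed
qed

lemma Ck_upto_flat: "Ck_upto k \<O> T s \<Longrightarrow> Ck_upto k \<O> T (\<lambda>p. flat m (s p))"
proof (induction k arbitrary: m s)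
  have cont: "continuous_on A (\<lambda>p. flat m (s p))" if "continuous_on A s" for A m and s :: "real \<times> real \<Rightarrow> real"
  proof (rule continuous_on_compose2[OF _ that])
    show "continuous_on UNIV (flat m)"
      by (rule DERIV_continuous_on) (rule has_field_derivative_at_within[OF flat_has_derivative])
  qed auto
  {
    case 0 then show ?case by (simp add: cont)
  next
    case (Suc k)
    obtain sx sy where s: "continuous_on (\<O> \<union> T) s"
      "\<And>p. p \<in> \<O> \<Longrightarrow> (s has_derivative (\<lambda>h. fst h * sx p + snd h * sy p)) (at p)"
      "Ck_upto k \<O> T sx" "Ck_upto k \<O> T sy"
      using Suc.prems by (rule Ck_upto_SucE) (rule that)
    have k: "Ck_upto k \<O> T s" using Suc.prems by (rule Ck_upto_decrease)
    define d where "d p = flat (m + 2) (s p) + (- real m) * flat (m + 1) (s p)" for p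
    have d: "Ck_upto k \<O> T d" unfolding d_def
      by (rule Ck_upto_add[OF Suc.IH[OF k] Ck_upto_mult[OF Ck_upto_const Suc.IH[OF k]]])
    show ?case
    proof (rule Ck_upto_SucI)
      fix p assume "p \<in> \<O>"
      have "(flat m has_derivative (\<lambda>h. d p * h)) (at (s p))"
        using flat_has_derivative[of m "s p"] by (simp add: d_def has_field_derivative_def)
      from has_derivative_compose[OF s(2)[OF \<open>p \<in> \<O>\<close>] this]
      show "((\<lambda>p. flat m (s p)) has_derivative (\<lambda>h. fst h * (d p * sx p) + snd h * (d p * sy p))) (at p)"
        by (simp add: algebra_simps)
    qed (rule cont s Ck_upto_mult d)+
  }
qed

text \<open>
  One factor for each side of the box: for \<open>n > 0\<close> the product is positive exactly inside, and as \<open>n\<close> grows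
  it tends to the indicator function.
\<close>

definition bump :: "nat \<Rightarrow> real \<times> real \<Rightarrow> real \<times> real \<Rightarrow> real \<times> real \<Rightarrow> real" where
  "bump n a b p =
     flat 0 (real n * (fst p - fst a)) * flat 0 (real n * (fst b - fst p)) *
     (flat 0 (real n * (snd p - snd a)) * flat 0 (real n * (snd b - snd p)))"

lemma mem_box_pair: "p \<in> box a b \<longleftrightarrow> fst a < fst p \<and> fst p < fst b \<and> snd a < snd p \<and> snd p < snd b"
  for p :: "real \<times> real"
  by (subst box_prod) (auto simp: mem_Times_iff)

lemma flat0_le_1: "flat 0 t \<le> 1" by (simp add: flat_def)

lemma bump_bounds: "0 \<le> bump n a b p" "bump n a b p \<le> 1"
  unfolding bump_def
  by (intro mult_nonneg_nonneg flat_nonneg) (intro mult_le_one mult_nonneg_nonneg flat_nonneg flat0_le_1)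

lemma bump_eq_0: "p \<notin> box a b \<Longrightarrow> bump n a b p = 0"
  unfolding bump_def mem_box_pair flat_def by (auto simp: zero_less_mult_iff)

lemma bump_tendsto_indicator: "(\<lambda>n. bump n a b p) \<longlonglongrightarrow> indicator (box a b) p"
proof (cases "p \<in> box a b")
  case True
  have "(\<lambda>n. flat 0 (real n * s)) \<longlonglongrightarrow> 1" if "s > 0" for s :: real
  proof -
    have "(\<lambda>n. exp (- (1 / s) * (1 / real n))) \<longlonglongrightarrow> exp (- (1 / s) * 0)"
      by (intro tendsto_intros lim_1_over_n)
    then have "(\<lambda>n. exp (- (1 / s) * (1 / real n))) \<longlonglongrightarrow> 1" by simp
    then show ?thesis
    proof (rule Lim_transform_eventually)
      show "\<forall>\<^sub>F n in sequentially. exp (- (1 / s) * (1 / real n)) = flat 0 (real n * s)"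
        using eventually_gt_at_top[of 0] by eventually_elim (use that in \<open>simp add: flat_def field_simps\<close>)
    qed
  qed
  then have "(\<lambda>n. bump n a b p) \<longlonglongrightarrow> 1 * 1 * (1 * 1)"
    unfolding bump_def using True by (intro tendsto_mult) (auto simp: mem_box_pair)
  then show ?thesis using True by simp
qed (simp add: bump_eq_0)

lemma Cinf0_I:
  assumes "\<And>k. Ck_upto k \<O> T \<phi>" "compact K" "K \<subseteq> \<O> \<union> T"
    "\<And>p. p \<in> \<O> \<union> T \<Longrightarrow> p \<notin> K \<Longrightarrow> \<phi> p = 0"
  shows "\<phi> \<in> Cinf0 \<O> T"
proof -
  have "\<exists>K. compact K \<and> K \<subseteq> \<O> \<union> T \<and> (\<forall>p \<in> (\<O> \<union> T) - K. \<phi> p = 0)"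
    using assms(2-4) by (intro exI[of _ K] conjI ballI) auto
  then show ?thesis using assms(1) by (simp add: Cinf0_def)
qed

lemma Cinf0_E:
  assumes "\<phi> \<in> Cinf0 \<O> T"
  obtains K where "\<And>k. Ck_upto k \<O> T \<phi>" "compact K" "K \<subseteq> \<O> \<union> T"
    "\<And>p. p \<in> \<O> \<union> T \<Longrightarrow> p \<notin> K \<Longrightarrow> \<phi> p = 0"
proof -
  from assms obtain K where "compact K" "K \<subseteq> \<O> \<union> T" "\<forall>p \<in> (\<O> \<union> T) - K. \<phi> p = 0"
    unfolding Cinf0_def mem_Collect_eq by (elim conjE exE)
  moreover have "Ck_upto k \<O> T \<phi>" for k using assms by (simp add: Cinf0_def)
  ultimately show thesis by (intro that[of K]) simp_all
qed

lemma Cinf0_add: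
  assumes "\<phi> \<in> Cinf0 \<O> T" "\<psi> \<in> Cinf0 \<O> T" shows "(\<lambda>p. \<phi> p + \<psi> p) \<in> Cinf0 \<O> T"
proof -
  obtain K where K: "\<And>k. Ck_upto k \<O> T \<phi>" "compact K" "K \<subseteq> \<O> \<union> T"
    "\<And>p. p \<in> \<O> \<union> T \<Longrightarrow> p \<notin> K \<Longrightarrow> \<phi> p = 0"
    using assms(1) by (rule Cinf0_E) (rule that)
  obtain L where L: "\<And>k. Ck_upto k \<O> T \<psi>" "compact L" "L \<subseteq> \<O> \<union> T"
    "\<And>p. p \<in> \<O> \<union> T \<Longrightarrow> p \<notin> L \<Longrightarrow> \<psi> p = 0"
    using assms(2) by (rule Cinf0_E) (rule that)
  show ?thesis
  proof (rule Cinf0_I[where K = "K \<union> L"])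
    show "compact (K \<union> L)" by (rule compact_Un[OF K(2) L(2)])
  qed (use K L in \<open>simp_all add: Ck_upto_add\<close>)
qed

lemma Cinf0_scale:
  assumes "\<phi> \<in> Cinf0 \<O> T" shows "(\<lambda>p. c * \<phi> p) \<in> Cinf0 \<O> T"
proof -
  obtain K where K: "\<And>k. Ck_upto k \<O> T \<phi>" "compact K" "K \<subseteq> \<O> \<union> T"
    "\<And>p. p \<in> \<O> \<union> T \<Longrightarrow> p \<notin> K \<Longrightarrow> \<phi> p = 0"
    using assms(1) by (rule Cinf0_E) (rule that)
  show ?thesis
    by (rule Cinf0_I[where K = K]) (use K in \<open>simp_all add: Ck_upto_mult Ck_upto_const\<close>)
qed

lemma Cinf0_zero: "(\<lambda>_. 0) \<in> Cinf0 \<O> T"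
  by (rule Cinf0_I[where K = "{}"]) (simp_all add: Ck_upto_const)

lemma bump_test_function:
  assumes "cbox a b \<subseteq> \<O>" shows "bump n a b \<in> Cinf0 \<O> {}"
proof (rule Cinf0_I[where K = "cbox a b"])
  fix k
  have "Ck_upto k \<O> {} (\<lambda>p. flat 0 (real n * (fst p - fst a)))"
    using Ck_upto_flat[OF Ck_upto_linear[of k \<O> "{}" "real n" 0 "- n * fst a"]] by (simp add: algebra_simps)
  moreover have "Ck_upto k \<O> {} (\<lambda>p. flat 0 (real n * (fst b - fst p)))"
    using Ck_upto_flat[OF Ck_upto_linear[of k \<O> "{}" "- real n" 0 "n * fst b"]] by (simp add: algebra_simps)
  moreover have "Ck_upto k \<O> {} (\<lambda>p. flat 0 (real n * (snd p - snd a)))"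
    using Ck_upto_flat[OF Ck_upto_linear[of k \<O> "{}" 0 "real n" "- n * snd a"]] by (simp add: algebra_simps)
  moreover have "Ck_upto k \<O> {} (\<lambda>p. flat 0 (real n * (snd b - snd p)))"
    using Ck_upto_flat[OF Ck_upto_linear[of k \<O> "{}" 0 "- real n" "n * snd b"]] by (simp add: algebra_simps)
  ultimately show "Ck_upto k \<O> {} (bump n a b)" unfolding bump_def[abs_def] by (simp only: Ck_upto_mult)
next
  fix p assume "p \<notin> cbox a b"
  then show "bump n a b p = 0" using box_subset_cbox[of a b] by (intro bump_eq_0) auto
qed (use assms in auto)

section \<open>Weak derivatives\<close>

text \<open>
  Test functions and their derivatives have this property, and it is all that passing to the limit
  in the definition of a weak derivative requires.
\<close>

definition compactly_supported_on :: "(real \<times> real) set \<Rightarrow> (real \<times> real \<Rightarrow> real) \<Rightarrow> bool" where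
  "compactly_supported_on \<O> \<zeta> \<longleftrightarrow> continuous_on \<O> \<zeta> \<and>
     (\<exists>K. compact K \<and> K \<subseteq> \<O> \<and> (\<forall>p\<in>\<O> - K. \<zeta> p = 0))"

lemma compactly_supported_onE:
  assumes "compactly_supported_on \<O> \<zeta>"
  obtains K where "continuous_on \<O> \<zeta>" "compact K" "K \<subseteq> \<O>" "\<And>p. p \<in> \<O> \<Longrightarrow> p \<notin> K \<Longrightarrow> \<zeta> p = 0"
proof -
  from assms obtain K where "continuous_on \<O> \<zeta>" "compact K" "K \<subseteq> \<O>" "\<forall>p\<in>\<O> - K. \<zeta> p = 0"
    unfolding compactly_supported_on_def by (elim conjE exE)
  then show thesis by (intro that[of K]) simp_all
qed

lemma compactly_supported_onI:
  assumes "continuous_on \<O> \<zeta>" "compact K" "K \<subseteq> \<O>" "\<And>p. p \<in> \<O> \<Longrightarrow> p \<notin> K \<Longrightarrow> \<zeta> p = 0"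
  shows "compactly_supported_on \<O> \<zeta>"
  unfolding compactly_supported_on_def using assms by (intro conjI exI[of _ K]) auto

lemma continuous_on_compact_bounded:
  fixes \<zeta> :: "'a::topological_space \<Rightarrow> real"
  assumes "continuous_on K \<zeta>" "compact K"
  obtains B where "B \<ge> 0" "\<And>p. p \<in> K \<Longrightarrow> \<bar>\<zeta> p\<bar> \<le> B"
proof -
  have "bounded (\<zeta> ` K)" using assms by (intro compact_imp_bounded compact_continuous_image)
  then obtain B where "B > 0" "\<forall>x\<in>\<zeta> ` K. norm x \<le> B" by (auto simp: bounded_pos)
  then show thesis by (intro that[of B]) auto
qed

lemma continuous_imp_locally_integrable:
  assumes "continuous_on \<O> u" shows "locally_integrable \<O> u"
  unfolding locally_integrable_def set_integrable_def
proof (intro allI impI)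
  fix K assume "compact K \<and> K \<subseteq> \<O>"
  then show "integrable lborel (\<lambda>x. indicat_real K x *\<^sub>R u x)"
    using assms by (intro borel_integrable_compact) (auto intro: continuous_on_subset)
qed

lemma locally_integrable_lincomb:
  assumes "locally_integrable \<O> u" "locally_integrable \<O> v"
  shows "locally_integrable \<O> (\<lambda>p. a * u p + b * v p)"
  using assms unfolding locally_integrable_def by (auto intro!: set_integral_add)

lemma set_integrable_locally_integrable_mult:
  assumes u: "locally_integrable \<O> u" and \<zeta>: "compactly_supported_on \<O> \<zeta>"
  shows "set_integrable lborel \<O> (\<lambda>p. u p * \<zeta> p)"
proof -
  obtain K where K: "continuous_on \<O> \<zeta>" "compact K" "K \<subseteq> \<O>" "\<And>p. p \<in> \<O> \<Longrightarrow> p \<notin> K \<Longrightarrow> \<zeta> p = 0"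
    using \<zeta> by (rule compactly_supported_onE) (rule that)
  have cK: "continuous_on K \<zeta>" using K by (auto intro: continuous_on_subset)
  obtain B where B: "B \<ge> 0" "\<And>p. p \<in> K \<Longrightarrow> \<bar>\<zeta> p\<bar> \<le> B"
    using cK K(2) by (rule continuous_on_compact_bounded) (rule that)
  have iu: "integrable lborel (\<lambda>p. indicator K p *\<^sub>R u p)"
    using u K unfolding locally_integrable_def set_integrable_def by blast
  have [measurable]: "(\<lambda>p. indicator K p *\<^sub>R \<zeta> p) \<in> borel_measurable borel"
    using cK K(2) by (intro borel_measurable_continuous_on_indicator) (auto simp: borel_compact)
  have eq: "indicator \<O> p *\<^sub>R (u p * \<zeta> p) = (indicator K p *\<^sub>R u p) * (indicator K p *\<^sub>R \<zeta> p)" for p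
    using K(3,4) by (auto simp: indicator_def)
  show ?thesis unfolding set_integrable_def eq
  proof (rule Bochner_Integration.integrable_bound)
    show "integrable lborel (\<lambda>p. B * (indicator K p *\<^sub>R u p))" using iu by simp
    show "(\<lambda>p. (indicator K p *\<^sub>R u p) * (indicator K p *\<^sub>R \<zeta> p)) \<in> borel_measurable lborel"
      using borel_measurable_integrable[OF iu] by measurable
    have "norm (indicator K p *\<^sub>R u p * (indicator K p *\<^sub>R \<zeta> p)) \<le> norm (B * (indicator K p *\<^sub>R u p))" for p
      using B(1) B(2)[of p] by (auto simp: indicator_def abs_mult mult.commute[of B] intro!: mult_left_mono)
    then show "AE p in lborel. norm (indicator K p *\<^sub>R u p * (indicator K p *\<^sub>R \<zeta> p))
        \<le> norm (B * (indicator K p *\<^sub>R u p))" by simp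
  qed
qed

lemma test_function_compactly_supported:
  assumes "\<phi> \<in> Cinf0 \<O> {}" shows "compactly_supported_on \<O> \<phi>"
proof -
  obtain K where K: "\<And>k. Ck_upto k \<O> {} \<phi>" "compact K" "K \<subseteq> \<O> \<union> {}"
    "\<And>p. p \<in> \<O> \<union> {} \<Longrightarrow> p \<notin> K \<Longrightarrow> \<phi> p = 0"
    using assms by (rule Cinf0_E) (rule that)
  show ?thesis
    by (rule compactly_supported_onI[of _ _ K]) (use K Ck_upto_continuous[OF K(1)[of 0]] in simp_all)
qed

text \<open>
  The third claim gives the derivative a continuous extension to \<open>T\<close>, where the function itself
  need not be differentiable.  It bounds the derivative up to the boundary.
\<close>

lemma Ck_upto_frechet:
  assumes "Ck_upto (Suc 0) \<O> T \<phi>" "open \<O>"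
  shows "\<And>p. p \<in> \<O> \<Longrightarrow> (\<phi> has_derivative frechet_derivative \<phi> (at p)) (at p)"
    and "continuous_on \<O> (\<lambda>p. frechet_derivative \<phi> (at p) e)"
    and "\<exists>\<phi>'. continuous_on (\<O> \<union> T) \<phi>' \<and> (\<forall>p\<in>\<O>. frechet_derivative \<phi> (at p) e = \<phi>' p)"
proof -
  obtain \<phi>x \<phi>y where \<phi>: "continuous_on (\<O> \<union> T) \<phi>"
    "\<And>p. p \<in> \<O> \<Longrightarrow> (\<phi> has_derivative (\<lambda>h. fst h * \<phi>x p + snd h * \<phi>y p)) (at p)"
    "Ck_upto 0 \<O> T \<phi>x" "Ck_upto 0 \<O> T \<phi>y"
    using assms(1) by (rule Ck_upto_SucE) (rule that)
  have f: "frechet_derivative \<phi> (at p) = (\<lambda>h. fst h * \<phi>x p + snd h * \<phi>y p)" if "p \<in> \<O>" for p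
    using frechet_derivative_at[OF \<phi>(2)[OF that]] by simp
  show "(\<phi> has_derivative frechet_derivative \<phi> (at p)) (at p)" if "p \<in> \<O>" for p
    using \<phi>(2)[OF that] f[OF that] by simp
  have c: "continuous_on (\<O> \<union> T) (\<lambda>p. fst e * \<phi>x p + snd e * \<phi>y p)"
    using \<phi>(3,4) by (intro continuous_intros) simp_all
  then show *: "\<exists>\<phi>'. continuous_on (\<O> \<union> T) \<phi>' \<and> (\<forall>p\<in>\<O>. frechet_derivative \<phi> (at p) e = \<phi>' p)"
    by (intro exI[of _ "\<lambda>p. fst e * \<phi>x p + snd e * \<phi>y p"]) (simp add: f)
  have "continuous_on \<O> (\<lambda>p. fst e * \<phi>x p + snd e * \<phi>y p)"
    using c by (rule continuous_on_subset) simp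
  then show "continuous_on \<O> (\<lambda>p. frechet_derivative \<phi> (at p) e)"
    by (rule continuous_on_eq) (simp add: f)
qed

lemma frechet_derivative_outside_support:
  fixes \<phi> :: "'a::real_normed_vector \<Rightarrow> 'b::real_normed_vector"
  assumes "open U" "\<And>q. q \<in> U \<Longrightarrow> \<phi> q = 0" "p \<in> U"
  shows "frechet_derivative \<phi> (at p) = (\<lambda>_. 0)"
proof -
  have "(\<phi> has_derivative (\<lambda>_. 0)) (at p)"
    by (rule has_derivative_transform_within_open[OF has_derivative_const[of 0] assms(1,3)])
      (use assms(2) in simp)
  then show ?thesis using frechet_derivative_at by metis
qed

lemma test_function_derivative_compactly_supported:
  assumes \<phi>: "\<phi> \<in> Cinf0 \<O> {}" and "open \<O>"
  shows "compactly_supported_on \<O> (\<lambda>p. frechet_derivative \<phi> (at p) e)"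
proof -
  obtain K where K: "\<And>k. Ck_upto k \<O> {} \<phi>" "compact K" "K \<subseteq> \<O> \<union> {}"
    "\<And>p. p \<in> \<O> \<union> {} \<Longrightarrow> p \<notin> K \<Longrightarrow> \<phi> p = 0"
    using assms(1) by (rule Cinf0_E) (rule that)
  have "open (\<O> - K)" using \<open>open \<O>\<close> K by (simp add: open_Diff compact_imp_closed)
  then have "frechet_derivative \<phi> (at p) = (\<lambda>_. 0)" if "p \<in> \<O>" "p \<notin> K" for p
    by (rule frechet_derivative_outside_support) (use that K(4) in auto)
  then show ?thesis
    by (intro compactly_supported_onI[of _ _ K]) (use K Ck_upto_frechet(2)[OF K(1) \<open>open \<O>\<close>] in simp_all)
qed

text \<open>
  By translation invariance of Lebesgue measure the difference quotients of a compactly supported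
  function have integral zero; they converge boundedly to the directional derivative.
\<close>

lemma integral_directional_derivative_eq_0:
  fixes F G :: "'a::euclidean_space \<Rightarrow> real"
  assumes F: "\<And>p. (F has_derivative F' p) (at p)" and G: "\<And>p. F' p e = G p"
    and cont: "continuous_on K G" and K: "compact K" "\<And>p. p \<notin> K \<Longrightarrow> F p = 0" "\<And>p. p \<notin> K \<Longrightarrow> G p = 0"
  shows "(\<integral>p. G p \<partial>lborel) = 0"
proof -
  obtain B where B: "B \<ge> 0" "\<And>p. p \<in> K \<Longrightarrow> \<bar>G p\<bar> \<le> B"
    using cont K(1) by (rule continuous_on_compact_bounded) (rule that)
  have GB: "\<bar>G p\<bar> \<le> B" for p using B K(3)[of p] by (cases "p \<in> K") auto
  obtain R where R: "R \<ge> 0" "\<And>p. p \<in> K \<Longrightarrow> norm p \<le> R"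
    using K(1) compact_imp_bounded by (metis bounded_pos less_imp_le)
  have contF: "continuous_on A F" for A
    using F by (intro has_derivative_continuous_on) (auto intro: has_derivative_at_withinI)
  have [measurable]: "F \<in> borel_measurable borel" using contF by (rule borel_measurable_continuous_onI)
  have F_int: "integrable lborel F"
  proof -
    have "integrable lborel (\<lambda>x. indicator K x *\<^sub>R F x)" by (rule borel_integrable_compact[OF K(1) contF])
    moreover have "indicator K x *\<^sub>R F x = F x" for x using K(2)[of x] by (cases "x \<in> K") auto
    ultimately show ?thesis by (simp only:)
  qed
  have shift: "integrable lborel (\<lambda>p. F (c + p))" "(\<integral>p. F (c + p) \<partial>lborel) = (\<integral>p. F p \<partial>lborel)" for c
  proof -
    have "integrable (distr lborel borel ((+) c)) F" by (simp add: lborel_distr_plus F_int)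
    then show "integrable lborel (\<lambda>p. F (c + p))" by (subst (asm) integrable_distr_eq) auto
    have "(\<integral>p. F p \<partial>lborel) = (\<integral>p. F p \<partial>distr lborel borel ((+) c))" by (simp add: lborel_distr_plus)
    also have "\<dots> = (\<integral>p. F (c + p) \<partial>lborel)" by (subst integral_distr) auto
    finally show "(\<integral>p. F (c + p) \<partial>lborel) = (\<integral>p. F p \<partial>lborel)" by simp
  qed
  have line: "((\<lambda>t. F (p + t *\<^sub>R e)) has_real_derivative G (p + t *\<^sub>R e)) (at t)" for p t
  proof -
    have "((\<lambda>t. p + t *\<^sub>R e) has_derivative (\<lambda>h. h *\<^sub>R e)) (at t)"
      by (auto intro!: derivative_eq_intros)
    from has_derivative_compose[OF this F]
    have d: "((\<lambda>t. F (p + t *\<^sub>R e)) has_derivative (\<lambda>h. F' (p + t *\<^sub>R e) (h *\<^sub>R e))) (at t)" .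
    have "linear (F' (p + t *\<^sub>R e))" using F has_derivative_linear by blast
    then have "F' (p + t *\<^sub>R e) (h *\<^sub>R e) = G (p + t *\<^sub>R e) * h" for h
      by (simp add: linear_scale G mult.commute)
    with d show ?thesis by (simp add: has_field_derivative_def)
  qed
  define h where "h n = 1 / real (Suc n)" for n
  have h: "0 < h n" "h n \<le> 1" for n by (auto simp: h_def)
  define q where "q n p = (F (h n *\<^sub>R e + p) - F p) / h n" for n p
  \<comment> \<open>contains the supports of all difference quotients with step at most 1\<close>
  define S where "S = cball (0::'a) (R + norm e)"
  have "(\<lambda>n. \<integral>p. q n p \<partial>lborel) \<longlonglongrightarrow> (\<integral>p. G p \<partial>lborel)"
  proof (rule integral_dominated_convergence)
    have "G p = indicator K p *\<^sub>R G p" for p using K(3)[of p] by (cases "p \<in> K") auto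
    then have "G = (\<lambda>p. indicator K p *\<^sub>R G p)" by (rule ext)
    also have "\<dots> \<in> borel_measurable borel"
      using cont K(1) by (intro borel_measurable_continuous_on_indicator) (auto simp: borel_compact)
    finally show "G \<in> borel_measurable lborel" by simp
    show "q n \<in> borel_measurable lborel" for n unfolding q_def by measurable
    show "integrable lborel (\<lambda>p. B * indicator S p)"
      using emeasure_lborel_cball_finite[of 0 "R + norm e"]
      by (intro integrable_mult_right integrable_real_indicator) (simp_all add: S_def)
    show "AE p in lborel. (\<lambda>n. q n p) \<longlonglongrightarrow> G p"
    proof (intro always_eventually allI)
      fix p
      have "((\<lambda>t. (F (p + t *\<^sub>R e) - F p) / t) \<longlongrightarrow> G p) (at 0)"
        using line[of p 0] by (simp add: DERIV_def)
      moreover have "filterlim h (at 0) sequentially"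
        unfolding filterlim_at
      proof
        show "\<forall>\<^sub>F n in sequentially. h n \<in> UNIV \<and> h n \<noteq> 0" by (simp add: h_def)
        show "h \<longlonglongrightarrow> 0" unfolding h_def using LIMSEQ_inverse_real_of_nat by (simp add: inverse_eq_divide)
      qed
      ultimately have "((\<lambda>n. (F (p + h n *\<^sub>R e) - F p) / h n) \<longlongrightarrow> G p) sequentially"
        by (rule filterlim_compose)
      then show "(\<lambda>n. q n p) \<longlonglongrightarrow> G p" by (simp add: q_def add.commute)
    qed
    show "AE p in lborel. norm (q n p) \<le> B * indicator S p" for n
    proof (intro always_eventually allI)
      fix p
      show "norm (q n p) \<le> B * indicator S p"
      proof (cases "p \<in> S")
        case True
        obtain z where z: "F (p + h n *\<^sub>R e) - F (p + 0 *\<^sub>R e) = (h n - 0) * G (p + z *\<^sub>R e)"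
          using MVT2[OF h(1), of n "\<lambda>t. F (p + t *\<^sub>R e)" "\<lambda>t. G (p + t *\<^sub>R e)"] line by blast
        then have "q n p = G (p + z *\<^sub>R e)" using h(1)[of n] by (simp add: q_def add.commute)
        then show ?thesis using True GB by simp
      next
        case False
        have "norm (h n *\<^sub>R e) \<le> norm e" using h[of n] by (simp add: mult_left_le_one_le)
        moreover have "norm p \<le> norm (h n *\<^sub>R e + p) + norm (h n *\<^sub>R e)"
          using norm_triangle_ineq4[of "h n *\<^sub>R e + p" "h n *\<^sub>R e"] by simp
        ultimately have "p \<notin> K" "h n *\<^sub>R e + p \<notin> K"
          using False R(2)[of p] R(2)[of "h n *\<^sub>R e + p"] norm_ge_zero[of e] by (auto simp: S_def)
        then show ?thesis using False by (simp add: q_def K(2))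
      qed
    qed
  qed
  moreover have "(\<integral>p. q n p \<partial>lborel) = 0" for n
    unfolding q_def using shift[of "h n *\<^sub>R e"] F_int by simp
  ultimately show ?thesis by (simp add: LIMSEQ_const_iff)
qed

lemma integration_by_parts:
  assumes O: "open \<O>" and \<phi>: "Ck_upto (Suc 0) \<O> T \<phi>" and \<psi>: "\<psi> \<in> Cinf0 \<O> {}"
  shows "(LINT p:\<O>|lborel. \<phi> p * frechet_derivative \<psi> (at p) e)
       = - (LINT p:\<O>|lborel. frechet_derivative \<phi> (at p) e * \<psi> p)"
proof -
  obtain K where K: "\<And>k. Ck_upto k \<O> {} \<psi>" "compact K" "K \<subseteq> \<O> \<union> {}"
    "\<And>p. p \<in> \<O> \<union> {} \<Longrightarrow> p \<notin> K \<Longrightarrow> \<psi> p = 0"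
    using \<psi> by (rule Cinf0_E) (rule that)
  note \<phi>' = Ck_upto_frechet[OF \<phi> O] and \<psi>' = Ck_upto_frechet[OF K(1) O]
  have c\<phi>: "continuous_on \<O> \<phi>" using Ck_upto_continuous[OF \<phi>] by (rule continuous_on_subset) simp
  have c\<psi>: "continuous_on \<O> \<psi>" using Ck_upto_continuous[OF K(1)[of 0]] by simp
  have openK: "open (\<O> - K)" using O K by (simp add: open_Diff compact_imp_closed)
  have zero: "frechet_derivative \<psi> (at p) = (\<lambda>_. 0)" if "p \<in> \<O>" "p \<notin> K" for p
    by (rule frechet_derivative_outside_support[OF openK]) (use that K(4) in auto)
  define F where "F p = (if p \<in> \<O> then \<phi> p * \<psi> p else 0)" for p
  define F' where "F' p h = (if p \<in> \<O> then \<phi> p * frechet_derivative \<psi> (at p) h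
      + frechet_derivative \<phi> (at p) h * \<psi> p else 0)" for p h
  have "(F has_derivative F' p) (at p)" for p
  proof (cases "p \<in> \<O>")
    case True
    have "((\<lambda>p. \<phi> p * \<psi> p) has_derivative F' p) (at p)"
      using has_derivative_mult[OF \<phi>'(1) \<psi>'(1), OF True True] True by (simp add: F'_def[abs_def])
    then show ?thesis
      by (rule has_derivative_transform_within_open[OF _ O True]) (simp add: F_def)
  next
    case False
    have "((\<lambda>_. 0) has_derivative F' p) (at p)" using False by (simp add: F'_def[abs_def])
    then show ?thesis
      by (rule has_derivative_transform_within_open[where s = "- K"])
        (use False K in \<open>auto simp: F_def compact_imp_closed\<close>)
  qed
  moreover have "continuous_on K (\<lambda>p. F' p e)"
  proof -
    have "continuous_on \<O> (\<lambda>p. \<phi> p * frechet_derivative \<psi> (at p) e + frechet_derivative \<phi> (at p) e * \<psi> p)"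
      by (intro continuous_intros c\<phi> c\<psi> \<phi>' \<psi>')
    then have "continuous_on \<O> (\<lambda>p. F' p e)" by (rule continuous_on_eq) (simp add: F'_def)
    then show ?thesis by (rule continuous_on_subset) (use K in simp)
  qed
  ultimately have "(\<integral>p. F' p e \<partial>lborel) = 0"
    by (rule integral_directional_derivative_eq_0[OF _ refl _ K(2)])
      (use K zero in \<open>auto simp: F_def F'_def\<close>)
  moreover have "set_integrable lborel \<O> (\<lambda>p. \<phi> p * frechet_derivative \<psi> (at p) e)"
    by (intro set_integrable_locally_integrable_mult continuous_imp_locally_integrable c\<phi>
        test_function_derivative_compactly_supported \<psi> O)
  moreover have "set_integrable lborel \<O> (\<lambda>p. frechet_derivative \<phi> (at p) e * \<psi> p)"
    by (intro set_integrable_locally_integrable_mult continuous_imp_locally_integrable \<phi>'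
        test_function_compactly_supported \<psi>)
  ultimately have "(LINT p:\<O>|lborel. \<phi> p * frechet_derivative \<psi> (at p) e)
      + (LINT p:\<O>|lborel. frechet_derivative \<phi> (at p) e * \<psi> p)
      = (LINT p:\<O>|lborel. \<phi> p * frechet_derivative \<psi> (at p) e + frechet_derivative \<phi> (at p) e * \<psi> p)"
    by (intro set_integral_add(2)[symmetric])
  also have "\<dots> = (\<integral>p. F' p e \<partial>lborel)"
    unfolding set_lebesgue_integral_def
    by (intro Bochner_Integration.integral_cong) (simp_all add: F'_def)
  also note \<open>(\<integral>p. F' p e \<partial>lborel) = 0\<close>
  finally show ?thesis by linarith
qed

lemma classical_imp_weak_deriv:
  assumes O: "open \<O>" and \<phi>: "Ck_upto (Suc 0) \<O> T \<phi>"
  shows "has_weak_deriv \<O> e \<phi> (\<lambda>p. frechet_derivative \<phi> (at p) e)"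
proof -
  have "continuous_on \<O> \<phi>" using Ck_upto_continuous[OF \<phi>] by (rule continuous_on_subset) simp
  then show ?thesis unfolding has_weak_deriv_def
    using integration_by_parts[OF O \<phi>] Ck_upto_frechet(2)[OF \<phi> O] continuous_imp_locally_integrable
    by blast
qed

text \<open>
  Boxes are stable under intersection and generate the Borel sets, so the integral vanishes over
  every Borel set by Dynkin's theorem.  The hypothesis on the total integral provides closure under
  complements.
\<close>

lemma integral_boxes_eq_0_imp_AE:
  fixes h :: "'a::euclidean_space \<Rightarrow> real"
  assumes h: "integrable lborel h" and tot: "(\<integral>p. h p \<partial>lborel) = 0"
    and box: "\<And>a b. (LINT p:box a b|lborel. h p) = 0"
  shows "AE p in lborel. h p = 0"
proof (rule density_unique_real[OF h integrable_zero])
  fix A :: "'a set" assume "A \<in> sets lborel"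
  then have "A \<in> sets borel" by simp
  then have A: "A \<in> sigma_sets UNIV (range (\<lambda>(a, b). box a b))"
    unfolding borel_eq_box by simp
  have "Int_stable (range (\<lambda>(a, b). box a b :: 'a set))"
    by (auto simp: Int_stable_def box_Int_box)
  moreover have "range (\<lambda>(a, b). box a b :: 'a set) \<subseteq> Pow UNIV" by auto
  ultimately have "(LINT p:A|lborel. h p) = 0" using A
  proof (induction rule: sigma_sets_induct_disjoint)
    case (basic A)
    then show ?case using box by auto
  next
    case empty
    then show ?case by (simp add: set_lebesgue_integral_def)
  next
    case (compl A)
    then have A: "A \<in> sets lborel" by (simp add: borel_eq_box)
    have "set_integrable lborel A h" unfolding set_integrable_def
      using h A by (intro integrable_mult_indicator) auto
    moreover have "indicator (UNIV - A) p *\<^sub>R h p = h p - indicator A p *\<^sub>R h p" for p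
      by (auto simp: indicator_def)
    ultimately show ?case
      using compl h tot by (simp add: set_lebesgue_integral_def set_integrable_def)
  next
    case (union A)
    have A: "A i \<in> sets lborel" for i using union(2) by (auto simp: borel_eq_box)
    have "(LINT p:(\<Union>i. A i)|lborel. h p) = (\<Sum>i. LINT p:A i|lborel. h p)"
    proof (rule lebesgue_integral_countable_add)
      show "set_integrable lborel (\<Union>i. A i) h" unfolding set_integrable_def
        using h A by (intro integrable_mult_indicator) auto
      show "A i \<inter> A j = {}" if "i \<noteq> j" for i j
        using union(1) that by (auto simp: disjoint_family_on_def)
    qed (rule A)
    then show ?case using union(3) by simp
  qed
  then show "(LINT p:A|lborel. h p) = (LINT p:A|lborel. 0)" by simp
qed

text \<open>
  The fundamental lemma of the calculus of variations.  Approximating the indicator functions of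
  boxes by smooth bumps shows that the integral of \<open>g\<close> vanishes over each box whose closure lies in
  \<open>\<O>\<close>, and countably many such boxes cover \<open>\<O>\<close>.
\<close>

lemma test_functions_separate:
  assumes O: "open \<O>" and g: "locally_integrable \<O> g"
    and zero: "\<And>\<phi>. \<phi> \<in> Cinf0 \<O> {} \<Longrightarrow> (LINT p:\<O>|lborel. g p * \<phi> p) = 0"
  shows "AE p in lborel. p \<in> \<O> \<longrightarrow> g p = 0"
proof -
  have int_cbox: "integrable lborel (\<lambda>p. indicator (cbox a b) p *\<^sub>R g p)" if "cbox a b \<subseteq> \<O>" for a b
    using g that unfolding locally_integrable_def set_integrable_def by (simp add: compact_cbox)
  have int_box: "set_integrable lborel (box a b) g" if "cbox a b \<subseteq> \<O>" for a b
    by (rule set_integrable_subset[of _ "cbox a b"])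
      (use int_cbox[OF that] box_subset_cbox in \<open>auto simp: set_integrable_def\<close>)
  have box0: "(LINT p:box a b|lborel. g p) = 0" if ab: "cbox a b \<subseteq> \<O>" for a b
  proof -
    have eq: "indicator \<O> p *\<^sub>R (g p * bump n a b p) = (indicator (cbox a b) p *\<^sub>R g p) * bump n a b p" for n p
      using ab bump_eq_0[of p a b n] box_subset_cbox[of a b] by (auto simp: indicator_def)
    have "(\<lambda>n. \<integral>p. indicator \<O> p *\<^sub>R (g p * bump n a b p) \<partial>lborel) \<longlonglongrightarrow> (\<integral>p. indicator (box a b) p *\<^sub>R g p \<partial>lborel)"
    proof (rule integral_dominated_convergence)
      show "(\<lambda>p. indicator (box a b) p *\<^sub>R g p) \<in> borel_measurable lborel"
        using int_box[OF ab] by (auto simp: set_integrable_def)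
      show "integrable lborel (\<lambda>p. \<bar>indicator (cbox a b) p *\<^sub>R g p\<bar>)"
        using int_cbox[OF ab] by simp
      show "(\<lambda>p. indicator \<O> p *\<^sub>R (g p * bump n a b p)) \<in> borel_measurable lborel" for n
      proof -
        have "set_integrable lborel \<O> (\<lambda>p. g p * bump n a b p)"
          by (intro set_integrable_locally_integrable_mult g test_function_compactly_supported
              bump_test_function ab)
        then show ?thesis by (auto simp: set_integrable_def)
      qed
      show "AE p in lborel. norm (indicator \<O> p *\<^sub>R (g p * bump n a b p)) \<le> \<bar>indicator (cbox a b) p *\<^sub>R g p\<bar>" for n
        unfolding eq using bump_bounds[of n a b] by (intro always_eventually allI) (simp add: abs_mult mult_left_le)
      show "AE p in lborel. (\<lambda>n. indicator \<O> p *\<^sub>R (g p * bump n a b p)) \<longlonglongrightarrow> indicator (box a b) p *\<^sub>R g p"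
      proof (intro always_eventually allI)
        fix p
        have "(\<lambda>n. (indicator (cbox a b) p *\<^sub>R g p) * bump n a b p)
            \<longlonglongrightarrow> (indicator (cbox a b) p *\<^sub>R g p) * indicator (box a b) p"
          by (intro tendsto_intros bump_tendsto_indicator)
        also have "(indicator (cbox a b) p *\<^sub>R g p) * indicator (box a b) p = indicator (box a b) p *\<^sub>R g p"
          using box_subset_cbox[of a b] by (auto simp: indicator_def)
        finally show "(\<lambda>n. indicator \<O> p *\<^sub>R (g p * bump n a b p)) \<longlonglongrightarrow> indicator (box a b) p *\<^sub>R g p"
          unfolding eq .
      qed
    qed
    moreover have "(\<integral>p. indicator \<O> p *\<^sub>R (g p * bump n a b p) \<partial>lborel) = 0" for n
      using zero[OF bump_test_function[OF ab]] by (simp add: set_lebesgue_integral_def)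
    ultimately show ?thesis by (simp add: LIMSEQ_const_iff set_lebesgue_integral_def)
  qed
  have AE_box: "AE p in lborel. p \<in> box c d \<longrightarrow> g p = 0" if cd: "cbox c d \<subseteq> \<O>" for c d
  proof -
    define h where "h p = indicator (box c d) p *\<^sub>R g p" for p
    have "AE p in lborel. h p = 0"
    proof (rule integral_boxes_eq_0_imp_AE)
      show "integrable lborel h" using int_box[OF cd] by (simp add: h_def[abs_def] set_integrable_def)
      show "(\<integral>p. h p \<partial>lborel) = 0" using box0[OF cd] by (simp add: h_def set_lebesgue_integral_def)
      fix a b
      obtain e f where ef: "box a b \<inter> box c d = box e f" unfolding box_Int_box by blast
      have "(LINT p:box a b|lborel. h p) = (LINT p:box e f|lborel. g p)"
        unfolding set_lebesgue_integral_def h_def ef[symmetric]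
        by (intro Bochner_Integration.integral_cong) (auto simp: indicator_def)
      also have "\<dots> = 0"
      proof (cases "box e f = {}")
        case True then show ?thesis by (simp add: set_lebesgue_integral_def)
      next
        case False
        then have "cbox e f = closure (box e f)" by (simp add: closure_box)
        also have "\<dots> \<subseteq> closure (box c d)" unfolding ef[symmetric] by (intro closure_mono) auto
        also have "\<dots> \<subseteq> cbox c d" by (intro closure_minimal box_subset_cbox closed_cbox)
        finally show ?thesis using cd by (intro box0) auto
      qed
      finally show "(LINT p:box a b|lborel. h p) = 0" .
    qed
    then show ?thesis by eventually_elim (auto simp: h_def)
  qed
  \<comment> \<open>corners with rational coordinates\<close>
  define Q :: "((real \<times> real) \<times> (real \<times> real)) set" where "Q = (\<rat> \<times> \<rat>) \<times> (\<rat> \<times> \<rat>)"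
  have "countable Q" unfolding Q_def by (intro countable_SIGMA countable_rat)
  then have "AE p in lborel. \<forall>(a, b)\<in>Q. cbox a b \<subseteq> \<O> \<longrightarrow> p \<in> box a b \<longrightarrow> g p = 0"
    using AE_box by (subst AE_ball_countable) auto
  then show ?thesis
  proof eventually_elim
    case (elim p)
    show ?case
    proof
      assume "p \<in> \<O>"
      then obtain e where e: "e > 0" "cball p e \<subseteq> \<O>" using O open_contains_cball by blast
      obtain a b where ab: "\<forall>i\<in>Basis. a \<bullet> i \<in> \<rat> \<and> b \<bullet> i \<in> \<rat>" "p \<in> box a b" "box a b \<subseteq> ball p e"
        using rational_boxes[OF e(1), of p] by blast
      have "cbox a b = closure (box a b)" using ab(2) by (subst closure_box) auto
      also have "\<dots> \<subseteq> cball p e" using ab(3) by (intro closure_minimal) auto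
      finally have "cbox a b \<subseteq> \<O>" using e(2) by simp
      moreover have "(a, b) \<in> Q"
        using ab(1) by (cases a; cases b) (auto simp: Q_def Basis_prod_def)
      ultimately show "g p = 0" using elim ab(2) by blast
    qed
  qed
qed

lemma weak_deriv_unique:
  assumes O: "open \<O>" and g: "has_weak_deriv \<O> e u g" and g': "has_weak_deriv \<O> e u g'"
  shows "AE p in lborel. p \<in> \<O> \<longrightarrow> g p = g' p"
proof -
  have l: "locally_integrable \<O> g" "locally_integrable \<O> g'" using g g' by (auto simp: has_weak_deriv_def)
  have "AE p in lborel. p \<in> \<O> \<longrightarrow> 1 * g p + (-1) * g' p = 0"
  proof (rule test_functions_separate[OF O])
    show "locally_integrable \<O> (\<lambda>p. 1 * g p + (-1) * g' p)" by (rule locally_integrable_lincomb[OF l])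
    fix \<phi> assume \<phi>: "\<phi> \<in> Cinf0 \<O> {}"
    note i = set_integrable_locally_integrable_mult[OF _ test_function_compactly_supported[OF \<phi>]]
    have "(LINT p:\<O>|lborel. (1 * g p + (-1) * g' p) * \<phi> p)
        = (LINT p:\<O>|lborel. g p * \<phi> p) - (LINT p:\<O>|lborel. g' p * \<phi> p)"
      by (subst set_integral_diff(2)[OF i i, OF l, symmetric]) (simp add: algebra_simps)
    also have "\<dots> = 0" using g g' \<phi> unfolding has_weak_deriv_def by fastforce
    finally show "(LINT p:\<O>|lborel. (1 * g p + (-1) * g' p) * \<phi> p) = 0" .
  qed
  then show ?thesis by eventually_elim auto
qed

lemma weak_deriv_lincomb:
  assumes O: "open \<O>" and g: "has_weak_deriv \<O> e u g" and h: "has_weak_deriv \<O> e v h"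
  shows "has_weak_deriv \<O> e (\<lambda>p. a * u p + b * v p) (\<lambda>p. a * g p + b * h p)"
proof -
  have l: "locally_integrable \<O> u" "locally_integrable \<O> g" "locally_integrable \<O> v" "locally_integrable \<O> h"
    using g h by (auto simp: has_weak_deriv_def)
  have lin: "(LINT p:\<O>|lborel. (a * f p + b * k p) * \<zeta> p)
      = a * (LINT p:\<O>|lborel. f p * \<zeta> p) + b * (LINT p:\<O>|lborel. k p * \<zeta> p)"
    if "compactly_supported_on \<O> \<zeta>" "locally_integrable \<O> f" "locally_integrable \<O> k" for f k \<zeta>
  proof -
    note i = set_integrable_locally_integrable_mult[OF _ that(1)]
    have "(LINT p:\<O>|lborel. (a * f p + b * k p) * \<zeta> p) = (LINT p:\<O>|lborel. a * (f p * \<zeta> p) + b * (k p * \<zeta> p))"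
      by (simp add: algebra_simps)
    also have "\<dots> = (LINT p:\<O>|lborel. a * (f p * \<zeta> p)) + (LINT p:\<O>|lborel. b * (k p * \<zeta> p))"
      by (intro set_integral_add(2) set_integrable_mult_right i that)
    finally show ?thesis by simp
  qed
  show ?thesis
    unfolding has_weak_deriv_def
  proof (intro conjI ballI locally_integrable_lincomb l)
    fix \<phi> assume \<phi>: "\<phi> \<in> Cinf0 \<O> {}"
    have "(LINT p:\<O>|lborel. u p * frechet_derivative \<phi> (at p) e) = - (LINT p:\<O>|lborel. g p * \<phi> p)"
      "(LINT p:\<O>|lborel. v p * frechet_derivative \<phi> (at p) e) = - (LINT p:\<O>|lborel. h p * \<phi> p)"
      using g h \<phi> unfolding has_weak_deriv_def by blast+
    then show "(LINT p:\<O>|lborel. (a * u p + b * v p) * frechet_derivative \<phi> (at p) e)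
        = - (LINT p:\<O>|lborel. (a * g p + b * h p) * \<phi> p)"
      using lin[OF test_function_derivative_compactly_supported[OF \<phi> O] l(1,3)]
        lin[OF test_function_compactly_supported[OF \<phi>] l(2,4)] by simp
  qed
qed

lemma weak_deriv_limit:
  assumes O: "open \<O>" and n: "\<And>n. has_weak_deriv \<O> e (u n) (g n)"
    and l: "locally_integrable \<O> u'" "locally_integrable \<O> g'"
    and u: "\<And>\<zeta>. compactly_supported_on \<O> \<zeta> \<Longrightarrow>
        (\<lambda>n. LINT p:\<O>|lborel. u n p * \<zeta> p) \<longlonglongrightarrow> (LINT p:\<O>|lborel. u' p * \<zeta> p)"
    and g: "\<And>\<zeta>. compactly_supported_on \<O> \<zeta> \<Longrightarrow>
        (\<lambda>n. LINT p:\<O>|lborel. g n p * \<zeta> p) \<longlonglongrightarrow> (LINT p:\<O>|lborel. g' p * \<zeta> p)"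
  shows "has_weak_deriv \<O> e u' g'"
  unfolding has_weak_deriv_def
proof (intro conjI ballI l)
  fix \<phi> assume \<phi>: "\<phi> \<in> Cinf0 \<O> {}"
  have "(LINT p:\<O>|lborel. u n p * frechet_derivative \<phi> (at p) e) = - (LINT p:\<O>|lborel. g n p * \<phi> p)" for n
    using n[of n] \<phi> unfolding has_weak_deriv_def by blast
  moreover have "(\<lambda>n. - (LINT p:\<O>|lborel. g n p * \<phi> p)) \<longlonglongrightarrow> - (LINT p:\<O>|lborel. g' p * \<phi> p)"
    by (intro tendsto_minus g test_function_compactly_supported \<phi>)
  ultimately show "(LINT p:\<O>|lborel. u' p * frechet_derivative \<phi> (at p) e) = - (LINT p:\<O>|lborel. g' p * \<phi> p)"
    using u[OF test_function_derivative_compactly_supported[OF \<phi> O, of e]]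
    by (simp add: LIMSEQ_unique)
qed

section \<open>Weighted Sobolev spaces\<close>

text \<open>
  Pointwise operations turn spaces of functions into subspaces of a real vector space, to which the
  abstract theory applies.
\<close>

instantiation "fun" :: (type, real_vector) real_vector
begin
definition "c *\<^sub>R f = (\<lambda>x. c *\<^sub>R f x)"
instance
  by standard (simp_all add: scaleR_fun_def fun_eq_iff scaleR_add_left scaleR_add_right)
end

lemma scaleR_fun_apply [simp]: "(c *\<^sub>R f) x = c *\<^sub>R f x"
  by (simp add: scaleR_fun_def)

text \<open>
  The square roots distribute the weights of the \<open>H\<^sup>1\<close> norm so that its density is the squared
  Euclidean norm of the jet.
\<close>

definition weighted_jet ::
  "(real \<times> real) set \<Rightarrow> (real \<times> real \<Rightarrow> real) \<Rightarrow> real \<times> real \<Rightarrow> real \<times> real \<times> real" where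
  "weighted_jet \<O> u p =
     (sqrt (snd p) * weak_dx \<O> u p, sqrt (snd p) * weak_dy \<O> u p, sqrt (1 + snd p) * u p)"

text \<open>
  The integrands that pair two square integrable vector fields into an integrable function: the
  inner product of \<open>H\<^sup>1\<close> and the Heston form are both of this kind.
\<close>

definition admissible_form ::
  "'a measure \<Rightarrow> real \<Rightarrow> ('a \<Rightarrow> 'b::euclidean_space \<Rightarrow> 'b \<Rightarrow> real) \<Rightarrow> bool" where
  "admissible_form M C B \<longleftrightarrow>
     (\<forall>p\<in>space M. bilinear (B p) \<and> (\<forall>X Y. \<bar>B p X Y\<bar> \<le> C * norm X * norm Y)) \<and>
     (\<forall>F\<in>borel_measurable M. \<forall>G\<in>borel_measurable M. (\<lambda>p. B p (F p) (G p)) \<in> borel_measurable M)"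

lemma admissible_formD:
  assumes "admissible_form M C B"
  shows "\<And>p. p \<in> space M \<Longrightarrow> bilinear (B p)"
    and "\<And>p X Y. p \<in> space M \<Longrightarrow> \<bar>B p X Y\<bar> \<le> C * norm X * norm Y"
    and "\<And>F G. F \<in> borel_measurable M \<Longrightarrow> G \<in> borel_measurable M \<Longrightarrow> (\<lambda>p. B p (F p) (G p)) \<in> borel_measurable M"
  using assms by (simp_all add: admissible_form_def)

lemma admissible_inner: "admissible_form M 1 (\<lambda>_. inner)"
  unfolding admissible_form_def
  by (auto simp: bilinear_conv_bounded_bilinear bounded_bilinear_inner Cauchy_Schwarz_ineq2)

lemma admissible_form_integrable:
  assumes B: "admissible_form M C B"
    and F: "F \<in> borel_measurable M" "integrable M (\<lambda>p. (norm (F p))\<^sup>2)"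
    and G: "G \<in> borel_measurable M" "integrable M (\<lambda>p. (norm (G p))\<^sup>2)"
  shows "integrable M (\<lambda>p. B p (F p) (G p))"
proof (rule Bochner_Integration.integrable_bound)
  show "integrable M (\<lambda>p. C * (norm (F p) * norm (G p)))"
    using F G by (intro integrable_mult_right integrable_mult_of_squares) auto
  show "(\<lambda>p. B p (F p) (G p)) \<in> borel_measurable M" using admissible_formD(3)[OF B] F G by blast
  have "\<bar>B p (F p) (G p)\<bar> \<le> C * (norm (F p) * norm (G p))" if "p \<in> space M" for p
    using admissible_formD(2)[OF B that, of "F p" "G p"] by (simp add: mult.assoc)
  then show "AE p in M. norm (B p (F p) (G p)) \<le> norm (C * (norm (F p) * norm (G p)))"
    by (intro AE_I2) (metis abs_ge_self order_trans real_norm_def)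
qed

lemma admissible_form_bound:
  assumes B: "admissible_form M C B" and C: "C \<ge> 0"
    and F: "F \<in> borel_measurable M" "integrable M (\<lambda>p. (norm (F p))\<^sup>2)"
    and G: "G \<in> borel_measurable M" "integrable M (\<lambda>p. (norm (G p))\<^sup>2)"
  shows "\<bar>\<integral>p. B p (F p) (G p) \<partial>M\<bar> \<le> C * sqrt (\<integral>p. (norm (F p))\<^sup>2 \<partial>M) * sqrt (\<integral>p. (norm (G p))\<^sup>2 \<partial>M)"
proof -
  have fg: "integrable M (\<lambda>p. norm (F p) * norm (G p))"
    using F G by (intro integrable_mult_of_squares) auto
  have "\<bar>\<integral>p. B p (F p) (G p) \<partial>M\<bar> \<le> (\<integral>p. \<bar>B p (F p) (G p)\<bar> \<partial>M)" by (rule integral_abs_bound)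
  also have "\<dots> \<le> (\<integral>p. C * (norm (F p) * norm (G p)) \<partial>M)"
    using admissible_formD(2)[OF B] admissible_form_integrable[OF B F G] fg
    by (intro integral_mono) (auto simp: mult.assoc)
  also have "\<dots> = C * (\<integral>p. norm (F p) * norm (G p) \<partial>M)" by simp
  also have "\<dots> \<le> C * (sqrt (\<integral>p. (norm (F p))\<^sup>2 \<partial>M) * sqrt (\<integral>p. (norm (G p))\<^sup>2 \<partial>M))"
    using integral_cauchy_schwarz[of "\<lambda>p. norm (F p)" M "\<lambda>p. norm (G p)"] F G C
    by (intro mult_left_mono) auto
  finally show ?thesis by (simp add: mult.assoc)
qed

text \<open>
  A weight that is continuous and positive inside the domain may degenerate at the boundary.  The
  last assumption limits this: the measure of bounded sets is finite up to the line \<open>y = 0\<close>, where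
  the functions that define \<open>H\<^sup>1\<^sub>0\<close> need not vanish.
\<close>

locale weighted_domain =
  fixes w :: "real \<times> real \<Rightarrow> real" and \<O> :: "(real \<times> real) set"
  assumes open_domain: "open \<O>" and domain_half_plane: "\<O> \<subseteq> half_plane"
    and w_continuous: "continuous_on \<O> w" and w_pos: "\<And>p. p \<in> \<O> \<Longrightarrow> 0 < w p"
    and w_locally_finite: "\<And>R. emeasure (wmeasure w \<O>) (\<O> \<inter> cball 0 R) < \<infinity>"
begin

abbreviation "M \<equiv> wmeasure w \<O>"
abbreviation "H \<equiv> H1 w \<O>"
abbreviation "V \<equiv> H10 w \<O>"
abbreviation "nrm \<equiv> H1_norm w \<O>"
abbreviation "\<Phi> \<equiv> weighted_jet \<O>"

lemma snd_pos: "p \<in> \<O> \<Longrightarrow> 0 < snd p"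
  using domain_half_plane by (auto simp: half_plane_def)

lemma domain_borel: "\<O> \<inter> space lborel \<in> sets lborel" "\<O> \<in> sets borel"
  using open_domain by auto

lemma space_M [simp]: "space M = \<O>"
  by (simp add: wmeasure_def space_restrict_space)

lemma borel_measurable_M: "borel_measurable M = borel_measurable (restrict_space lborel \<O>)"
  by (intro measurable_cong_sets) (auto simp: wmeasure_def)

lemma continuous_borel_measurable:
  fixes f :: "real \<times> real \<Rightarrow> 'b::topological_space"
  assumes "continuous_on \<O> f" shows "f \<in> borel_measurable M"
proof -
  have "f \<in> borel_measurable (restrict_space borel \<O>)" using assms by (rule borel_measurable_continuous_on_restrict)
  then show ?thesis unfolding borel_measurable_M
    by (subst measurable_cong_sets[OF sets_restrict_space_cong refl]) auto
qed

lemma w_measurable: "(\<lambda>p. ennreal (w p)) \<in> borel_measurable (restrict_space lborel \<O>)"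
  using continuous_borel_measurable[OF w_continuous] unfolding borel_measurable_M by measurable

lemma w_real_measurable: "w \<in> borel_measurable (restrict_space lborel \<O>)"
  using continuous_borel_measurable[OF w_continuous] by (simp add: borel_measurable_M)

lemma w_AE_nonneg: "AE p in restrict_space lborel \<O>. 0 \<le> w p"
  unfolding AE_restrict_space_iff[OF domain_borel(1)]
  by (intro always_eventually allI impI less_imp_le w_pos)

lemma AE_M: "(AE p in M. P p) \<longleftrightarrow> (AE p in lborel. p \<in> \<O> \<longrightarrow> P p)"
proof -
  have "(AE p in M. P p) \<longleftrightarrow> (AE p in lborel. p \<in> \<O> \<longrightarrow> 0 < ennreal (w p) \<longrightarrow> P p)"
    unfolding wmeasure_def AE_density[OF w_measurable] by (rule AE_restrict_space_iff[OF domain_borel(1)])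
  also have "\<dots> \<longleftrightarrow> (AE p in lborel. p \<in> \<O> \<longrightarrow> P p)"
    using w_pos by (intro AE_cong) auto
  finally show ?thesis .
qed

lemma integrable_M:
  assumes "f \<in> borel_measurable M"
  shows "integrable M f \<longleftrightarrow> set_integrable lborel \<O> (\<lambda>p. w p * f p :: real)"
proof -
  have "integrable M f \<longleftrightarrow> integrable (restrict_space lborel \<O>) (\<lambda>p. w p *\<^sub>R f p)"
    unfolding wmeasure_def
    by (rule integrable_density[OF assms[unfolded borel_measurable_M] w_real_measurable w_AE_nonneg])
  also have "\<dots> \<longleftrightarrow> set_integrable lborel \<O> (\<lambda>p. w p * f p)"
    by (simp add: integrable_restrict_space[OF domain_borel(1)] set_integrable_def)
  finally show ?thesis .
qed

lemma integral_M:
  assumes "f \<in> borel_measurable M"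
  shows "(\<integral>p. f p \<partial>M) = (LINT p:\<O>|lborel. w p * f p :: real)"
proof -
  have "(\<integral>p. f p \<partial>M) = (\<integral>p. w p *\<^sub>R f p \<partial>restrict_space lborel \<O>)"
    unfolding wmeasure_def
    by (rule integral_density[OF assms[unfolded borel_measurable_M] w_real_measurable w_AE_nonneg])
  also have "\<dots> = (LINT p:\<O>|lborel. w p * f p)"
    by (simp add: integral_restrict_space[OF domain_borel(1)] set_lebesgue_integral_def)
  finally show ?thesis .
qed

text \<open>
  The domain is exhausted by countably many compact sets, on each of which the function is
  measurable.
\<close>

lemma locally_integrable_measurable:
  assumes g: "locally_integrable \<O> g" shows "g \<in> borel_measurable M"
proof -
  obtain K where K: "\<And>n. compact (K n)" "\<And>n. K n \<subseteq> \<O>" "\<And>n. K n \<subseteq> interior (K (Suc n))"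
    "\<Union>(range K) = \<O>" "\<And>L. compact L \<Longrightarrow> L \<subseteq> \<O> \<Longrightarrow> \<exists>N. \<forall>n\<ge>N. L \<subseteq> K n"
    using open_domain by (rule open_Union_compact_subsets) (rule that)
  show ?thesis
  proof (rule borel_measurable_LIMSEQ_real)
    show "(\<lambda>p. indicator (K n) p *\<^sub>R g p) \<in> borel_measurable M" for n
    proof -
      have "integrable lborel (\<lambda>p. indicator (K n) p *\<^sub>R g p)"
        using g K(1,2)[of n] by (simp add: locally_integrable_def set_integrable_def)
      then have "(\<lambda>p. indicator (K n) p *\<^sub>R g p) \<in> borel_measurable lborel" by simp
      then show ?thesis unfolding borel_measurable_M by (rule measurable_restrict_space1)
    qed
    fix p assume "p \<in> space M"
    then obtain N where N: "\<forall>n\<ge>N. p \<in> K n" using K(5)[of "{p}"] by (simp, blast)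
    have "\<forall>\<^sub>F n in sequentially. g p = indicator (K n) p *\<^sub>R g p"
      unfolding eventually_sequentially using N by (intro exI[of _ N]) simp
    then show "(\<lambda>n. indicator (K n) p *\<^sub>R g p) \<longlonglongrightarrow> g p"
      by (rule Lim_transform_eventually[OF tendsto_const])
  qed
qed

text \<open>
  On a compact subset of \<open>\<O>\<close> the weight \<open>w c\<^sup>2\<close> is bounded below by a positive constant, and
  \<open>|f| \<le> 1 + f\<^sup>2\<close>.
\<close>

lemma weighted_L2_locally_integrable:
  assumes c: "continuous_on \<O> c" "\<And>p. p \<in> \<O> \<Longrightarrow> 0 < c p"
    and f: "f \<in> borel_measurable M" "integrable M (\<lambda>p. (c p * f p)\<^sup>2)"
  shows "locally_integrable \<O> f"
  unfolding locally_integrable_def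
proof (intro allI impI)
  fix K assume "compact K \<and> K \<subseteq> \<O>"
  then have K: "compact K" "K \<subseteq> \<O>" by auto
  define k where "k p = w p * (c p)\<^sup>2" for p
  have k: "continuous_on K k" unfolding k_def
    using c(1) w_continuous K(2) by (intro continuous_intros) (auto intro: continuous_on_subset)
  have k_pos: "k p > 0" if "p \<in> K" for p
  proof -
    have "p \<in> \<O>" using that K(2) by blast
    then show ?thesis using c(2)[of p] w_pos[of p] by (simp add: k_def)
  qed
  obtain m where m: "m > 0" "\<And>p. p \<in> K \<Longrightarrow> m \<le> k p"
  proof (cases "K = {}")
    case True then show thesis using that[of 1] by simp
  next
    case False
    then obtain q where "q \<in> K" "\<forall>p\<in>K. k q \<le> k p"
      using continuous_attains_inf[OF K(1) _ k] by blast
    then show thesis using that[of "k q"] k_pos by blast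
  qed
  have i1: "integrable lborel (\<lambda>p. indicator \<O> p *\<^sub>R (w p * (c p * f p)\<^sup>2))"
  proof -
    have "(\<lambda>p. (c p * f p)\<^sup>2) \<in> borel_measurable M" using f by simp
    then show ?thesis using f(2) unfolding integrable_M[OF \<open>(\<lambda>p. (c p * f p)\<^sup>2) \<in> borel_measurable M\<close>]
      by (simp only: set_integrable_def)
  qed
  show "set_integrable lborel K f" unfolding set_integrable_def
  proof (rule Bochner_Integration.integrable_bound)
    show "integrable lborel (\<lambda>p. indicator K p + 1 / m * (indicator \<O> p *\<^sub>R (w p * (c p * f p)\<^sup>2)))"
      using K(1) emeasure_compact_finite[OF K(1)]
      by (intro Bochner_Integration.integrable_add integrable_mult_right i1 integrable_real_indicator)
        (simp_all add: borel_compact)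
    have "(\<lambda>p. indicator \<O> p *\<^sub>R f p) \<in> borel_measurable lborel"
      using f(1) unfolding borel_measurable_M by (simp add: borel_measurable_restrict_space_iff[OF domain_borel(1)])
    then have "(\<lambda>p. indicator K p *\<^sub>R (indicator \<O> p *\<^sub>R f p)) \<in> borel_measurable lborel"
      by (rule borel_measurable_scaleR[OF borel_measurable_indicator, rotated])
        (use K(1) in \<open>simp add: borel_compact\<close>)
    also have "(\<lambda>p. indicator K p *\<^sub>R (indicator \<O> p *\<^sub>R f p)) = (\<lambda>p. indicator K p *\<^sub>R f p)"
      using K(2) by (intro ext) (auto simp: indicator_def)
    finally show "(\<lambda>p. indicator K p *\<^sub>R f p) \<in> borel_measurable lborel" .
    have "norm (indicator K p *\<^sub>R f p) \<le> norm (indicator K p + 1 / m * (indicator \<O> p *\<^sub>R (w p * (c p * f p)\<^sup>2)))" for p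
    proof (cases "p \<in> K")
      case True
      have "2 * \<bar>f p\<bar> \<le> 1 + (f p)\<^sup>2" using sum_squares_bound[of 1 "\<bar>f p\<bar>"] by simp
      then have "\<bar>f p\<bar> \<le> 1 + (f p)\<^sup>2" using zero_le_power2[of "f p"] by linarith
      also have "m * (f p)\<^sup>2 \<le> k p * (f p)\<^sup>2" using m(2)[OF True] by (intro mult_right_mono) auto
      then have "(f p)\<^sup>2 \<le> 1 / m * (w p * (c p * f p)\<^sup>2)"
        using m(1) by (simp add: k_def field_simps)
      finally have "\<bar>f p\<bar> \<le> 1 + 1 / m * (w p * (c p * f p)\<^sup>2)" by simp
      then show ?thesis using True K(2) by auto
    qed simp
    then show "AE p in lborel. norm (indicator K p *\<^sub>R f p)
        \<le> norm (indicator K p + 1 / m * (indicator \<O> p *\<^sub>R (w p * (c p * f p)\<^sup>2)))" by simp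
  qed
qed

text \<open>
  Cauchy--Schwarz for \<open>f \<zeta> = w (c f) (\<zeta> / (w c))\<close>; the last factor is continuous with compact
  support inside the domain, where the weights do not vanish.
\<close>

lemma pairing_bound:
  assumes \<zeta>: "compactly_supported_on \<O> \<zeta>"
    and c: "continuous_on \<O> c" "\<And>p. p \<in> \<O> \<Longrightarrow> 0 < c p"
  obtains B where "\<And>f. f \<in> borel_measurable M \<Longrightarrow> integrable M (\<lambda>p. (c p * f p)\<^sup>2) \<Longrightarrow>
    \<bar>LINT p:\<O>|lborel. f p * \<zeta> p\<bar> \<le> sqrt (\<integral>p. (c p * f p)\<^sup>2 \<partial>M) * B"
proof -
  have c\<zeta>: "continuous_on \<O> \<zeta>" using \<zeta> by (simp add: compactly_supported_on_def)
  define g where "g p = \<zeta> p / (w p * c p)" for p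
  have nz: "w p * c p \<noteq> 0" "w p * (c p)\<^sup>2 \<noteq> 0" if "p \<in> \<O>" for p
    using w_pos[OF that] c(2)[OF that] by simp_all
  have g_cont: "continuous_on \<O> g" unfolding g_def
    by (intro continuous_intros c\<zeta> w_continuous c(1) ballI nz)
  then have g_meas: "g \<in> borel_measurable M" by (rule continuous_borel_measurable)
  have g_int: "integrable M (\<lambda>p. (g p)\<^sup>2)"
  proof -
    have "set_integrable lborel \<O> (\<lambda>p. (\<zeta> p / (w p * (c p)\<^sup>2)) * \<zeta> p)"
      by (intro set_integrable_locally_integrable_mult \<zeta> continuous_imp_locally_integrable
          continuous_intros c\<zeta> w_continuous c(1) ballI nz)
    moreover have "(\<zeta> p / (w p * (c p)\<^sup>2)) * \<zeta> p = w p * (g p)\<^sup>2" if "p \<in> \<O>" for p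
      using w_pos[OF that] c(2)[OF that] by (simp add: g_def power2_eq_square field_simps)
    ultimately have "set_integrable lborel \<O> (\<lambda>p. w p * (g p)\<^sup>2)"
      by (subst (asm) set_integrable_cong[OF refl refl]) auto
    then show ?thesis using g_meas by (subst integrable_M) auto
  qed
  have "\<bar>LINT p:\<O>|lborel. f p * \<zeta> p\<bar> \<le> sqrt (\<integral>p. (c p * f p)\<^sup>2 \<partial>M) * sqrt (\<integral>p. (g p)\<^sup>2 \<partial>M)"
    if f: "f \<in> borel_measurable M" "integrable M (\<lambda>p. (c p * f p)\<^sup>2)" for f
  proof -
    have cm: "c \<in> borel_measurable M" using c(1) by (rule continuous_borel_measurable)
    have "(LINT p:\<O>|lborel. f p * \<zeta> p) = (LINT p:\<O>|lborel. w p * ((c p * f p) * g p))"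
    proof (intro set_lebesgue_integral_cong allI impI)
      fix p assume "p \<in> \<O>"
      then show "f p * \<zeta> p = w p * ((c p * f p) * g p)"
        using w_pos[of p] c(2)[of p] by (simp add: g_def)
    qed (rule domain_borel(2)[folded sets_lborel])
    also have "\<dots> = (\<integral>p. (c p * f p) * g p \<partial>M)"
      using f(1) cm g_meas by (intro integral_M[symmetric]) auto
    finally show ?thesis
      using integral_cauchy_schwarz[of "\<lambda>p. c p * f p" M g] f cm g_meas g_int by auto
  qed
  then show thesis by (rule that)
qed

lemma pairing_tendsto:
  assumes \<zeta>: "compactly_supported_on \<O> \<zeta>"
    and c: "continuous_on \<O> c" "\<And>p. p \<in> \<O> \<Longrightarrow> 0 < c p"
    and f: "\<And>n. locally_integrable \<O> (f n)" "locally_integrable \<O> g"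
    and int: "\<And>n. integrable M (\<lambda>p. (c p * (f n p - g p))\<^sup>2)"
    and lim: "(\<lambda>n. \<integral>p. (c p * (f n p - g p))\<^sup>2 \<partial>M) \<longlonglongrightarrow> 0"
  shows "(\<lambda>n. LINT p:\<O>|lborel. f n p * \<zeta> p) \<longlonglongrightarrow> (LINT p:\<O>|lborel. g p * \<zeta> p)"
proof -
  obtain B where B: "\<And>f. f \<in> borel_measurable M \<Longrightarrow> integrable M (\<lambda>p. (c p * f p)\<^sup>2) \<Longrightarrow>
    \<bar>LINT p:\<O>|lborel. f p * \<zeta> p\<bar> \<le> sqrt (\<integral>p. (c p * f p)\<^sup>2 \<partial>M) * B"
    using pairing_bound[OF \<zeta> c] by blast
  have "(\<lambda>n. (LINT p:\<O>|lborel. f n p * \<zeta> p) - (LINT p:\<O>|lborel. g p * \<zeta> p)) \<longlonglongrightarrow> 0"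
  proof (rule Lim_null_comparison)
    have "norm ((LINT p:\<O>|lborel. f n p * \<zeta> p) - (LINT p:\<O>|lborel. g p * \<zeta> p))
        \<le> sqrt (\<integral>p. (c p * (f n p - g p))\<^sup>2 \<partial>M) * B" for n
    proof -
      have "(LINT p:\<O>|lborel. f n p * \<zeta> p) - (LINT p:\<O>|lborel. g p * \<zeta> p)
          = (LINT p:\<O>|lborel. (f n p - g p) * \<zeta> p)"
        by (subst set_integral_diff(2)[symmetric])
          (simp_all add: set_integrable_locally_integrable_mult f \<zeta> left_diff_distrib)
      then show ?thesis
        using B[of "\<lambda>p. f n p - g p", OF _ int] f[THEN locally_integrable_measurable] by simp
    qed
    then show "\<forall>\<^sub>F n in sequentially. norm ((LINT p:\<O>|lborel. f n p * \<zeta> p) - (LINT p:\<O>|lborel. g p * \<zeta> p))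
        \<le> sqrt (\<integral>p. (c p * (f n p - g p))\<^sup>2 \<partial>M) * B" by simp
    have "(\<lambda>n. sqrt (\<integral>p. (c p * (f n p - g p))\<^sup>2 \<partial>M) * B) \<longlonglongrightarrow> sqrt 0 * B"
      by (intro tendsto_intros lim)
    then show "(\<lambda>n. sqrt (\<integral>p. (c p * (f n p - g p))\<^sup>2 \<partial>M) * B) \<longlonglongrightarrow> 0" by simp
  qed
  then show ?thesis by (simp add: LIM_zero_iff)
qed

definition has_weak_gradient :: "(real \<times> real \<Rightarrow> real) \<Rightarrow> bool" where
  "has_weak_gradient u \<longleftrightarrow> u \<in> borel_measurable M \<and>
     (\<exists>g. has_weak_deriv \<O> (1, 0) u g) \<and> (\<exists>g. has_weak_deriv \<O> (0, 1) u g)"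

lemma has_weak_gradientD:
  assumes "has_weak_gradient u"
  shows "u \<in> borel_measurable M" "has_weak_deriv \<O> (1, 0) u (weak_dx \<O> u)"
    "has_weak_deriv \<O> (0, 1) u (weak_dy \<O> u)" "locally_integrable \<O> u"
    "weak_dx \<O> u \<in> borel_measurable M" "weak_dy \<O> u \<in> borel_measurable M" "\<Phi> u \<in> borel_measurable M"
proof -
  show u: "u \<in> borel_measurable M" using assms by (simp add: has_weak_gradient_def)
  show x: "has_weak_deriv \<O> (1, 0) u (weak_dx \<O> u)"
    unfolding weak_dx_def
    by (rule someI_ex[of "has_weak_deriv \<O> (1, 0) u"]) (use assms in \<open>simp add: has_weak_gradient_def\<close>)
  show y: "has_weak_deriv \<O> (0, 1) u (weak_dy \<O> u)"
    unfolding weak_dy_def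
    by (rule someI_ex[of "has_weak_deriv \<O> (0, 1) u"]) (use assms in \<open>simp add: has_weak_gradient_def\<close>)
  show "locally_integrable \<O> u" using x unfolding has_weak_deriv_def by (rule conjunct1)
  have lx: "locally_integrable \<O> (weak_dx \<O> u)" using x unfolding has_weak_deriv_def by (elim conjE)
  have ly: "locally_integrable \<O> (weak_dy \<O> u)" using y unfolding has_weak_deriv_def by (elim conjE)
  show xm: "weak_dx \<O> u \<in> borel_measurable M" using lx by (rule locally_integrable_measurable)
  show ym: "weak_dy \<O> u \<in> borel_measurable M" using ly by (rule locally_integrable_measurable)
  have [measurable]: "(\<lambda>p. sqrt (snd p)) \<in> borel_measurable M" "(\<lambda>p. sqrt (1 + snd p)) \<in> borel_measurable M"
    by (intro continuous_borel_measurable continuous_intros)+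
  note [measurable] = u xm ym
  show "\<Phi> u \<in> borel_measurable M" unfolding weighted_jet_def[abs_def] by measurable
qed

lemma norm_jet: "p \<in> \<O> \<Longrightarrow> (norm (\<Phi> u p))\<^sup>2 = H1_density \<O> u p"
  using snd_pos[of p]
  by (simp add: weighted_jet_def H1_density_def norm_Pair power_mult_distrib distrib_left)

lemma H1_iff: "u \<in> H \<longleftrightarrow> has_weak_gradient u \<and> integrable M (\<lambda>p. (norm (\<Phi> u p))\<^sup>2)"
proof -
  have "integrable M (\<lambda>p. (norm (\<Phi> u p))\<^sup>2) \<longleftrightarrow> integrable M (H1_density \<O> u)"
    by (intro Bochner_Integration.integrable_cong) (simp_all add: norm_jet)
  then show ?thesis by (auto simp: H1_def has_weak_gradient_def)
qed

lemma H1_norm_jet: "nrm u = sqrt (\<integral>p. (norm (\<Phi> u p))\<^sup>2 \<partial>M)"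
proof -
  have "(\<integral>p. (norm (\<Phi> u p))\<^sup>2 \<partial>M) = (\<integral>p. H1_density \<O> u p \<partial>M)"
    by (intro Bochner_Integration.integral_cong) (simp_all add: norm_jet)
  then show ?thesis by (simp add: H1_norm_def)
qed

lemma H1_norm_nonneg: "0 \<le> nrm u"
  by (simp add: H1_norm_jet)

text \<open>
  The jet is built from arbitrarily chosen representatives of the weak derivatives.  Any other
  representatives may be used in their place almost everywhere.
\<close>

lemma weak_gradient_AE_unique:
  assumes x: "has_weak_deriv \<O> (1, 0) u g" and y: "has_weak_deriv \<O> (0, 1) u h"
    and u: "u \<in> borel_measurable M"
  shows "has_weak_gradient u"
    "AE p in M. \<Phi> u p = (sqrt (snd p) * g p, sqrt (snd p) * h p, sqrt (1 + snd p) * u p)"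
proof -
  show gr: "has_weak_gradient u" unfolding has_weak_gradient_def using assms by blast
  have "AE p in M. weak_dx \<O> u p = g p" "AE p in M. weak_dy \<O> u p = h p"
    unfolding AE_M using weak_deriv_unique[OF open_domain] has_weak_gradientD(2,3)[OF gr] x y by blast+
  then show "AE p in M. \<Phi> u p = (sqrt (snd p) * g p, sqrt (snd p) * h p, sqrt (1 + snd p) * u p)"
    by eventually_elim (simp add: weighted_jet_def)
qed

lemma jet_lincomb:
  assumes u: "has_weak_gradient u" and v: "has_weak_gradient v"
  shows "has_weak_gradient (\<lambda>p. a * u p + b * v p)"
    "AE p in M. \<Phi> (\<lambda>p. a * u p + b * v p) p = a *\<^sub>R \<Phi> u p + b *\<^sub>R \<Phi> v p"
proof -
  note ud = has_weak_gradientD[OF u] and vd = has_weak_gradientD[OF v]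
  note x = weak_deriv_lincomb[OF open_domain ud(2) vd(2), of a b]
    and y = weak_deriv_lincomb[OF open_domain ud(3) vd(3), of a b]
  have m: "(\<lambda>p. a * u p + b * v p) \<in> borel_measurable M" using ud(1) vd(1) by measurable
  show "has_weak_gradient (\<lambda>p. a * u p + b * v p)" by (rule weak_gradient_AE_unique(1)[OF x y m])
  show "AE p in M. \<Phi> (\<lambda>p. a * u p + b * v p) p = a *\<^sub>R \<Phi> u p + b *\<^sub>R \<Phi> v p"
    using weak_gradient_AE_unique(2)[OF x y m]
    by eventually_elim (simp add: weighted_jet_def algebra_simps)
qed

lemma norm_sq_lincomb_integrable:
  fixes F G :: "real \<times> real \<Rightarrow> real \<times> real \<times> real"
  assumes "F \<in> borel_measurable M" "G \<in> borel_measurable M"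
    and "integrable M (\<lambda>x. (norm (F x))\<^sup>2)" "integrable M (\<lambda>x. (norm (G x))\<^sup>2)"
  shows "integrable M (\<lambda>x. (norm (a *\<^sub>R F x + b *\<^sub>R G x))\<^sup>2)"
  using assms by (intro norm_sq_integrable_add) (auto simp: power_mult_distrib)

lemma H1_lincomb:
  assumes u: "u \<in> H" and v: "v \<in> H"
  shows "(\<lambda>p. a * u p + b * v p) \<in> H"
proof -
  have gr: "has_weak_gradient u" "has_weak_gradient v" using u v by (auto simp: H1_iff)
  note j = jet_lincomb[OF gr, of a b]
  have "integrable M (\<lambda>p. (norm (a *\<^sub>R \<Phi> u p + b *\<^sub>R \<Phi> v p))\<^sup>2)"
    using u v gr[THEN has_weak_gradientD(7)] by (intro norm_sq_lincomb_integrable) (auto simp: H1_iff)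
  then have "integrable M (\<lambda>p. (norm (\<Phi> (\<lambda>p. a * u p + b * v p) p))\<^sup>2)"
  proof (rule integrable_cong_AE_imp)
    show "(\<lambda>p. (norm (\<Phi> (\<lambda>p. a * u p + b * v p) p))\<^sup>2) \<in> borel_measurable M"
      using has_weak_gradientD(7)[OF j(1)] by measurable
    show "AE p in M. (norm (a *\<^sub>R \<Phi> u p + b *\<^sub>R \<Phi> v p))\<^sup>2 = (norm (\<Phi> (\<lambda>p. a * u p + b * v p) p))\<^sup>2"
      using j(2) by eventually_elim simp
  qed
  with j(1) show ?thesis by (simp add: H1_iff)
qed

lemma H1_zero: "0 \<in> H"
proof -
  have d: "has_weak_deriv \<O> e (\<lambda>_. 0) (\<lambda>_. 0)" for e
    by (auto simp: has_weak_deriv_def continuous_imp_locally_integrable set_lebesgue_integral_def)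
  have j: "has_weak_gradient (\<lambda>_. 0)" "AE p in M. \<Phi> (\<lambda>_. 0) p = 0"
    using weak_gradient_AE_unique[OF d d] by (simp_all add: zero_prod_def)
  have "integrable M (\<lambda>p. (norm (\<Phi> (\<lambda>_. 0) p))\<^sup>2)"
  proof (rule integrable_cong_AE_imp[of _ "\<lambda>_. 0"])
    show "(\<lambda>p. (norm (\<Phi> (\<lambda>_. 0) p))\<^sup>2) \<in> borel_measurable M"
      using has_weak_gradientD(7)[OF j(1)] by measurable
    show "AE p in M. 0 = (norm (\<Phi> (\<lambda>_. 0) p))\<^sup>2" using j(2) by eventually_elim simp
  qed simp
  with j(1) show ?thesis by (simp add: H1_iff zero_fun_def)
qed

lemma subspace_H1: "subspace (H)"
proof (rule subspaceI)
  fix u v assume "u \<in> H" "v \<in> H"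
  from H1_lincomb[OF this, of 1 1] show "u + v \<in> H" by (simp add: plus_fun_def)
next
  fix u c assume "u \<in> H"
  from H1_lincomb[OF this this, of c 0] show "c *\<^sub>R u \<in> H" by (simp add: scaleR_fun_def)
qed (rule H1_zero)

definition form where "form B u v = (\<integral>p. B p (\<Phi> u p) (\<Phi> v p) \<partial>M)"

lemma H1_jet:
  assumes "u \<in> H"
  shows "\<Phi> u \<in> borel_measurable M" "integrable M (\<lambda>p. (norm (\<Phi> u p))\<^sup>2)"
  using assms has_weak_gradientD(7) by (auto simp: H1_iff)

lemma jet_add:
  assumes "u \<in> H" "v \<in> H" shows "AE p in M. \<Phi> (u + v) p = \<Phi> u p + \<Phi> v p"
  using jet_lincomb(2)[of u v 1 1] assms by (simp add: H1_iff plus_fun_def)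

lemma jet_diff:
  assumes "u \<in> H" "v \<in> H" shows "AE p in M. \<Phi> (u - v) p = \<Phi> u p - \<Phi> v p"
  using jet_lincomb(2)[of u v 1 "-1"] assms by (simp add: H1_iff fun_diff_def)

lemma jet_scale:
  assumes "u \<in> H" shows "AE p in M. \<Phi> (c *\<^sub>R u) p = c *\<^sub>R \<Phi> u p"
  using jet_lincomb(2)[of u u c 0] assms by (simp add: H1_iff scaleR_fun_def)

lemma form_integrable:
  assumes "admissible_form M C B" "u \<in> H" "v \<in> H"
  shows "integrable M (\<lambda>p. B p (\<Phi> u p) (\<Phi> v p))"
  using admissible_form_integrable[OF assms(1) H1_jet[OF assms(2)] H1_jet[OF assms(3)]] .

lemma form_bound:
  assumes "admissible_form M C B" "C \<ge> 0" "u \<in> H" "v \<in> H"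
  shows "\<bar>form B u v\<bar> \<le> C * nrm u * nrm v"
  using admissible_form_bound[OF assms(1,2) H1_jet[OF assms(3)] H1_jet[OF assms(4)]]
  by (simp add: form_def H1_norm_jet)

lemma form_cong_AE:
  assumes B: "admissible_form M C B" and "F \<in> borel_measurable M" "F' \<in> borel_measurable M"
    "G \<in> borel_measurable M" "G' \<in> borel_measurable M" "AE p in M. F p = F' p" "AE p in M. G p = G' p"
  shows "(\<integral>p. B p (F p) (G p) \<partial>M) = (\<integral>p. B p (F' p) (G' p) \<partial>M)"
proof (rule integral_cong_AE)
  show "AE p in M. B p (F p) (G p) = B p (F' p) (G' p)" using assms(6,7) by eventually_elim simp
qed (use admissible_formD(3)[OF B] assms(2-5) in blast)+

lemma form_add:
  assumes B: "admissible_form M C B" and u: "u \<in> H" and v: "v \<in> H" and z: "z \<in> H"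
  shows "form B (u + v) z = form B u z + form B v z" "form B z (u + v) = form B z u + form B z v"
proof -
  have uv: "u + v \<in> H" using subspace_H1 u v by (rule subspace_add)
  have m: "(\<lambda>p. \<Phi> u p + \<Phi> v p) \<in> borel_measurable M"
    using H1_jet(1)[OF u] H1_jet(1)[OF v] by measurable
  have "form B (u + v) z = (\<integral>p. B p (\<Phi> u p + \<Phi> v p) (\<Phi> z p) \<partial>M)" unfolding form_def
    using jet_add[OF u v] by (intro form_cong_AE[OF B] H1_jet m uv z) auto
  also have "\<dots> = (\<integral>p. B p (\<Phi> u p) (\<Phi> z p) + B p (\<Phi> v p) (\<Phi> z p) \<partial>M)"
    by (intro Bochner_Integration.integral_cong refl bilinear_ladd admissible_formD(1)[OF B])
  finally show "form B (u + v) z = form B u z + form B v z"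
    unfolding form_def using form_integrable[OF B] u v z by simp
  have "form B z (u + v) = (\<integral>p. B p (\<Phi> z p) (\<Phi> u p + \<Phi> v p) \<partial>M)" unfolding form_def
    using jet_add[OF u v] by (intro form_cong_AE[OF B] H1_jet m uv z) auto
  also have "\<dots> = (\<integral>p. B p (\<Phi> z p) (\<Phi> u p) + B p (\<Phi> z p) (\<Phi> v p) \<partial>M)"
    by (intro Bochner_Integration.integral_cong refl bilinear_radd admissible_formD(1)[OF B])
  finally show "form B z (u + v) = form B z u + form B z v"
    unfolding form_def using form_integrable[OF B] u v z by simp
qed

lemma form_scale:
  assumes B: "admissible_form M C B" and u: "u \<in> H" and z: "z \<in> H"
  shows "form B (c *\<^sub>R u) z = c * form B u z" "form B z (c *\<^sub>R u) = c * form B z u"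
proof -
  have cu: "c *\<^sub>R u \<in> H" using subspace_H1 u by (rule subspace_scale)
  have m: "(\<lambda>p. c *\<^sub>R \<Phi> u p) \<in> borel_measurable M" using H1_jet(1)[OF u] by measurable
  have "form B (c *\<^sub>R u) z = (\<integral>p. B p (c *\<^sub>R \<Phi> u p) (\<Phi> z p) \<partial>M)" unfolding form_def
    using jet_scale[OF u] by (intro form_cong_AE[OF B] H1_jet m cu z) auto
  also have "\<dots> = (\<integral>p. c * B p (\<Phi> u p) (\<Phi> z p) \<partial>M)"
    by (intro Bochner_Integration.integral_cong refl bilinear_lmul[where 'c=real, simplified] admissible_formD(1)[OF B])
  finally show "form B (c *\<^sub>R u) z = c * form B u z" unfolding form_def by simp
  have "form B z (c *\<^sub>R u) = (\<integral>p. B p (\<Phi> z p) (c *\<^sub>R \<Phi> u p) \<partial>M)" unfolding form_def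
    using jet_scale[OF u] by (intro form_cong_AE[OF B] H1_jet m cu z) auto
  also have "\<dots> = (\<integral>p. c * B p (\<Phi> z p) (\<Phi> u p) \<partial>M)"
    by (intro Bochner_Integration.integral_cong refl bilinear_rmul[where 'c=real, simplified] admissible_formD(1)[OF B])
  finally show "form B z (c *\<^sub>R u) = c * form B z u" unfolding form_def by simp
qed

end

lemma jet_entries:
  "linear (fst :: real \<times> real \<times> real \<Rightarrow> real)"
  "linear (\<lambda>x :: real \<times> real \<times> real. fst (snd x))"
  "linear (\<lambda>x :: real \<times> real \<times> real. snd (snd x))"
  "\<bar>fst x\<bar> \<le> norm x" "\<bar>fst (snd x)\<bar> \<le> norm x" "\<bar>snd (snd x)\<bar> \<le> norm x"
  for x :: "real \<times> real \<times> real"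
  using norm_fst_le[of "fst x" "snd x"] norm_snd_le[of "snd x" "fst x"]
    norm_fst_le[of "fst (snd x)" "snd (snd x)"] norm_snd_le[of "snd (snd x)" "fst (snd x)"]
  by (simp_all add: linearI)

context weighted_domain
begin

text \<open>
  To be read with \<open>F n\<close> the jet of the \<open>n\<close>-th function, \<open>l\<close> one of its entries and \<open>c\<close> the weight
  of that entry: dividing the limit \<open>G\<close> by the weight recovers the limit of the functions, or of
  their weak derivatives, in the sense of distributions.
\<close>

lemma weighted_limit_component:
  fixes F :: "nat \<Rightarrow> real \<times> real \<Rightarrow> real \<times> real \<times> real"
  assumes c: "continuous_on \<O> c" "\<And>p. p \<in> \<O> \<Longrightarrow> 0 < c p"
    and l: "linear l" "\<And>x. \<bar>l x\<bar> \<le> norm x" and f: "\<And>n. locally_integrable \<O> (f n)"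
    and lf: "\<And>n p. l (F n p) = c p * f n p"
    and G[measurable]: "G \<in> borel_measurable M" and intG: "integrable M (\<lambda>p. (norm (G p))\<^sup>2)"
    and intD: "\<And>n. integrable M (\<lambda>p. (norm (F n p - G p))\<^sup>2)"
    and lim: "(\<lambda>n. \<integral>p. (norm (F n p - G p))\<^sup>2 \<partial>M) \<longlonglongrightarrow> 0"
  shows "locally_integrable \<O> (\<lambda>p. l (G p) / c p)" (is "locally_integrable \<O> ?g")
    and "\<And>\<zeta>. compactly_supported_on \<O> \<zeta> \<Longrightarrow>
      (\<lambda>n. LINT p:\<O>|lborel. f n p * \<zeta> p) \<longlonglongrightarrow> (LINT p:\<O>|lborel. l (G p) / c p * \<zeta> p)"
proof -
  have cm[measurable]: "c \<in> borel_measurable M" using c(1) by (rule continuous_borel_measurable)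
  have [measurable]: "l \<in> borel_measurable borel"
    using l(1) by (intro borel_measurable_continuous_onI linear_continuous_on) (simp add: linear_conv_bounded_linear)
  have gm: "?g \<in> borel_measurable M" by measurable
  have le: "(l x)\<^sup>2 \<le> (norm x)\<^sup>2" for x using l(2)[of x] by (metis abs_ge_zero power2_abs power_mono)
  have "integrable M (\<lambda>p. (c p * ?g p)\<^sup>2)"
  proof (rule Bochner_Integration.integrable_bound[OF intG])
    show "AE p in M. norm ((c p * ?g p)\<^sup>2) \<le> norm ((norm (G p))\<^sup>2)"
    proof (rule AE_I2)
      fix p assume "p \<in> space M"
      then have "c p * ?g p = l (G p)" using c(2)[of p] by simp
      then show "norm ((c p * ?g p)\<^sup>2) \<le> norm ((norm (G p))\<^sup>2)" using le by simp
    qed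
  qed measurable
  then show g: "locally_integrable \<O> ?g"
    by (rule weighted_L2_locally_integrable[OF c(1) _ gm, rotated]) (rule c(2))
  have eq: "c p * (f n p - ?g p) = l (F n p - G p)" if "p \<in> \<O>" for n p
    using c(2)[OF that] l(1) by (simp add: linear_diff lf algebra_simps)
  have [measurable]: "f n \<in> borel_measurable M" for n using f by (rule locally_integrable_measurable)
  have dm: "(\<lambda>p. (c p * (f n p - ?g p))\<^sup>2) \<in> borel_measurable M" for n by measurable
  have int: "integrable M (\<lambda>p. (c p * (f n p - ?g p))\<^sup>2)" for n
  proof (rule Bochner_Integration.integrable_bound[OF intD])
    show "AE p in M. norm ((c p * (f n p - ?g p))\<^sup>2) \<le> norm ((norm (F n p - G p))\<^sup>2)"
      by (intro AE_I2) (simp add: eq le)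
  qed (rule dm)
  show "(\<lambda>n. LINT p:\<O>|lborel. f n p * \<zeta> p) \<longlonglongrightarrow> (LINT p:\<O>|lborel. ?g p * \<zeta> p)"
    if "compactly_supported_on \<O> \<zeta>" for \<zeta>
  proof (rule pairing_tendsto[OF that c f g int])
    show "(\<lambda>n. \<integral>p. (c p * (f n p - ?g p))\<^sup>2 \<partial>M) \<longlonglongrightarrow> 0"
    proof (rule tendsto_sandwich[OF _ _ tendsto_const lim])
      show "\<forall>\<^sub>F n in sequentially. (\<integral>p. (c p * (f n p - ?g p))\<^sup>2 \<partial>M) \<le> (\<integral>p. (norm (F n p - G p))\<^sup>2 \<partial>M)"
        by (intro always_eventually allI integral_mono int intD) (simp add: eq le)
    qed simp
  qed
qed

text \<open>
  The jets of a Cauchy sequence converge in \<open>L\<^sup>2\<close> to some \<open>G\<close>.  The entries of \<open>G\<close>, freed from their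
  weights, are a function and its weak derivatives, because the defining identity of weak
  derivatives passes to the limit.
\<close>

lemma H1_complete:
  assumes X: "\<And>n. X n \<in> H"
    and cauchy: "\<And>e. e > 0 \<Longrightarrow> \<exists>N. \<forall>m\<ge>N. \<forall>n\<ge>N. nrm (X m - X n) < e"
  shows "\<exists>u\<in>H. (\<lambda>n. nrm (X n - u)) \<longlonglongrightarrow> 0"
proof -
  have norm_diff: "nrm (u - v) = sqrt (\<integral>p. (norm (\<Phi> u p - \<Phi> v p))\<^sup>2 \<partial>M)"
    if u: "u \<in> H" and v: "v \<in> H" for u v
  proof -
    have "(\<integral>p. (norm (\<Phi> (u - v) p))\<^sup>2 \<partial>M) = (\<integral>p. (norm (\<Phi> u p - \<Phi> v p))\<^sup>2 \<partial>M)"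
    proof (rule integral_cong_AE)
      have "u - v \<in> H" using subspace_H1 u v by (rule subspace_diff)
      note [measurable] = H1_jet(1)[OF u] H1_jet(1)[OF v] H1_jet(1)[OF this]
      show "(\<lambda>p. (norm (\<Phi> (u - v) p))\<^sup>2) \<in> borel_measurable M"
        "(\<lambda>p. (norm (\<Phi> u p - \<Phi> v p))\<^sup>2) \<in> borel_measurable M" by measurable
      show "AE p in M. (norm (\<Phi> (u - v) p))\<^sup>2 = (norm (\<Phi> u p - \<Phi> v p))\<^sup>2"
        using jet_diff[OF u v] by eventually_elim simp
    qed
    then show ?thesis by (simp add: H1_norm_jet)
  qed
  have "\<exists>G\<in>borel_measurable M. integrable M (\<lambda>p. (norm (G p))\<^sup>2) \<and>
      (\<lambda>n. \<integral>p. (norm (\<Phi> (X n) p - G p))\<^sup>2 \<partial>M) \<longlonglongrightarrow> 0"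
  proof (rule riesz_fischer_L2)
    fix e :: real assume "e > 0"
    then obtain N where N: "\<forall>m\<ge>N. \<forall>n\<ge>N. nrm (X m - X n) < sqrt e"
      using cauchy[of "sqrt e"] by auto
    then show "\<exists>N. \<forall>m\<ge>N. \<forall>n\<ge>N. (\<integral>p. (norm (\<Phi> (X m) p - \<Phi> (X n) p))\<^sup>2 \<partial>M) < e"
      by (intro exI[of _ N]) (simp add: norm_diff[OF X X])
  qed (use H1_jet[OF X] in auto)
  then obtain G where G[measurable]: "G \<in> borel_measurable M" and intG: "integrable M (\<lambda>p. (norm (G p))\<^sup>2)"
    and lim: "(\<lambda>n. \<integral>p. (norm (\<Phi> (X n) p - G p))\<^sup>2 \<partial>M) \<longlonglongrightarrow> 0" by blast
  have intD: "integrable M (\<lambda>p. (norm (\<Phi> (X n) p - G p))\<^sup>2)" for n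
    by (intro norm_sq_integrable_diff H1_jet[OF X] G intG)
  have c: "continuous_on \<O> (\<lambda>p. sqrt (snd p))" "continuous_on \<O> (\<lambda>p. sqrt (1 + snd p))"
    "\<And>p. p \<in> \<O> \<Longrightarrow> 0 < sqrt (snd p)" "\<And>p. p \<in> \<O> \<Longrightarrow> 0 < sqrt (1 + snd p)"
  proof -
    show "continuous_on \<O> (\<lambda>p. sqrt (snd p))" "continuous_on \<O> (\<lambda>p. sqrt (1 + snd p))"
      by (intro continuous_intros)+
    fix p assume "p \<in> \<O>"
    then show "0 < sqrt (snd p)" "0 < sqrt (1 + snd p)" using snd_pos[of p] by simp_all
  qed
  have grX: "has_weak_gradient (X n)" for n using X by (simp add: H1_iff)
  note Xd = has_weak_gradientD[OF grX]
  define gx gy u where "gx p = fst (G p) / sqrt (snd p)" and "gy p = fst (snd (G p)) / sqrt (snd p)"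
    and "u p = snd (snd (G p)) / sqrt (1 + snd p)" for p
  have lx: "locally_integrable \<O> (weak_dx \<O> (X n))" and ly: "locally_integrable \<O> (weak_dy \<O> (X n))" for n
    using Xd(2)[of n] Xd(3)[of n] by (auto simp: has_weak_deriv_def)
  have jet_components: "fst (\<Phi> (X n) p) = sqrt (snd p) * weak_dx \<O> (X n) p"
    "fst (snd (\<Phi> (X n) p)) = sqrt (snd p) * weak_dy \<O> (X n) p"
    "snd (snd (\<Phi> (X n) p)) = sqrt (1 + snd p) * X n p" for n p
    by (simp_all add: weighted_jet_def)
  have cx: "locally_integrable \<O> gx" "\<And>\<zeta>. compactly_supported_on \<O> \<zeta> \<Longrightarrow>
      (\<lambda>n. LINT p:\<O>|lborel. weak_dx \<O> (X n) p * \<zeta> p) \<longlonglongrightarrow> (LINT p:\<O>|lborel. gx p * \<zeta> p)"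
  proof -
    note k = weighted_limit_component[where f = "\<lambda>n. weak_dx \<O> (X n)" and F = "\<lambda>n. \<Phi> (X n)",
      OF c(1) _ jet_entries(1) jet_entries(4) lx jet_components(1) G intG intD lim]
    show "locally_integrable \<O> gx" unfolding gx_def by (rule k(1)) (rule c(3))
    show "(\<lambda>n. LINT p:\<O>|lborel. weak_dx \<O> (X n) p * \<zeta> p) \<longlonglongrightarrow> (LINT p:\<O>|lborel. gx p * \<zeta> p)"
      if "compactly_supported_on \<O> \<zeta>" for \<zeta>
      unfolding gx_def by (rule k(2)[OF _ that]) (rule c(3))
  qed
  have cy: "locally_integrable \<O> gy" "\<And>\<zeta>. compactly_supported_on \<O> \<zeta> \<Longrightarrow>
      (\<lambda>n. LINT p:\<O>|lborel. weak_dy \<O> (X n) p * \<zeta> p) \<longlonglongrightarrow> (LINT p:\<O>|lborel. gy p * \<zeta> p)"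
  proof -
    note k = weighted_limit_component[where f = "\<lambda>n. weak_dy \<O> (X n)" and F = "\<lambda>n. \<Phi> (X n)",
      OF c(1) _ jet_entries(2) jet_entries(5) ly jet_components(2) G intG intD lim]
    show "locally_integrable \<O> gy" unfolding gy_def by (rule k(1)) (rule c(3))
    show "(\<lambda>n. LINT p:\<O>|lborel. weak_dy \<O> (X n) p * \<zeta> p) \<longlonglongrightarrow> (LINT p:\<O>|lborel. gy p * \<zeta> p)"
      if "compactly_supported_on \<O> \<zeta>" for \<zeta>
      unfolding gy_def by (rule k(2)[OF _ that]) (rule c(3))
  qed
  have cu: "locally_integrable \<O> u" "\<And>\<zeta>. compactly_supported_on \<O> \<zeta> \<Longrightarrow>
      (\<lambda>n. LINT p:\<O>|lborel. X n p * \<zeta> p) \<longlonglongrightarrow> (LINT p:\<O>|lborel. u p * \<zeta> p)"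
  proof -
    note k = weighted_limit_component[where f = "\<lambda>n. X n" and F = "\<lambda>n. \<Phi> (X n)",
      OF c(2) _ jet_entries(3) jet_entries(6) Xd(4) jet_components(3) G intG intD lim]
    show "locally_integrable \<O> u" unfolding u_def by (rule k(1)) (rule c(4))
    show "(\<lambda>n. LINT p:\<O>|lborel. X n p * \<zeta> p) \<longlonglongrightarrow> (LINT p:\<O>|lborel. u p * \<zeta> p)"
      if "compactly_supported_on \<O> \<zeta>" for \<zeta>
      unfolding u_def by (rule k(2)[OF _ that]) (rule c(4))
  qed
  have dx: "has_weak_deriv \<O> (1, 0) u gx"
    by (rule weak_deriv_limit[OF open_domain Xd(2) cu(1) cx(1) cu(2) cx(2)])
  have dy: "has_weak_deriv \<O> (0, 1) u gy"
    by (rule weak_deriv_limit[OF open_domain Xd(3) cu(1) cy(1) cu(2) cy(2)])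
  have um: "u \<in> borel_measurable M" using cu(1) by (rule locally_integrable_measurable)
  note gr = weak_gradient_AE_unique[OF dx dy um]
  have \<Phi>u: "AE p in M. \<Phi> u p = G p"
    using gr(2) AE_space
  proof eventually_elim
    case (elim p)
    then have "p \<in> \<O>" by simp
    then show ?case using elim(1) c(3,4)[of p] by (simp add: gx_def gy_def u_def)
  qed
  have [measurable]: "\<Phi> u \<in> borel_measurable M" by (rule has_weak_gradientD(7)[OF gr(1)])
  have "integrable M (\<lambda>p. (norm (\<Phi> u p))\<^sup>2)"
    using intG
  proof (rule integrable_cong_AE_imp)
    show "AE p in M. (norm (G p))\<^sup>2 = (norm (\<Phi> u p))\<^sup>2" using \<Phi>u by eventually_elim simp
  qed measurable
  with gr(1) have u: "u \<in> H" by (simp add: H1_iff)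
  have "(\<lambda>n. nrm (X n - u)) \<longlonglongrightarrow> sqrt 0"
  proof -
    have "nrm (X n - u) = sqrt (\<integral>p. (norm (\<Phi> (X n) p - G p))\<^sup>2 \<partial>M)" for n
    proof -
      note [measurable] = H1_jet(1)[OF X]
      have "(\<integral>p. (norm (\<Phi> (X n) p - \<Phi> u p))\<^sup>2 \<partial>M) = (\<integral>p. (norm (\<Phi> (X n) p - G p))\<^sup>2 \<partial>M)"
      proof (rule integral_cong_AE)
        show "AE p in M. (norm (\<Phi> (X n) p - \<Phi> u p))\<^sup>2 = (norm (\<Phi> (X n) p - G p))\<^sup>2"
          using \<Phi>u by eventually_elim simp
      qed measurable
      then show ?thesis by (simp add: norm_diff[OF X u])
    qed
    then show ?thesis using tendsto_real_sqrt[OF lim] by simp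
  qed
  with u show ?thesis by auto
qed

lemma H1_semi_hilbert: "semi_hilbert (H) (form (\<lambda>_. inner)) (nrm)"
proof
  show "nrm u = sqrt (form (\<lambda>_. inner) u u)" for u
    by (simp add: H1_norm_jet form_def power2_norm_eq_inner)
  show "form (\<lambda>_. inner) u v = form (\<lambda>_. inner) v u" for u v
    by (simp add: form_def inner_commute)
  show "0 \<le> form (\<lambda>_. inner) u u" for u by (simp add: form_def)
qed (use subspace_H1 form_add(1)[OF admissible_inner] form_scale(1)[OF admissible_inner] H1_complete in blast)+

interpretation H1: semi_hilbert "H" "form (\<lambda>_. inner)" "nrm"
  by (rule H1_semi_hilbert)

text \<open>
  Without this fact the closure that defines \<open>H\<^sup>1\<^sub>0\<close> would be meaningless: an integral that does not
  exist has the value zero, so a difference that is not in \<open>H\<^sup>1\<close> could have norm zero.  The function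
  and its derivatives are bounded on their compact support, which has finite measure although it
  may reach the line \<open>y = 0\<close>.
\<close>

lemma Cinf0_in_H1:
  assumes \<phi>: "\<phi> \<in> Cinf0 \<O> T" shows "\<phi> \<in> H"
proof -
  obtain K where K: "\<And>k. Ck_upto k \<O> T \<phi>" "compact K" "K \<subseteq> \<O> \<union> T"
    "\<And>p. p \<in> \<O> \<union> T \<Longrightarrow> p \<notin> K \<Longrightarrow> \<phi> p = 0"
    using \<phi> by (rule Cinf0_E) (rule that)
  define gx gy where "gx p = frechet_derivative \<phi> (at p) (1, 0)"
    and "gy p = frechet_derivative \<phi> (at p) (0, 1)" for p
  have "continuous_on \<O> \<phi>" using Ck_upto_continuous[OF K(1)[of 0]] by (rule continuous_on_subset) simp
  then have \<phi>m: "\<phi> \<in> borel_measurable M" by (rule continuous_borel_measurable)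
  have dx: "has_weak_deriv \<O> (1, 0) \<phi> gx" and dy: "has_weak_deriv \<O> (0, 1) \<phi> gy"
    unfolding gx_def gy_def by (rule classical_imp_weak_deriv[OF open_domain K(1)])+
  note gr = weak_gradient_AE_unique[OF dx dy \<phi>m]
  obtain gx' where gx': "continuous_on (\<O> \<union> T) gx'" "\<And>p. p \<in> \<O> \<Longrightarrow> gx p = gx' p"
    using Ck_upto_frechet(3)[OF K(1) open_domain, of "(1, 0)"] unfolding gx_def by blast
  obtain gy' where gy': "continuous_on (\<O> \<union> T) gy'" "\<And>p. p \<in> \<O> \<Longrightarrow> gy p = gy' p"
    using Ck_upto_frechet(3)[OF K(1) open_domain, of "(0, 1)"] unfolding gy_def by blast
  obtain B0 where B0: "B0 \<ge> 0" "\<And>p. p \<in> K \<Longrightarrow> \<bar>\<phi> p\<bar> \<le> B0"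
    using continuous_on_subset[OF Ck_upto_continuous[OF K(1)[of 0]] K(3)] K(2)
    by (rule continuous_on_compact_bounded) (rule that)
  obtain Bx where Bx: "Bx \<ge> 0" "\<And>p. p \<in> K \<Longrightarrow> \<bar>gx' p\<bar> \<le> Bx"
    using continuous_on_subset[OF gx'(1) K(3)] K(2) by (rule continuous_on_compact_bounded) (rule that)
  obtain By where By: "By \<ge> 0" "\<And>p. p \<in> K \<Longrightarrow> \<bar>gy' p\<bar> \<le> By"
    using continuous_on_subset[OF gy'(1) K(3)] K(2) by (rule continuous_on_compact_bounded) (rule that)
  obtain R where R: "\<And>p. p \<in> K \<Longrightarrow> norm p \<le> R"
    using compact_imp_bounded[OF K(2)] unfolding bounded_pos by blast
  have openK: "open (\<O> - K)" using open_domain K by (simp add: open_Diff compact_imp_closed)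
  have zero: "frechet_derivative \<phi> (at p) = (\<lambda>_. 0)" if "p \<in> \<O>" "p \<notin> K" for p
    by (rule frechet_derivative_outside_support[OF openK]) (use that K(4) in auto)
  define C where "C = R * (Bx\<^sup>2 + By\<^sup>2) + (1 + R) * B0\<^sup>2"
  define N where "N p = snd p * ((gx p)\<^sup>2 + (gy p)\<^sup>2) + (1 + snd p) * (\<phi> p)\<^sup>2" for p
  have N: "0 \<le> N p" "N p \<le> C * indicator (\<O> \<inter> cball 0 R) p" if p: "p \<in> \<O>" for p
  proof -
    show "0 \<le> N p" unfolding N_def using snd_pos[OF p] by simp
    show "N p \<le> C * indicator (\<O> \<inter> cball 0 R) p"
    proof (cases "p \<in> K")
      case True
      have y: "0 < snd p" "snd p \<le> R" using snd_pos[OF p] R[OF True] norm_snd_le[of "snd p" "fst p"] by auto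
      have "(gx p)\<^sup>2 \<le> Bx\<^sup>2" "(gy p)\<^sup>2 \<le> By\<^sup>2" "(\<phi> p)\<^sup>2 \<le> B0\<^sup>2"
        using Bx By B0 True gx'(2)[OF p] gy'(2)[OF p] by (simp_all add: abs_le_square_iff[symmetric])
      then have "N p \<le> C" unfolding N_def C_def using y by (intro add_mono mult_mono) auto
      then show ?thesis using p R[OF True] by simp
    next
      case False
      \<comment> \<open>if \<open>K\<close> is empty, \<open>R\<close> and with it \<open>C\<close> may be negative\<close>
      have "R \<ge> 0 \<or> \<O> \<inter> cball 0 R = {}" by auto
      moreover have "0 \<le> C" if "R \<ge> 0" unfolding C_def using that by simp
      ultimately have "0 \<le> C * indicator (\<O> \<inter> cball 0 R) p" by auto
      then show ?thesis using False p K(4)[of p] zero[OF p False] by (simp add: N_def gx_def gy_def)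
    qed
  qed
  have "integrable M (\<lambda>p. (norm (\<Phi> \<phi> p))\<^sup>2)"
  proof (rule Bochner_Integration.integrable_bound)
    have "\<O> \<inter> cball 0 R \<in> sets M"
      by (auto simp: wmeasure_def sets_restrict_space)
    then show "integrable M (\<lambda>p. C * indicator (\<O> \<inter> cball 0 R) p)"
      using w_locally_finite[of R] by (intro integrable_mult_right integrable_real_indicator) auto
    show "(\<lambda>p. (norm (\<Phi> \<phi> p))\<^sup>2) \<in> borel_measurable M"
      using has_weak_gradientD(7)[OF gr(1)] by measurable
    show "AE p in M. norm ((norm (\<Phi> \<phi> p))\<^sup>2) \<le> norm (C * indicator (\<O> \<inter> cball 0 R) p)"
      using gr(2) AE_space
    proof eventually_elim
      case (elim p)
      then have p: "p \<in> \<O>" by simp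
      have "(norm (\<Phi> \<phi> p))\<^sup>2 = N p" unfolding elim(1) using snd_pos[OF p]
        by (simp add: N_def norm_Pair power_mult_distrib distrib_left)
      then show ?case using N[OF p] by simp
    qed
  qed
  with gr(1) show ?thesis by (simp add: H1_iff)
qed

lemma H10_iff:
  "u \<in> V \<longleftrightarrow> u \<in> H \<and> (\<forall>e>0. \<exists>\<phi>\<in>Cinf0 \<O> (Gamma0 \<O>). nrm (u - \<phi>) < e)"
  by (simp add: H10_def fun_diff_def)

lemma H10_subset_H1: "u \<in> V \<Longrightarrow> u \<in> H"
  by (simp add: H10_iff)

lemma H10_closed:
  assumes u: "u \<in> H" and approx: "\<And>e. e > 0 \<Longrightarrow> \<exists>v\<in>V. nrm (u - v) < e"
  shows "u \<in> V"
  unfolding H10_iff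
proof (intro conjI allI impI u)
  fix e :: real assume e: "e > 0"
  obtain v where v: "v \<in> V" "nrm (u - v) < e / 2" using approx[of "e / 2"] e by auto
  obtain \<phi> where \<phi>: "\<phi> \<in> Cinf0 \<O> (Gamma0 \<O>)" "nrm (v - \<phi>) < e / 2"
    using v(1) e unfolding H10_iff by (meson half_gt_zero)
  have "nrm (u - \<phi>) \<le> nrm (u - v) + nrm (v - \<phi>)"
    by (intro H1.nrm_diff_triangle u H10_subset_H1 v Cinf0_in_H1[OF \<phi>(1)])
  then have "nrm (u - \<phi>) < e" using v(2) \<phi>(2) by linarith
  with \<phi>(1) show "\<exists>\<phi>\<in>Cinf0 \<O> (Gamma0 \<O>). nrm (u - \<phi>) < e" by blast
qed

lemma subspace_H10: "subspace (V)"
proof (rule subspaceI)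
  have "0 \<in> Cinf0 \<O> (Gamma0 \<O>)" using Cinf0_zero by (simp add: zero_fun_def)
  moreover have "nrm (0 - 0) = 0"
    using H1.nrm_scale[OF H1_zero, of 0] by simp
  ultimately show "0 \<in> V" unfolding H10_iff using H1_zero by force
next
  fix u v assume uv: "u \<in> V" "v \<in> V"
  show "u + v \<in> V" unfolding H10_iff
  proof (intro conjI allI impI H1.V_add H10_subset_H1 uv)
    fix e :: real assume e: "e > 0"
    obtain \<phi> where \<phi>: "\<phi> \<in> Cinf0 \<O> (Gamma0 \<O>)" "nrm (u - \<phi>) < e / 2"
      using uv(1) e unfolding H10_iff by (meson half_gt_zero)
    obtain \<psi> where \<psi>: "\<psi> \<in> Cinf0 \<O> (Gamma0 \<O>)" "nrm (v - \<psi>) < e / 2"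
      using uv(2) e unfolding H10_iff by (meson half_gt_zero)
    have "nrm ((u - \<phi>) + (v - \<psi>)) \<le> nrm (u - \<phi>) + nrm (v - \<psi>)"
      by (intro H1.nrm_triangle H1.V_diff H10_subset_H1 uv Cinf0_in_H1[OF \<phi>(1)] Cinf0_in_H1[OF \<psi>(1)])
    moreover have "(u - \<phi>) + (v - \<psi>) = u + v - (\<phi> + \<psi>)" by (simp add: algebra_simps)
    ultimately have "nrm (u + v - (\<phi> + \<psi>)) < e" using \<phi>(2) \<psi>(2) by simp
    moreover have "\<phi> + \<psi> \<in> Cinf0 \<O> (Gamma0 \<O>)"
      using Cinf0_add[OF \<phi>(1) \<psi>(1)] by (simp add: plus_fun_def)
    ultimately show "\<exists>\<phi>\<in>Cinf0 \<O> (Gamma0 \<O>). nrm (u + v - \<phi>) < e" by blast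
  qed
next
  fix c :: real and u assume u: "u \<in> V"
  show "c *\<^sub>R u \<in> V" unfolding H10_iff
  proof (intro conjI allI impI H1.V_scale H10_subset_H1 u)
    fix e :: real assume e: "e > 0"
    then have "e / (\<bar>c\<bar> + 1) > 0" by simp
    then obtain \<phi> where \<phi>: "\<phi> \<in> Cinf0 \<O> (Gamma0 \<O>)" "nrm (u - \<phi>) < e / (\<bar>c\<bar> + 1)"
      using u unfolding H10_iff by blast
    have "nrm (c *\<^sub>R (u - \<phi>)) = \<bar>c\<bar> * nrm (u - \<phi>)"
      by (intro H1.nrm_scale H1.V_diff H10_subset_H1 u Cinf0_in_H1[OF \<phi>(1)])
    also have "\<dots> \<le> (\<bar>c\<bar> + 1) * nrm (u - \<phi>)" by (intro mult_right_mono H1_norm_nonneg) simp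
    also have "\<dots> < e" using \<phi>(2) pos_less_divide_eq[of "\<bar>c\<bar> + 1" "nrm (u - \<phi>)" e] by (simp add: mult.commute)
    finally have "nrm (c *\<^sub>R u - c *\<^sub>R \<phi>) < e" by (simp add: scaleR_diff_right)
    moreover have "c *\<^sub>R \<phi> \<in> Cinf0 \<O> (Gamma0 \<O>)"
      using Cinf0_scale[OF \<phi>(1)] by (simp add: scaleR_fun_def)
    ultimately show "\<exists>\<phi>\<in>Cinf0 \<O> (Gamma0 \<O>). nrm (c *\<^sub>R u - \<phi>) < e" by blast
  qed
qed

lemma H10_semi_hilbert: "semi_hilbert (V) (form (\<lambda>_. inner)) (nrm)"
proof
  fix X :: "nat \<Rightarrow> real \<times> real \<Rightarrow> real"
  assume X: "\<And>n. X n \<in> V"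
    and cauchy: "\<And>e. e > 0 \<Longrightarrow> \<exists>N. \<forall>m\<ge>N. \<forall>n\<ge>N. nrm (X m - X n) < e"
  obtain u where u: "u \<in> H" and lim: "(\<lambda>n. nrm (X n - u)) \<longlonglongrightarrow> 0"
    using H1_complete[OF H10_subset_H1[OF X] cauchy] by blast
  have "u \<in> V"
  proof (rule H10_closed[OF u])
    fix e :: real assume "e > 0"
    then have "\<forall>\<^sub>F n in sequentially. nrm (X n - u) < e" using lim by (rule order_tendstoD(2)[rotated])
    then obtain n where "nrm (X n - u) < e" by (auto simp: eventually_sequentially)
    then have "nrm (u - X n) < e" using H1.nrm_minus_commute[OF u H10_subset_H1[OF X]] by simp
    then show "\<exists>v\<in>V. nrm (u - v) < e" using X by blast
  qed
  then show "\<exists>u\<in>V. (\<lambda>n. nrm (X n - u)) \<longlonglongrightarrow> 0" using lim by blast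
qed (auto simp: subspace_H10 H10_subset_H1 H1.nrm_def H1.ip_commute H1.ip_add_left H1.ip_scale_left H1.ip_nonneg)

section \<open>The penalized equation\<close>

lemma H1_subset_L2:
  assumes u: "u \<in> H"
  shows "u \<in> L2 w \<O>" "sqrt (\<integral>p. (u p)\<^sup>2 \<partial>M) \<le> nrm u"
proof -
  have um[measurable]: "u \<in> borel_measurable M" using u by (simp add: H1_def)
  have le: "(u p)\<^sup>2 \<le> (norm (\<Phi> u p))\<^sup>2" if p: "p \<in> \<O>" for p
  proof -
    have "1 * (u p)\<^sup>2 \<le> (1 + snd p) * (u p)\<^sup>2" using snd_pos[OF p] by (intro mult_right_mono) auto
    also have "\<dots> \<le> H1_density \<O> u p" using snd_pos[OF p] by (simp add: H1_density_def)
    finally show ?thesis by (simp add: norm_jet[OF p])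
  qed
  have int: "integrable M (\<lambda>p. (u p)\<^sup>2)"
    by (rule Bochner_Integration.integrable_bound[OF H1_jet(2)[OF u]]) (use le in \<open>auto intro!: AE_I2\<close>)
  then show "u \<in> L2 w \<O>" by (simp add: L2_def)
  show "sqrt (\<integral>p. (u p)\<^sup>2 \<partial>M) \<le> nrm u"
    unfolding H1_norm_jet using le by (intro real_sqrt_le_mono integral_mono int H1_jet(2)[OF u]) simp
qed

lemma L2_inner_bound:
  assumes f: "f \<in> L2 w \<O>" and v: "v \<in> H"
  shows "integrable M (\<lambda>p. f p * v p)"
    "\<bar>L2_inner w \<O> f v\<bar> \<le> sqrt (\<integral>p. (f p)\<^sup>2 \<partial>M) * nrm v"
proof -
  have fv: "f \<in> borel_measurable M" "integrable M (\<lambda>p. (f p)\<^sup>2)"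
    "v \<in> borel_measurable M" "integrable M (\<lambda>p. (v p)\<^sup>2)"
    using f H1_subset_L2(1)[OF v] by (simp_all add: L2_def)
  then show "integrable M (\<lambda>p. f p * v p)" by (intro integrable_mult_of_squares)
  have "\<bar>L2_inner w \<O> f v\<bar> \<le> sqrt (\<integral>p. (f p)\<^sup>2 \<partial>M) * sqrt (\<integral>p. (v p)\<^sup>2 \<partial>M)"
    unfolding L2_inner_def using fv by (intro integral_cauchy_schwarz)
  also have "\<dots> \<le> sqrt (\<integral>p. (f p)\<^sup>2 \<partial>M) * nrm v"
    by (intro mult_left_mono H1_subset_L2(2)[OF v]) simp
  finally show "\<bar>L2_inner w \<O> f v\<bar> \<le> sqrt (\<integral>p. (f p)\<^sup>2 \<partial>M) * nrm v" .
qed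

lemma L2_inner_add_right:
  assumes "f \<in> L2 w \<O>" "u \<in> H" "v \<in> H"
  shows "L2_inner w \<O> f (u + v) = L2_inner w \<O> f u + L2_inner w \<O> f v"
  using assms L2_inner_bound(1) by (simp add: L2_inner_def distrib_left)

lemma L2_inner_scale_right: "L2_inner w \<O> f (c *\<^sub>R u) = c * L2_inner w \<O> f u"
  by (simp add: L2_inner_def mult.left_commute)

lemma H1_norm_eq_0_imp_AE:
  assumes u: "u \<in> H" and 0: "nrm u = 0"
  shows "AE p in lborel. p \<in> \<O> \<longrightarrow> u p = 0"
proof -
  have um[measurable]: "u \<in> borel_measurable M" "integrable M (\<lambda>p. (u p)\<^sup>2)"
    using H1_subset_L2(1)[OF u] by (simp_all add: L2_def)
  have "(\<integral>p. (u p)\<^sup>2 \<partial>M) = 0"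
    using H1_subset_L2(2)[OF u] 0 Bochner_Integration.integral_nonneg[of M "\<lambda>p. (u p)\<^sup>2"] by (simp add: antisym)
  then have "AE p in M. (u p)\<^sup>2 = 0"
    using um(2) by (subst (asm) integral_nonneg_eq_0_iff_AE) auto
  then show ?thesis by (simp add: AE_M)
qed

text \<open>
  Strong monotonicity is inherited from the form, because the penalty is nondecreasing in \<open>u\<close> and
  so contributes a nonnegative term; the Lipschitz constant is \<open>C + 1/\<epsilon>\<close>.  The difference of two
  solutions has norm zero by strong monotonicity.
\<close>

theorem penalized_equation_uniquely_solvable:
  assumes B: "admissible_form M C B" and C: "C > 0" and \<nu>: "\<nu> > 0"
    and coercive: "\<And>v. v \<in> V \<Longrightarrow> \<nu> * (nrm v)\<^sup>2 \<le> form B v v"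
    and f: "f \<in> L2 w \<O>" and \<psi>: "\<psi> \<in> H" and \<epsilon>: "\<epsilon> > 0"
  shows "\<exists>u\<in>V.
    (\<forall>v\<in>V. form B u v + L2_inner w \<O> (penalty \<psi> \<epsilon> u) v = L2_inner w \<O> f v) \<and>
    (\<forall>u'\<in>V. (\<forall>v\<in>V. form B u' v + L2_inner w \<O> (penalty \<psi> \<epsilon> u') v = L2_inner w \<O> f v) \<longrightarrow>
       (AE p in lborel. p \<in> \<O> \<longrightarrow> u' p = u p))"
proof -
  let ?P = "penalty \<psi> \<epsilon>"
  interpret V: semi_hilbert "V" "form (\<lambda>_. inner)" "nrm"
    by (rule H10_semi_hilbert)
  note V1 = H10_subset_H1
  have pen_lip: "\<bar>?P u p - ?P u' p\<bar> \<le> (1 / \<epsilon>) * \<bar>u p - u' p\<bar>" for u u' p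
  proof -
    have "?P u p - ?P u' p = (1 / \<epsilon>) * (max (\<psi> p - u' p) 0 - max (\<psi> p - u p) 0)"
      by (simp add: penalty_def algebra_simps)
    then have "\<bar>?P u p - ?P u' p\<bar> = (1 / \<epsilon>) * \<bar>max (\<psi> p - u' p) 0 - max (\<psi> p - u p) 0\<bar>"
      using \<epsilon> by (simp add: abs_mult)
    also have "\<dots> \<le> (1 / \<epsilon>) * \<bar>u p - u' p\<bar>" using \<epsilon> by (intro mult_left_mono) auto
    finally show ?thesis .
  qed
  have pen_mono: "0 \<le> (?P u p - ?P u' p) * (u p - u' p)" for u u' p
  proof -
    have "?P u p - ?P u' p = (1 / \<epsilon>) * (max (\<psi> p - u' p) 0 - max (\<psi> p - u p) 0)"
      by (simp add: penalty_def algebra_simps)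
    then have "(?P u p - ?P u' p) * (u p - u' p)
        = (1 / \<epsilon>) * ((max (\<psi> p - u' p) 0 - max (\<psi> p - u p) 0) * (u p - u' p))"
      by simp
    moreover have "0 \<le> (max (\<psi> p - u' p) 0 - max (\<psi> p - u p) 0) * (u p - u' p)"
      by (cases "u p \<le> u' p") (auto intro!: mult_nonneg_nonneg mult_nonpos_nonpos)
    ultimately show ?thesis using \<epsilon> by simp
  qed
  have pen_meas: "?P u \<in> borel_measurable M" if "u \<in> H" for u
  proof -
    have [measurable]: "u \<in> borel_measurable M" "\<psi> \<in> borel_measurable M"
      using that \<psi> by (simp_all add: H1_def)
    show ?thesis unfolding penalty_def[abs_def] by measurable
  qed
  have pen_L2: "?P u \<in> L2 w \<O>" if u: "u \<in> H" for u
  proof -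
    have d: "integrable M (\<lambda>p. (1 / \<epsilon>)\<^sup>2 * ((\<psi> - u) p)\<^sup>2)"
      using H1_subset_L2(1)[OF H1.V_diff[OF \<psi> u]] unfolding L2_def by (intro integrable_mult_right) simp
    have "(?P u p)\<^sup>2 \<le> (1 / \<epsilon>)\<^sup>2 * ((\<psi> - u) p)\<^sup>2" for p
    proof -
      have "(max (\<psi> p - u p) 0)\<^sup>2 \<le> (\<psi> p - u p)\<^sup>2" by (simp add: max_def)
      then show ?thesis unfolding penalty_def power_mult_distrib
        by (intro mult_mono) auto
    qed
    then have "integrable M (\<lambda>p. (?P u p)\<^sup>2)"
      using pen_meas[OF u] by (intro Bochner_Integration.integrable_bound[OF d]) (auto intro!: AE_I2)
    then show ?thesis using pen_meas[OF u] by (simp add: L2_def)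
  qed
  have pen_diff_L2: "(\<lambda>p. ?P u p - ?P u' p) \<in> L2 w \<O>"
    "sqrt (\<integral>p. (?P u p - ?P u' p)\<^sup>2 \<partial>M) \<le> (1 / \<epsilon>) * nrm (u - u')"
    if u: "u \<in> H" "u' \<in> H" for u u'
  proof -
    have d: "integrable M (\<lambda>p. (1 / \<epsilon>)\<^sup>2 * ((u - u') p)\<^sup>2)"
      using H1_subset_L2(1)[OF H1.V_diff[OF u]] unfolding L2_def by (intro integrable_mult_right) simp
    have le: "(?P u p - ?P u' p)\<^sup>2 \<le> (1 / \<epsilon>)\<^sup>2 * ((u - u') p)\<^sup>2" for p
    proof -
      have "\<bar>?P u p - ?P u' p\<bar>\<^sup>2 \<le> ((1 / \<epsilon>) * \<bar>u p - u' p\<bar>)\<^sup>2"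
        using pen_lip by (intro power_mono) auto
      then show ?thesis by (simp add: power_mult_distrib power_divide)
    qed
    have m: "(\<lambda>p. ?P u p - ?P u' p) \<in> borel_measurable M"
      using pen_meas u by (intro borel_measurable_diff) auto
    have i: "integrable M (\<lambda>p. (?P u p - ?P u' p)\<^sup>2)"
      using m le by (intro Bochner_Integration.integrable_bound[OF d]) (auto intro!: AE_I2)
    then show "(\<lambda>p. ?P u p - ?P u' p) \<in> L2 w \<O>" using m by (simp add: L2_def)
    have "sqrt (\<integral>p. (?P u p - ?P u' p)\<^sup>2 \<partial>M) \<le> sqrt (\<integral>p. (1 / \<epsilon>)\<^sup>2 * ((u - u') p)\<^sup>2 \<partial>M)"
      by (intro real_sqrt_le_mono integral_mono i d le)
    also have "\<dots> = (1 / \<epsilon>) * sqrt (\<integral>p. ((u - u') p)\<^sup>2 \<partial>M)"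
      using \<epsilon> by (simp add: real_sqrt_mult real_sqrt_divide)
    also have "\<dots> \<le> (1 / \<epsilon>) * nrm (u - u')"
      using \<epsilon> by (intro mult_left_mono H1_subset_L2(2) H1.V_diff u) auto
    finally show "sqrt (\<integral>p. (?P u p - ?P u' p)\<^sup>2 \<partial>M) \<le> (1 / \<epsilon>) * nrm (u - u')" .
  qed
  define T where "T u v = form B u v + L2_inner w \<O> (?P u) v - L2_inner w \<O> f v" for u v
  have T_diff: "T u v - T u' v = form B (u - u') v
      + L2_inner w \<O> (\<lambda>p. ?P u p - ?P u' p) v"
    if "u \<in> V" "u' \<in> V" "v \<in> V" for u u' v
  proof -
    have "form B u v = form B (u - u') v + form B u' v"
      using form_add(1)[OF B, of "u - u'" u' v] that by (simp add: V1 V.V_diff)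
    moreover have "L2_inner w \<O> (\<lambda>p. ?P u p - ?P u' p) v
        = L2_inner w \<O> (?P u) v - L2_inner w \<O> (?P u') v"
      unfolding L2_inner_def left_diff_distrib
      using that by (intro Bochner_Integration.integral_diff L2_inner_bound(1) pen_L2 V1)
    ultimately show ?thesis by (simp add: T_def)
  qed
  have T_mono: "\<nu> * (nrm (u - u'))\<^sup>2 \<le> T u (u - u') - T u' (u - u')"
    if "u \<in> V" "u' \<in> V" for u u'
  proof -
    have "0 \<le> L2_inner w \<O> (\<lambda>p. ?P u p - ?P u' p) (u - u')"
      unfolding L2_inner_def using pen_mono by (intro Bochner_Integration.integral_nonneg) simp
    then show ?thesis using coercive[OF V.V_diff[OF that]] T_diff[OF that V.V_diff[OF that]] by simp
  qed
  have "\<exists>u\<in>V. \<forall>v\<in>V. T u v = 0"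
  proof (rule V.strongly_monotone_solvable[where L = "C + 1 / \<epsilon>" and \<nu> = \<nu>])
    fix u v z assume "u \<in> V" "v \<in> V" "z \<in> V"
    then show "T u (v + z) = T u v + T u z"
      by (simp add: T_def V1 form_add(2)[OF B] L2_inner_add_right pen_L2 f)
  next
    fix c u v assume "u \<in> V" "v \<in> V"
    then show "T u (c *\<^sub>R v) = c * T u v"
      by (simp add: T_def V1 form_scale(2)[OF B] L2_inner_scale_right algebra_simps)
  next
    fix u assume u: "u \<in> V"
    define K where "K = C * nrm u + sqrt (\<integral>p. (?P u p)\<^sup>2 \<partial>M) + sqrt (\<integral>p. (f p)\<^sup>2 \<partial>M)"
    have "\<bar>T u v\<bar> \<le> K * nrm v" if v: "v \<in> V" for v
      using form_bound[OF B less_imp_le[OF C] V1[OF u] V1[OF v]]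
        L2_inner_bound(2)[OF pen_L2[OF V1[OF u]] V1[OF v]] L2_inner_bound(2)[OF f V1[OF v]]
      unfolding T_def K_def distrib_right by linarith
    then show "\<exists>K. \<forall>v\<in>V. \<bar>T u v\<bar> \<le> K * nrm v" by blast
  next
    fix u u' v assume u: "u \<in> V" "u' \<in> V" and v: "v \<in> V"
    have "\<bar>form B (u - u') v\<bar> \<le> C * nrm (u - u') * nrm v"
      using form_bound[OF B less_imp_le[OF C] V1[OF V.V_diff[OF u]] V1[OF v]] .
    moreover have "\<bar>L2_inner w \<O> (\<lambda>p. ?P u p - ?P u' p) v\<bar>
        \<le> (1 / \<epsilon>) * nrm (u - u') * nrm v"
      using L2_inner_bound(2)[OF pen_diff_L2(1)[OF V1[OF u(1)] V1[OF u(2)]] V1[OF v]]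
        mult_right_mono[OF pen_diff_L2(2)[OF V1[OF u(1)] V1[OF u(2)]] H1_norm_nonneg[of v]]
      by linarith
    ultimately show "\<bar>T u v - T u' v\<bar> \<le> (C + 1 / \<epsilon>) * nrm (u - u') * nrm v"
      unfolding T_diff[OF u v] distrib_right by linarith
  next
    show "0 < C + 1 / \<epsilon>" using C \<epsilon> by (simp add: add_pos_pos)
  qed (fact T_mono \<nu>)+
  then obtain u where u: "u \<in> V" and sol: "\<And>v. v \<in> V \<Longrightarrow> T u v = 0" by blast
  have "AE p in lborel. p \<in> \<O> \<longrightarrow> u' p = u p"
    if u': "u' \<in> V" and sol': "\<And>v. v \<in> V \<Longrightarrow> T u' v = 0" for u'
  proof -
    have "\<nu> * (nrm (u' - u))\<^sup>2 \<le> 0"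
      using T_mono[OF u' u] sol[OF V.V_diff[OF u' u]] sol'[OF V.V_diff[OF u' u]] by simp
    then have "nrm (u' - u) = 0" using \<nu> by (simp add: mult_le_0_iff)
    then have "AE p in lborel. p \<in> \<O> \<longrightarrow> (u' - u) p = 0"
      by (intro H1_norm_eq_0_imp_AE V1 V.V_diff u u')
    then show ?thesis by simp
  qed
  with u sol show ?thesis unfolding T_def by (intro bexI[of _ u]) auto
qed

end

section \<open>The Heston form\<close>

text \<open>
  A bounded part of the half-plane lies in a rectangle, over which \<open>y\<^bsup>\<beta> - 1\<^esup>\<close> is integrable by
  Tonelli's theorem since \<open>\<beta> - 1 > -1\<close>.
\<close>

lemma heston_weight_local_finite:
  fixes w :: "real \<times> real \<Rightarrow> real" and A :: "(real \<times> real) set"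
  assumes "\<beta> > (0::real)" and w: "\<And>p. 0 < snd p \<Longrightarrow> w p \<le> snd p powr (\<beta> - 1)"
    and A: "A \<in> sets lborel" "A \<subseteq> {p. 0 < snd p \<and> norm p \<le> R}"
  shows "(\<integral>\<^sup>+p\<in>A. ennreal (w p) \<partial>lborel) < \<infinity>"
proof -
  define k where "k y = indicator {0..\<bar>R\<bar>} y * y powr (\<beta> - 1)" for y
  have km[measurable]: "k \<in> borel_measurable borel" unfolding k_def by measurable
  have "(\<lambda>y. y powr (\<beta> - 1)) integrable_on {0..\<bar>R\<bar>}"
    using assms(1) by (intro integrable_on_powr_from_0) auto
  then have "(\<lambda>y. y powr (\<beta> - 1)) absolutely_integrable_on {0..\<bar>R\<bar>}"
    by (rule nonnegative_absolutely_integrable_1) simp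
  then have "integrable lebesgue k" by (simp add: set_integrable_def k_def[abs_def])
  then have "integrable lborel k" by (simp add: integrable_completion)
  moreover have "norm (k y) = k y" for y by (simp add: k_def)
  ultimately have fin: "(\<integral>\<^sup>+y. ennreal (k y) \<partial>lborel) < \<infinity>" by (simp add: integrable_iff_bounded)
  have "(\<integral>\<^sup>+p\<in>A. ennreal (w p) \<partial>lborel)
      \<le> (\<integral>\<^sup>+p. indicator {- \<bar>R\<bar>..\<bar>R\<bar>} (fst p) * ennreal (k (snd p)) \<partial>lborel)"
  proof (rule nn_integral_mono)
    fix p :: "real \<times> real"
    show "ennreal (w p) * indicator A p \<le> indicator {- \<bar>R\<bar>..\<bar>R\<bar>} (fst p) * ennreal (k (snd p))"
    proof (cases "p \<in> A")
      case True
      then have p: "0 < snd p" "norm p \<le> R" using A by auto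
      then have "\<bar>fst p\<bar> \<le> \<bar>R\<bar>" "\<bar>snd p\<bar> \<le> \<bar>R\<bar>"
        using norm_fst_le[of "fst p" "snd p"] norm_snd_le[of "snd p" "fst p"] by auto
      then have "fst p \<in> {- \<bar>R\<bar>..\<bar>R\<bar>}" "snd p \<in> {0..\<bar>R\<bar>}" using p(1) unfolding atLeastAtMost_iff by linarith+
      then show ?thesis using True w[OF p(1)] by (simp add: k_def ennreal_leI)
    qed simp
  qed
  also have "\<dots> = (\<integral>\<^sup>+p. indicator {- \<bar>R\<bar>..\<bar>R\<bar>} (fst p) * ennreal (k (snd p)) \<partial>(lborel \<Otimes>\<^sub>M lborel))"
    by (simp add: lborel_prod)
  also have "\<dots> = (\<integral>\<^sup>+x. \<integral>\<^sup>+y. indicator {- \<bar>R\<bar>..\<bar>R\<bar>} x * ennreal (k y) \<partial>lborel \<partial>lborel)"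
    by (subst lborel.nn_integral_fst[symmetric]) auto
  also have "\<dots> = (\<integral>\<^sup>+x. indicator {- \<bar>R\<bar>..\<bar>R\<bar>} x * (\<integral>\<^sup>+y. ennreal (k y) \<partial>lborel) \<partial>lborel)"
    by (intro nn_integral_cong nn_integral_cmult) auto
  also have "\<dots> = (\<integral>\<^sup>+x. indicator {- \<bar>R\<bar>..\<bar>R\<bar>} (x::real) \<partial>lborel) * (\<integral>\<^sup>+y. ennreal (k y) \<partial>lborel)"
    by (intro nn_integral_multc) auto
  also have "\<dots> < \<infinity>" using fin by (simp add: ennreal_mult_less_top)
  finally show ?thesis .
qed

lemma heston_weighted_domain:
  assumes "\<sigma> \<noteq> 0" "\<kappa> > 0" "\<theta> > 0" "\<gamma> > 0" and dom: "is_domain \<O>"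
  shows "weighted_domain (heston_weight \<kappa> \<theta> \<sigma> \<gamma>) \<O>"
proof
  define \<beta> \<mu> where "\<beta> = 2 * \<kappa> * \<theta> / \<sigma>\<^sup>2" and "\<mu> = 2 * \<kappa> / \<sigma>\<^sup>2"
  have pos: "\<beta> > 0" "\<mu> > 0" using assms by (simp_all add: \<beta>_def \<mu>_def)
  have w: "heston_weight \<kappa> \<theta> \<sigma> \<gamma> = (\<lambda>p. snd p powr (\<beta> - 1) * exp (- \<gamma> * \<bar>fst p\<bar> - \<mu> * snd p))"
    by (simp add: heston_weight_def[abs_def] \<beta>_def \<mu>_def Let_def)
  show O: "open \<O>" "\<O> \<subseteq> half_plane" using dom by (simp_all add: is_domain_def)
  have y: "0 < snd p" if "p \<in> \<O>" for p using that O by (auto simp: half_plane_def)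
  show cont: "continuous_on \<O> (heston_weight \<kappa> \<theta> \<sigma> \<gamma>)"
    unfolding w using y by (intro continuous_intros) (fastforce)+
  show "0 < heston_weight \<kappa> \<theta> \<sigma> \<gamma> p" if "p \<in> \<O>" for p
    unfolding w using y[OF that] by simp
  fix R
  have m: "(\<lambda>p. ennreal (heston_weight \<kappa> \<theta> \<sigma> \<gamma> p)) \<in> borel_measurable (restrict_space lborel \<O>)"
  proof -
    have "heston_weight \<kappa> \<theta> \<sigma> \<gamma> \<in> borel_measurable (restrict_space borel \<O>)"
      using cont by (rule borel_measurable_continuous_on_restrict)
    then have "heston_weight \<kappa> \<theta> \<sigma> \<gamma> \<in> borel_measurable (restrict_space lborel \<O>)"
      by (subst measurable_cong_sets[OF sets_restrict_space_cong refl]) auto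
    then show ?thesis by measurable
  qed
  have "emeasure (wmeasure (heston_weight \<kappa> \<theta> \<sigma> \<gamma>) \<O>) (\<O> \<inter> cball 0 R)
      = (\<integral>\<^sup>+p\<in>\<O> \<inter> cball 0 R. ennreal (heston_weight \<kappa> \<theta> \<sigma> \<gamma> p) \<partial>restrict_space lborel \<O>)"
    unfolding wmeasure_def by (rule emeasure_density[OF m]) (auto simp: sets_restrict_space)
  also have "\<dots> = (\<integral>\<^sup>+p\<in>\<O> \<inter> cball 0 R. ennreal (heston_weight \<kappa> \<theta> \<sigma> \<gamma> p) \<partial>lborel)"
    using O by (subst nn_integral_restrict_space) (auto intro!: nn_integral_cong simp: indicator_def)
  also have "\<dots> < \<infinity>"
  proof (rule heston_weight_local_finite[OF pos(1)])
    show "heston_weight \<kappa> \<theta> \<sigma> \<gamma> p \<le> snd p powr (\<beta> - 1)" if "0 < snd p" for p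
    proof -
      have "- \<gamma> * \<bar>fst p\<bar> \<le> 0" "0 \<le> \<mu> * snd p" using assms(4) pos that by (simp_all add: mult_nonneg_nonneg)
      then have "exp (- \<gamma> * \<bar>fst p\<bar> - \<mu> * snd p) \<le> 1" by simp
      then show ?thesis unfolding w by (simp add: mult_left_le)
    qed
    show "\<O> \<inter> cball 0 R \<in> sets lborel" using O by auto
    show "\<O> \<inter> cball 0 R \<subseteq> {p. 0 < snd p \<and> norm p \<le> R}" using y by auto
  qed
  finally show "emeasure (wmeasure (heston_weight \<kappa> \<theta> \<sigma> \<gamma>) \<O>) (\<O> \<inter> cball 0 R) < \<infinity>" .
qed

text \<open>
  The terms of the Heston form are all of this shape, with \<open>l\<close> and \<open>m\<close> entries of the jets.
\<close>

lemma admissible_rank1: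
  fixes l m :: "'b::euclidean_space \<Rightarrow> real"
  assumes k: "k \<in> borel_measurable M" "\<And>p. p \<in> space M \<Longrightarrow> \<bar>k p\<bar> \<le> K"
    and l: "linear l" "\<And>x. \<bar>l x\<bar> \<le> norm x" and m: "linear m" "\<And>x. \<bar>m x\<bar> \<le> norm x"
  shows "admissible_form M K (\<lambda>p X Y. k p * (l X * m Y))"
  unfolding admissible_form_def
proof (intro conjI ballI allI)
  fix p assume p: "p \<in> space M"
  show "bilinear (\<lambda>X Y. k p * (l X * m Y))"
    unfolding bilinear_def
    by (intro conjI allI linearI) (simp_all add: linear_add[OF l(1)] linear_add[OF m(1)]
        linear_scale[OF l(1)] linear_scale[OF m(1)] algebra_simps)
  fix X Y
  have "\<bar>k p\<bar> * (\<bar>l X\<bar> * \<bar>m Y\<bar>) \<le> K * (norm X * norm Y)"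
    by (intro mult_mono k(2) p l(2) m(2)) (use k(2)[OF p] in auto)
  then show "\<bar>k p * (l X * m Y)\<bar> \<le> K * norm X * norm Y" by (simp add: abs_mult mult.assoc)
next
  fix F G :: "'a \<Rightarrow> 'b"
  assume [measurable]: "F \<in> borel_measurable M" "G \<in> borel_measurable M"
  have [measurable]: "l \<in> borel_measurable borel" "m \<in> borel_measurable borel"
    using l(1) m(1) by (auto intro!: borel_measurable_continuous_onI linear_continuous_on simp: linear_conv_bounded_linear)
  note [measurable] = k(1)
  show "(\<lambda>p. k p * (l (F p) * m (G p))) \<in> borel_measurable M" by measurable
qed

lemma admissible_add:
  fixes B B' :: "'a \<Rightarrow> 'b::euclidean_space \<Rightarrow> 'b \<Rightarrow> real"
  assumes B: "admissible_form M C B" and B': "admissible_form M C' B'"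
  shows "admissible_form M (C + C') (\<lambda>p X Y. B p X Y + B' p X Y)"
  unfolding admissible_form_def
proof (intro conjI ballI allI)
  fix p assume p: "p \<in> space M"
  show "bilinear (\<lambda>X Y. B p X Y + B' p X Y)"
    using admissible_formD(1)[OF B p] admissible_formD(1)[OF B' p]
    unfolding bilinear_def by (intro conjI allI linear_compose_add) auto
  show "\<bar>B p X Y + B' p X Y\<bar> \<le> (C + C') * norm X * norm Y" for X Y
    using admissible_formD(2)[OF B p, of X Y] admissible_formD(2)[OF B' p, of X Y]
    unfolding distrib_right by linarith
next
  fix F G :: "'a \<Rightarrow> 'b" assume "F \<in> borel_measurable M" "G \<in> borel_measurable M"
  then show "(\<lambda>p. B p (F p) (G p) + B' p (F p) (G p)) \<in> borel_measurable M"
    using admissible_formD(3)[OF B] admissible_formD(3)[OF B'] by (intro borel_measurable_add) blast+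
qed

lemma admissible_scale:
  fixes B :: "'a \<Rightarrow> 'b::euclidean_space \<Rightarrow> 'b \<Rightarrow> real"
  assumes B: "admissible_form M C B"
  shows "admissible_form M (\<bar>c\<bar> * C) (\<lambda>p X Y. c * B p X Y)"
  unfolding admissible_form_def
proof (intro conjI ballI allI)
  fix p assume p: "p \<in> space M"
  have "linear (\<lambda>z. c * g z)" if "linear g" for g :: "'b \<Rightarrow> real"
    using linear_compose_scale_right[OF that, of c] by simp
  then show "bilinear (\<lambda>X Y. c * B p X Y)"
    using admissible_formD(1)[OF B p] unfolding bilinear_def by blast
  show "\<bar>c * B p X Y\<bar> \<le> \<bar>c\<bar> * C * norm X * norm Y" for X Y
    using mult_left_mono[OF admissible_formD(2)[OF B p, of X Y], of "\<bar>c\<bar>"] by (simp add: abs_mult mult.assoc)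
next
  fix F G :: "'a \<Rightarrow> 'b" assume "F \<in> borel_measurable M" "G \<in> borel_measurable M"
  then show "(\<lambda>p. c * B p (F p) (G p)) \<in> borel_measurable M"
    using admissible_formD(3)[OF B] by (intro borel_measurable_times) auto
qed

lemma admissible_mono:
  fixes B :: "'a \<Rightarrow> 'b::euclidean_space \<Rightarrow> 'b \<Rightarrow> real"
  assumes B: "admissible_form M C B" and "C \<le> C'"
  shows "admissible_form M C' B"
proof -
  have "C * norm X * norm Y \<le> C' * norm X * norm Y" for X Y :: 'b
    using assms(2) by (intro mult_right_mono) auto
  with B show ?thesis unfolding admissible_form_def by (meson order_trans)
qed

text \<open>
  The factor that relates the weight \<open>y\<close> of the first-order terms to the product of the weights
  \<open>\<surd>y\<close> and \<open>\<surd>(1 + y)\<close> of the two jet entries.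
\<close>

definition damping :: "real \<times> real \<Rightarrow> real" where
  "damping p = sqrt (snd p) / sqrt (1 + snd p)"

lemma damping:
  assumes "0 < snd p"
  shows "\<bar>damping p\<bar> \<le> 1" "damping p * (sqrt (snd p) * sqrt (1 + snd p)) = snd p"
  using assms by (simp_all add: damping_def)

definition principal_part :: "real \<Rightarrow> real \<Rightarrow> real \<times> real \<times> real \<Rightarrow> real \<times> real \<times> real \<Rightarrow> real" where
  "principal_part \<rho> \<sigma> = (\<lambda>(a, b, c) (a', b', c').
     a * a' + \<rho> * \<sigma> * (b * a') + \<rho> * \<sigma> * (a * b') + \<sigma>\<^sup>2 * (b * b'))"

text \<open>
  The integrand of the shifted Heston form as a bilinear function of two jets: the
  second-order part, the two first-order parts, and the two parts of order zero.
\<close>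

definition heston_integrand ::
  "real \<Rightarrow> real \<Rightarrow> real \<Rightarrow> real \<Rightarrow> real \<Rightarrow> real \<Rightarrow> real \<times> real \<Rightarrow>
   real \<times> real \<times> real \<Rightarrow> real \<times> real \<times> real \<Rightarrow> real" where
  "heston_integrand r \<kappa> \<rho> \<sigma> lam \<gamma> p X Y =
     1 / 2 * principal_part \<rho> \<sigma> X Y
     + (- \<gamma> / 2) * (sgn (fst p) * damping p * (fst X * snd (snd Y))
                     + \<rho> * \<sigma> * sgn (fst p) * damping p * (fst (snd X) * snd (snd Y)))
     + (- (\<kappa> * \<rho> / \<sigma> - 1 / 2)) * (damping p * (fst X * snd (snd Y)))
     + r / (1 + snd p) * (snd (snd X) * snd (snd Y))
     + lam * (1 * (snd (snd X) * snd (snd Y)))"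

text \<open>
  The bound \<open>2 |\<rho> \<sigma> a b| \<le> |\<rho>| (a\<^sup>2 + \<sigma>\<^sup>2 b\<^sup>2)\<close> makes the second-order part at least
  \<open>2 \<nu> (a\<^sup>2 + b\<^sup>2)\<close>.  Half of this pays for the first-order terms, which are at most
  \<open>D (|a| + |b|) |c|\<close>; the price in \<open>c\<^sup>2\<close> is \<open>D\<^sup>2 / (2 \<nu>)\<close>, which is what \<open>lam\<close> provides
  beyond the \<open>\<nu> c\<^sup>2\<close> that belongs to the norm.
\<close>

lemma heston_integrand_coercive:
  fixes r \<kappa> \<rho> \<sigma> \<gamma> lam :: real
  defines "\<nu> \<equiv> (1 - \<bar>\<rho>\<bar>) / 4 * min 1 (\<sigma>\<^sup>2)"
    and "D \<equiv> 1 / 2 + \<bar>\<kappa> * \<rho> / \<sigma> - 1 / 2\<bar> + \<bar>\<rho> * \<sigma>\<bar>"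
  assumes \<rho>: "\<bar>\<rho>\<bar> < 1" and \<sigma>: "\<sigma> \<noteq> 0" and r: "r \<ge> 0" and \<gamma>: "0 < \<gamma>" "\<gamma> < 1" and p: "0 < snd p"
    and lam: "lam \<ge> \<nu> + D\<^sup>2 / (2 * \<nu>)"
  shows "\<nu> * (norm X)\<^sup>2 \<le> heston_integrand r \<kappa> \<rho> \<sigma> lam \<gamma> p X X"
proof -
  obtain a b c where X: "X = (a, b, c)" by (cases X)
  define a1 where "a1 = \<kappa> * \<rho> / \<sigma> - 1 / 2"
  define s where "s = damping p"
  define e where "e = sgn (fst p)"
  have s: "\<bar>s\<bar> \<le> 1" unfolding s_def using damping(1)[OF p] .
  have e: "\<bar>e\<bar> \<le> 1" unfolding e_def by (simp add: sgn_if)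
  have \<nu>: "\<nu> > 0" unfolding \<nu>_def using \<rho> \<sigma> by simp
  have D: "D \<ge> 0" by (simp add: D_def)
  \<comment> \<open>ellipticity of the principal part\<close>
  have "2 * \<nu> * (a\<^sup>2 + b\<^sup>2) \<le> 1 / 2 * (a\<^sup>2 + 2 * \<rho> * \<sigma> * (a * b) + \<sigma>\<^sup>2 * b\<^sup>2)"
  proof -
    have "2 * (\<bar>a\<bar> * \<bar>\<sigma> * b\<bar>) \<le> a\<^sup>2 + (\<sigma> * b)\<^sup>2"
      using sum_squares_bound[of "\<bar>a\<bar>" "\<bar>\<sigma> * b\<bar>"] by (simp add: mult.assoc)
    then have "\<bar>\<rho>\<bar> * (2 * (\<bar>a\<bar> * \<bar>\<sigma> * b\<bar>)) \<le> \<bar>\<rho>\<bar> * (a\<^sup>2 + \<sigma>\<^sup>2 * b\<^sup>2)"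
      by (intro mult_left_mono) (auto simp: power_mult_distrib)
    moreover have "- (\<rho> * (2 * (a * (\<sigma> * b)))) \<le> \<bar>\<rho>\<bar> * (2 * (\<bar>a\<bar> * \<bar>\<sigma> * b\<bar>))"
      using abs_ge_minus_self[of "\<rho> * (2 * (a * (\<sigma> * b)))"] by (simp add: abs_mult)
    ultimately have "(1 - \<bar>\<rho>\<bar>) * (a\<^sup>2 + \<sigma>\<^sup>2 * b\<^sup>2) \<le> a\<^sup>2 + 2 * \<rho> * \<sigma> * (a * b) + \<sigma>\<^sup>2 * b\<^sup>2"
      by (simp add: algebra_simps)
    moreover have "(1 - \<bar>\<rho>\<bar>) * (min 1 (\<sigma>\<^sup>2) * (a\<^sup>2 + b\<^sup>2)) \<le> (1 - \<bar>\<rho>\<bar>) * (a\<^sup>2 + \<sigma>\<^sup>2 * b\<^sup>2)"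
    proof (intro mult_left_mono)
      have "min 1 (\<sigma>\<^sup>2) * a\<^sup>2 \<le> 1 * a\<^sup>2" "min 1 (\<sigma>\<^sup>2) * b\<^sup>2 \<le> \<sigma>\<^sup>2 * b\<^sup>2"
        by (intro mult_right_mono; simp)+
      then show "min 1 (\<sigma>\<^sup>2) * (a\<^sup>2 + b\<^sup>2) \<le> a\<^sup>2 + \<sigma>\<^sup>2 * b\<^sup>2" by (simp add: distrib_left)
    qed (use \<rho> in auto)
    ultimately show ?thesis unfolding \<nu>_def by (simp add: field_simps)
  qed
  \<comment> \<open>the first-order terms are absorbed with the weighted Young inequality\<close>
  moreover have "\<gamma> / 2 * (e * s * (a * c) + \<rho> * \<sigma> * e * s * (b * c)) + a1 * (s * (a * c))
      \<le> \<nu> * (a\<^sup>2 + b\<^sup>2) + D\<^sup>2 / (2 * \<nu>) * c\<^sup>2"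
  proof -
    have young: "D * (\<bar>t\<bar> * \<bar>c\<bar>) \<le> \<nu> * t\<^sup>2 + D\<^sup>2 / (4 * \<nu>) * c\<^sup>2" for t
    proof -
      have "0 \<le> (2 * \<nu> * \<bar>t\<bar> - D * \<bar>c\<bar>)\<^sup>2 / (4 * \<nu>)" using \<nu> by simp
      also have "\<dots> = \<nu> * t\<^sup>2 + D\<^sup>2 / (4 * \<nu>) * c\<^sup>2 - D * (\<bar>t\<bar> * \<bar>c\<bar>)"
        using \<nu> by (simp add: power2_diff power_mult_distrib field_simps power2_eq_square)
      finally show ?thesis by simp
    qed
    have bd: "\<bar>x * (y * (z * t))\<bar> \<le> \<bar>x\<bar> * \<bar>t\<bar>" if "\<bar>y\<bar> \<le> 1" "\<bar>z\<bar> \<le> 1" for x y z t :: real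
    proof -
      have "\<bar>y\<bar> * \<bar>z\<bar> \<le> 1" using that by (intro mult_le_one) auto
      then have "\<bar>x\<bar> * \<bar>t\<bar> * (\<bar>y\<bar> * \<bar>z\<bar>) \<le> \<bar>x\<bar> * \<bar>t\<bar>" by (intro mult_left_le) auto
      then show ?thesis by (simp add: abs_mult mult_ac)
    qed
    have g: "\<bar>\<gamma> / 2\<bar> \<le> 1 / 2" using \<gamma> by simp
    have "\<gamma> / 2 * (e * s * (a * c)) \<le> 1 / 2 * \<bar>a * c\<bar>"
    proof -
      have "\<gamma> / 2 * (e * (s * (a * c))) \<le> \<bar>\<gamma> / 2\<bar> * \<bar>a * c\<bar>" using bd[OF e s, of "\<gamma> / 2" "a * c"] by linarith
      also have "\<dots> \<le> 1 / 2 * \<bar>a * c\<bar>" using g by (intro mult_right_mono) auto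
      finally show ?thesis by (simp add: mult.assoc)
    qed
    moreover have "\<gamma> / 2 * (\<rho> * \<sigma> * e * s * (b * c)) \<le> \<bar>\<rho> * \<sigma>\<bar> * \<bar>b * c\<bar>"
    proof -
      have "\<bar>\<gamma> / 2\<bar> * \<bar>\<rho> * \<sigma>\<bar> \<le> 1 * \<bar>\<rho> * \<sigma>\<bar>" using g by (intro mult_right_mono) auto
      then have rs: "\<bar>\<gamma> / 2 * (\<rho> * \<sigma>)\<bar> \<le> \<bar>\<rho> * \<sigma>\<bar>" by (simp only: abs_mult[of "\<gamma> / 2"] mult_1)
      have "(\<gamma> / 2 * (\<rho> * \<sigma>)) * (e * (s * (b * c))) \<le> \<bar>\<gamma> / 2 * (\<rho> * \<sigma>)\<bar> * \<bar>b * c\<bar>"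
        using bd[OF e s, of "\<gamma> / 2 * (\<rho> * \<sigma>)" "b * c"] by linarith
      also have "\<dots> \<le> \<bar>\<rho> * \<sigma>\<bar> * \<bar>b * c\<bar>"
        by (intro mult_right_mono rs) simp
      finally show ?thesis by (simp add: mult.assoc)
    qed
    moreover have "a1 * (s * (a * c)) \<le> \<bar>a1\<bar> * \<bar>a * c\<bar>"
      using bd[OF _ s, of 1 a1 "a * c"] by simp
    moreover have "(1 / 2 + \<bar>a1\<bar>) * \<bar>a * c\<bar> \<le> D * (\<bar>a\<bar> * \<bar>c\<bar>)"
      unfolding D_def a1_def by (intro mult_mono) (auto simp: abs_mult)
    moreover have "\<bar>\<rho> * \<sigma>\<bar> * \<bar>b * c\<bar> \<le> D * (\<bar>b\<bar> * \<bar>c\<bar>)"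
      unfolding D_def by (intro mult_mono) (auto simp: abs_mult)
    ultimately have "\<gamma> / 2 * (e * s * (a * c) + \<rho> * \<sigma> * e * s * (b * c)) + a1 * (s * (a * c))
        \<le> D * (\<bar>a\<bar> * \<bar>c\<bar>) + D * (\<bar>b\<bar> * \<bar>c\<bar>)"
      unfolding distrib_left distrib_right by linarith
    also have "\<dots> \<le> \<nu> * a\<^sup>2 + D\<^sup>2 / (4 * \<nu>) * c\<^sup>2 + (\<nu> * b\<^sup>2 + D\<^sup>2 / (4 * \<nu>) * c\<^sup>2)"
      by (intro add_mono young)
    also have "\<dots> = \<nu> * (a\<^sup>2 + b\<^sup>2) + D\<^sup>2 / (2 * \<nu>) * c\<^sup>2"
      using \<nu> by (simp add: field_simps)
    finally show ?thesis .
  qed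
  moreover have "(\<nu> + D\<^sup>2 / (2 * \<nu>)) * c\<^sup>2 \<le> lam * c\<^sup>2" using lam by (intro mult_right_mono) auto
  moreover have "0 \<le> r / (1 + snd p) * (c * c)" using r p by simp
  moreover have "heston_integrand r \<kappa> \<rho> \<sigma> lam \<gamma> p X X =
      1 / 2 * (a\<^sup>2 + 2 * \<rho> * \<sigma> * (a * b) + \<sigma>\<^sup>2 * b\<^sup>2)
      - (\<gamma> / 2 * (e * s * (a * c) + \<rho> * \<sigma> * e * s * (b * c)) + a1 * (s * (a * c)))
      + r / (1 + snd p) * (c * c) + lam * c\<^sup>2"
    unfolding heston_integrand_def X principal_part_def e_def s_def a1_def
    by (simp add: power2_eq_square algebra_simps)
  moreover have "\<nu> * (norm X)\<^sup>2 = \<nu> * (a\<^sup>2 + b\<^sup>2) + \<nu> * c\<^sup>2"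
    unfolding X by (simp add: norm_Pair algebra_simps)
  ultimately show ?thesis unfolding distrib_right[of \<nu>] by linarith
qed

context weighted_domain
begin

lemma form_sum:
  assumes "admissible_form M C B" "admissible_form M C' B'" "u \<in> H" "v \<in> H"
  shows "form (\<lambda>p X Y. B p X Y + B' p X Y) u v = form B u v + form B' u v"
  unfolding form_def using form_integrable assms by (intro Bochner_Integration.integral_add) blast+

lemma form_mult: fixes c :: real shows "form (\<lambda>p X Y. c * B p X Y) u v = c * form B u v"
  unfolding form_def by simp

lemma heston_integrand_form:
  fixes r \<kappa> \<rho> \<sigma> lam \<gamma> :: real
  assumes r: "r \<ge> 0" and u: "u \<in> H" and v: "v \<in> H"
  defines "a1 \<equiv> \<kappa> * \<rho> / \<sigma> - 1 / 2"
  shows "admissible_form M (\<bar>1 / 2\<bar> * (1 + \<bar>\<rho> * \<sigma>\<bar> + \<bar>\<rho> * \<sigma>\<bar> + \<sigma>\<^sup>2) + \<bar>- \<gamma> / 2\<bar> * (1 + \<bar>\<rho> * \<sigma>\<bar>)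
           + \<bar>- a1\<bar> * 1 + r + \<bar>lam\<bar> * 1) (heston_integrand r \<kappa> \<rho> \<sigma> lam \<gamma>)" (is ?A)
    and "form (heston_integrand r \<kappa> \<rho> \<sigma> lam \<gamma>) u v =
         1 / 2 * (\<integral>p. (weak_dx \<O> u p * weak_dx \<O> v p + \<rho> * \<sigma> * weak_dy \<O> u p * weak_dx \<O> v p
              + \<rho> * \<sigma> * weak_dx \<O> u p * weak_dy \<O> v p + \<sigma>\<^sup>2 * weak_dy \<O> u p * weak_dy \<O> v p) * snd p \<partial>M)
         - \<gamma> / 2 * (\<integral>p. (weak_dx \<O> u p + \<rho> * \<sigma> * weak_dy \<O> u p) * v p * sgn (fst p) * snd p \<partial>M)
         - (\<integral>p. a1 * snd p * weak_dx \<O> u p * v p \<partial>M)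
         + (\<integral>p. r * u p * v p \<partial>M)
         + lam * L2_inner w \<O> (\<lambda>p. (1 + snd p) * u p) v" (is ?E)
proof -
  define b1 where "b1 p X Y = principal_part \<rho> \<sigma> X Y" for p :: "real \<times> real" and X Y
  define b2 where "b2 p X Y = sgn (fst p) * damping p * (fst X * snd (snd Y))
      + \<rho> * \<sigma> * sgn (fst p) * damping p * (fst (snd X) * snd (snd Y))"
    for p :: "real \<times> real" and X Y :: "real \<times> real \<times> real"
  define b3 where "b3 p X Y = damping p * (fst X * snd (snd Y))"
    for p :: "real \<times> real" and X Y :: "real \<times> real \<times> real"
  define b4 where "b4 p X Y = r / (1 + snd p) * (snd (snd X) * snd (snd Y))"
    for p :: "real \<times> real" and X Y :: "real \<times> real \<times> real"
  define b5 where "b5 p X Y = 1 * (snd (snd X) * snd (snd Y))"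
    for p :: "real \<times> real" and X Y :: "real \<times> real \<times> real"
  have y: "0 < snd p" if "p \<in> space M" for p using snd_pos that by simp
  have dm: "damping \<in> borel_measurable M"
    unfolding damping_def[abs_def] using snd_pos
    by (intro continuous_borel_measurable continuous_intros) (fastforce simp: add_nonneg_eq_0_iff)
  have sm: "(\<lambda>p. sgn (fst p)) \<in> borel_measurable M"
  proof -
    have "fst \<in> borel_measurable M" by (intro continuous_borel_measurable continuous_intros)
    then show ?thesis by measurable
  qed
  have sgn1: "\<bar>sgn t\<bar> \<le> 1" for t :: real by (simp add: sgn_if)
  have sd: "\<bar>sgn (fst p) * damping p\<bar> \<le> 1" if "p \<in> space M" for p
    using damping(1)[OF y[OF that]] sgn1[of "fst p"] by (simp add: abs_mult mult_le_one)
  have B1: "admissible_form M (1 + \<bar>\<rho> * \<sigma>\<bar> + \<bar>\<rho> * \<sigma>\<bar> + \<sigma>\<^sup>2) b1"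
  proof -
    have "b1 = (\<lambda>p X Y. 1 * (fst X * fst Y) + \<rho> * \<sigma> * (fst (snd X) * fst Y)
        + \<rho> * \<sigma> * (fst X * fst (snd Y)) + \<sigma>\<^sup>2 * (fst (snd X) * fst (snd Y)))"
      by (intro ext) (simp add: b1_def principal_part_def case_prod_beta)
    then show ?thesis
      by (simp only:) (intro admissible_add admissible_rank1 jet_entries; simp)
  qed
  have B2: "admissible_form M (1 + \<bar>\<rho> * \<sigma>\<bar>) b2"
    unfolding b2_def[abs_def]
  proof (intro admissible_add admissible_rank1 jet_entries)
    show "(\<lambda>p. sgn (fst p) * damping p) \<in> borel_measurable M" using sm dm by measurable
    show "(\<lambda>p. \<rho> * \<sigma> * sgn (fst p) * damping p) \<in> borel_measurable M" using sm dm by measurable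
    show "\<bar>\<rho> * \<sigma> * sgn (fst p) * damping p\<bar> \<le> \<bar>\<rho> * \<sigma>\<bar>" if "p \<in> space M" for p
      using mult_left_mono[OF sd[OF that], of "\<bar>\<rho> * \<sigma>\<bar>"] by (simp add: abs_mult mult.assoc)
  qed (rule sd)
  have B3: "admissible_form M 1 b3"
    unfolding b3_def[abs_def] by (intro admissible_rank1 jet_entries dm damping(1) y)
  have B4: "admissible_form M r b4"
    unfolding b4_def[abs_def]
  proof (intro admissible_rank1 jet_entries)
    show "(\<lambda>p. r / (1 + snd p)) \<in> borel_measurable M"
      using snd_pos by (intro continuous_borel_measurable continuous_intros) fastforce
    show "\<bar>r / (1 + snd p)\<bar> \<le> r" if "p \<in> space M" for p
      using r y[OF that] by (simp add: divide_le_eq mult_left_mono algebra_simps)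
  qed
  have B5: "admissible_form M 1 b5"
    unfolding b5_def[abs_def] by (intro admissible_rank1 jet_entries) auto
  have hB: "heston_integrand r \<kappa> \<rho> \<sigma> lam \<gamma> =
      (\<lambda>p X Y. 1 / 2 * b1 p X Y + (- \<gamma> / 2) * b2 p X Y + (- a1) * b3 p X Y + b4 p X Y + lam * b5 p X Y)"
    by (intro ext) (simp only: heston_integrand_def b1_def b2_def b3_def b4_def b5_def a1_def)
  show ?A unfolding hB by (intro admissible_add admissible_scale B1 B2 B3 B4 B5)
  have "form (heston_integrand r \<kappa> \<rho> \<sigma> lam \<gamma>) u v =
      1 / 2 * form b1 u v + (- \<gamma> / 2) * form b2 u v + (- a1) * form b3 u v + form b4 u v + lam * form b5 u v"
  proof -
    note s1 = admissible_scale[OF B1, of "1 / 2"] and s2 = admissible_scale[OF B2, of "- \<gamma> / 2"]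
      and s3 = admissible_scale[OF B3, of "- a1"] and s5 = admissible_scale[OF B5, of lam]
    note s12 = admissible_add[OF s1 s2]
    note s123 = admissible_add[OF s12 s3]
    note s1234 = admissible_add[OF s123 B4]
    show ?thesis unfolding hB
      by (simp only: form_sum[OF s1234 s5 u v] form_sum[OF s123 B4 u v] form_sum[OF s12 s3 u v]
          form_sum[OF s1 s2 u v] form_mult)
  qed
  also have "form b1 u v = (\<integral>p. (weak_dx \<O> u p * weak_dx \<O> v p + \<rho> * \<sigma> * weak_dy \<O> u p * weak_dx \<O> v p
              + \<rho> * \<sigma> * weak_dx \<O> u p * weak_dy \<O> v p + \<sigma>\<^sup>2 * weak_dy \<O> u p * weak_dy \<O> v p) * snd p \<partial>M)"
    unfolding form_def
  proof (intro Bochner_Integration.integral_cong refl)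
    fix p assume "p \<in> space M"
    define t where "t = sqrt (snd p)"
    have t: "snd p = t * t" using y[OF \<open>p \<in> space M\<close>] by (simp add: t_def)
    show "b1 p (\<Phi> u p) (\<Phi> v p) = (weak_dx \<O> u p * weak_dx \<O> v p + \<rho> * \<sigma> * weak_dy \<O> u p * weak_dx \<O> v p
              + \<rho> * \<sigma> * weak_dx \<O> u p * weak_dy \<O> v p + \<sigma>\<^sup>2 * weak_dy \<O> u p * weak_dy \<O> v p) * snd p"
      unfolding b1_def weighted_jet_def principal_part_def prod.case t_def[symmetric]
      by (subst t) (simp add: algebra_simps)
  qed
  also have "form b2 u v = (\<integral>p. (weak_dx \<O> u p + \<rho> * \<sigma> * weak_dy \<O> u p) * v p * sgn (fst p) * snd p \<partial>M)"
    unfolding form_def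
  proof (intro Bochner_Integration.integral_cong refl)
    fix p assume "p \<in> space M"
    have "b2 p (\<Phi> u p) (\<Phi> v p) = sgn (fst p) * (weak_dx \<O> u p + \<rho> * \<sigma> * weak_dy \<O> u p) * v p
        * (damping p * (sqrt (snd p) * sqrt (1 + snd p)))"
      unfolding b2_def weighted_jet_def by (simp add: algebra_simps)
    then show "b2 p (\<Phi> u p) (\<Phi> v p) = (weak_dx \<O> u p + \<rho> * \<sigma> * weak_dy \<O> u p) * v p * sgn (fst p) * snd p"
      unfolding damping(2)[OF y[OF \<open>p \<in> space M\<close>]] by (simp add: algebra_simps)
  qed
  also have "(- a1) * form b3 u v = - (\<integral>p. a1 * snd p * weak_dx \<O> u p * v p \<partial>M)"
  proof -
    have "a1 * form b3 u v = (\<integral>p. a1 * b3 p (\<Phi> u p) (\<Phi> v p) \<partial>M)" unfolding form_def by simp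
    also have "\<dots> = (\<integral>p. a1 * snd p * weak_dx \<O> u p * v p \<partial>M)"
    proof (intro Bochner_Integration.integral_cong refl)
      fix p assume "p \<in> space M"
      have "b3 p (\<Phi> u p) (\<Phi> v p) = weak_dx \<O> u p * v p * (damping p * (sqrt (snd p) * sqrt (1 + snd p)))"
        unfolding b3_def weighted_jet_def by simp
      then show "a1 * b3 p (\<Phi> u p) (\<Phi> v p) = a1 * snd p * weak_dx \<O> u p * v p"
        unfolding damping(2)[OF y[OF \<open>p \<in> space M\<close>]] by simp
    qed
    finally show ?thesis by simp
  qed
  also have "form b4 u v = (\<integral>p. r * u p * v p \<partial>M)"
    unfolding form_def
  proof (intro Bochner_Integration.integral_cong refl)
    fix p assume "p \<in> space M"
    have "sqrt (1 + snd p) * sqrt (1 + snd p) = 1 + snd p" "1 + snd p \<noteq> 0" using y[OF \<open>p \<in> space M\<close>] by simp_all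
    then have "r / (1 + snd p) * (u p * v p * (sqrt (1 + snd p) * sqrt (1 + snd p))) = r * u p * v p" by simp
    then show "b4 p (\<Phi> u p) (\<Phi> v p) = r * u p * v p"
      unfolding b4_def weighted_jet_def by (simp add: mult_ac)
  qed
  also have "form b5 u v = L2_inner w \<O> (\<lambda>p. (1 + snd p) * u p) v"
    unfolding form_def L2_inner_def
  proof (intro Bochner_Integration.integral_cong refl)
    fix p assume "p \<in> space M"
    have "(sqrt (1 + snd p) * sqrt (1 + snd p)) * (u p * v p) = (1 + snd p) * u p * v p"
      using y[OF \<open>p \<in> space M\<close>] by simp
    then show "b5 p (\<Phi> u p) (\<Phi> v p) = (1 + snd p) * u p * v p"
      unfolding b5_def weighted_jet_def by (simp add: mult_ac)
  qed
  finally show ?E by simp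
qed

end

lemma heston_form_shift_eq_form:
  assumes "weighted_domain (heston_weight \<kappa> \<theta> \<sigma> \<gamma>) \<O>" and "r \<ge> 0"
    and "u \<in> H1 (heston_weight \<kappa> \<theta> \<sigma> \<gamma>) \<O>" "v \<in> H1 (heston_weight \<kappa> \<theta> \<sigma> \<gamma>) \<O>"
  shows "heston_form_shift r \<kappa> \<theta> \<rho> \<sigma> lam \<gamma> \<O> u v =
    weighted_domain.form (heston_weight \<kappa> \<theta> \<sigma> \<gamma>) \<O> (heston_integrand r \<kappa> \<rho> \<sigma> lam \<gamma>) u v"
  unfolding weighted_domain.heston_integrand_form(2)[OF assms] heston_form_shift_def heston_form_def Let_def
  by simp

text \<open>
  A bound of the Heston form that is uniform in \<open>0 < \<gamma> < 1\<close> and in the domain, as the order of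
  quantifiers in \<open>coercive_shift\<close> demands.
\<close>

definition heston_bound :: "real \<Rightarrow> real \<Rightarrow> real \<Rightarrow> real \<Rightarrow> real \<Rightarrow> real" where
  "heston_bound r \<kappa> \<rho> \<sigma> lam = 1 + 2 * \<bar>\<rho> * \<sigma>\<bar> + \<sigma>\<^sup>2 + \<bar>\<kappa> * \<rho> / \<sigma> - 1 / 2\<bar> + r + \<bar>lam\<bar>"

lemma heston_integrand_admissible:
  assumes W: "weighted_domain (heston_weight \<kappa> \<theta> \<sigma> \<gamma>) \<O>" and r: "r \<ge> 0" and \<gamma>: "0 < \<gamma>" "\<gamma> < 1"
  shows "admissible_form (wmeasure (heston_weight \<kappa> \<theta> \<sigma> \<gamma>) \<O>) (heston_bound r \<kappa> \<rho> \<sigma> lam)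
           (heston_integrand r \<kappa> \<rho> \<sigma> lam \<gamma>)"
proof -
  have z: "0 \<in> H1 (heston_weight \<kappa> \<theta> \<sigma> \<gamma>) \<O>" using W by (rule weighted_domain.H1_zero)
  have "\<gamma> / 2 * (1 + \<bar>\<rho> * \<sigma>\<bar>) \<le> 1 / 2 * (1 + \<bar>\<rho> * \<sigma>\<bar>)" using \<gamma> by (intro mult_right_mono) auto
  moreover have gen: "1 / 2 * (1 + a + a + s) + g * (1 + a) + d * 1 + r + l * 1 \<le> 1 + 2 * a + s + d + r + l"
    if "g * (1 + a) \<le> 1 / 2 * (1 + a)" "0 \<le> a" "0 \<le> s" for a s d l g :: real
    using that by (simp add: algebra_simps)
  moreover have half: "\<bar>1 / 2\<bar> = (1 / 2 :: real)" "\<bar>- \<gamma> / 2\<bar> = \<gamma> / 2" using \<gamma> by simp_all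
  ultimately have "\<bar>1 / 2\<bar> * (1 + \<bar>\<rho> * \<sigma>\<bar> + \<bar>\<rho> * \<sigma>\<bar> + \<sigma>\<^sup>2) + \<bar>- \<gamma> / 2\<bar> * (1 + \<bar>\<rho> * \<sigma>\<bar>)
      + \<bar>- (\<kappa> * \<rho> / \<sigma> - 1 / 2)\<bar> * 1 + r + \<bar>lam\<bar> * 1 \<le> heston_bound r \<kappa> \<rho> \<sigma> lam"
    unfolding heston_bound_def half abs_minus_cancel by (intro gen) simp_all
  then show ?thesis
    by (rule admissible_mono[OF weighted_domain.heston_integrand_form(1)[OF W r z z]])
qed

theorem theorem4p18:
  fixes r q \<kappa> \<theta> \<rho> \<sigma> :: real
  assumes "\<sigma> \<noteq> 0" and "-1 < \<rho>" and "\<rho> < 1" and "\<kappa> > 0" and "\<theta> > 0" and "r \<ge> 0" and "q \<ge> 0"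
    and "r - q - \<kappa> * \<theta> * \<rho> / \<sigma> = 0"
  shows "\<exists>\<gamma>\<^sub>0>0.
    (\<exists>lam. coercive_shift r \<kappa> \<theta> \<rho> \<sigma> \<gamma>\<^sub>0 lam) \<and>
    (\<forall>lam \<gamma> \<O> f \<psi> \<epsilon>.
       coercive_shift r \<kappa> \<theta> \<rho> \<sigma> \<gamma>\<^sub>0 lam \<and>
       0 < \<gamma> \<and> \<gamma> < \<gamma>\<^sub>0 \<and>
       is_domain \<O> \<and> Gamma0 \<O> \<noteq> {} \<and>
       f \<in> L2 (heston_weight \<kappa> \<theta> \<sigma> \<gamma>) \<O> \<and>
       \<psi> \<in> H1 (heston_weight \<kappa> \<theta> \<sigma> \<gamma>) \<O> \<and>
       (\<lambda>p. max (\<psi> p) 0) \<in> H10 (heston_weight \<kappa> \<theta> \<sigma> \<gamma>) \<O> \<and>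
       \<epsilon> > 0 \<longrightarrow>
       (\<exists>u. solves_penalized r \<kappa> \<theta> \<rho> \<sigma> lam \<gamma> \<O> f \<psi> \<epsilon> u \<and>
            (\<forall>u'. solves_penalized r \<kappa> \<theta> \<rho> \<sigma> lam \<gamma> \<O> f \<psi> \<epsilon> u' \<longrightarrow>
                  (AE p in lborel. p \<in> \<O> \<longrightarrow> u' p = u p))))"
proof (rule exI[of _ 1], intro conjI allI impI)
  show "(0::real) < 1" by simp
  define \<nu> where "\<nu> = (1 - \<bar>\<rho>\<bar>) / 4 * min 1 (\<sigma>\<^sup>2)"
  define D where "D = 1 / 2 + \<bar>\<kappa> * \<rho> / \<sigma> - 1 / 2\<bar> + \<bar>\<rho> * \<sigma>\<bar>"
  define lam where "lam = \<nu> + D\<^sup>2 / (2 * \<nu>)"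
  have \<rho>: "\<bar>\<rho>\<bar> < 1" using assms by auto
  have \<nu>: "\<nu> > 0" unfolding \<nu>_def using \<rho> assms(1) by simp
  have lam: "lam > 0" unfolding lam_def using \<nu> by (simp add: add_pos_nonneg)
  have W: "weighted_domain (heston_weight \<kappa> \<theta> \<sigma> \<gamma>) \<O>" if "0 < \<gamma>" "is_domain \<O>" for \<gamma> \<O>
    using assms that by (intro heston_weighted_domain)
  have bound_pos: "heston_bound r \<kappa> \<rho> \<sigma> l > 0" for l
    unfolding heston_bound_def using assms(6) by (intro add_pos_nonneg) auto
  have "coercive_shift r \<kappa> \<theta> \<rho> \<sigma> 1 lam"
    unfolding coercive_shift_def Let_def
  proof (rule conjI[OF lam], rule exI[of _ "heston_bound r \<kappa> \<rho> \<sigma> lam"], rule conjI[OF bound_pos],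
      rule exI[of _ \<nu>], rule conjI[OF \<nu>], intro conjI allI impI ballI; elim conjE)
    fix \<gamma> :: real and \<O> assume \<gamma>: "0 < \<gamma>" "\<gamma> < 1" and O: "is_domain \<O>"
    interpret weighted_domain "heston_weight \<kappa> \<theta> \<sigma> \<gamma>" \<O> by (rule W[OF \<gamma>(1) O])
    let ?w = "heston_weight \<kappa> \<theta> \<sigma> \<gamma>"
    note W' = weighted_domain_axioms
    note adm = heston_integrand_admissible[OF W' assms(6) \<gamma>]
    {
      fix u v assume "u \<in> H10 ?w \<O>" "v \<in> H10 ?w \<O>"
      then have uv: "u \<in> H1 ?w \<O>" "v \<in> H1 ?w \<O>" by (auto intro: H10_subset_H1)
      show "\<bar>heston_form_shift r \<kappa> \<theta> \<rho> \<sigma> lam \<gamma> \<O> u v\<bar>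
          \<le> heston_bound r \<kappa> \<rho> \<sigma> lam * H1_norm ?w \<O> u * H1_norm ?w \<O> v"
        unfolding heston_form_shift_eq_form[OF W' assms(6) uv]
        by (rule form_bound[OF adm less_imp_le[OF bound_pos] uv])
    }
    fix v assume "v \<in> H10 ?w \<O>"
    then have v: "v \<in> H1 ?w \<O>" by (rule H10_subset_H1)
    have "\<nu> * (H1_norm ?w \<O> v)\<^sup>2 = (\<integral>p. \<nu> * (norm (\<Phi> v p))\<^sup>2 \<partial>M)" by (simp add: H1_norm_jet)
    also have "\<dots> \<le> (\<integral>p. heston_integrand r \<kappa> \<rho> \<sigma> lam \<gamma> p (\<Phi> v p) (\<Phi> v p) \<partial>M)"
    proof (rule integral_mono)
      show "integrable M (\<lambda>p. \<nu> * (norm (\<Phi> v p))\<^sup>2)" using H1_jet(2)[OF v] by simp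
      show "integrable M (\<lambda>p. heston_integrand r \<kappa> \<rho> \<sigma> lam \<gamma> p (\<Phi> v p) (\<Phi> v p))"
        by (rule form_integrable[OF adm v v])
      show "\<nu> * (norm (\<Phi> v p))\<^sup>2 \<le> heston_integrand r \<kappa> \<rho> \<sigma> lam \<gamma> p (\<Phi> v p) (\<Phi> v p)" if "p \<in> space M" for p
        unfolding \<nu>_def
        by (rule heston_integrand_coercive)
          (use \<rho> assms \<gamma> that snd_pos in \<open>auto simp: lam_def \<nu>_def D_def\<close>)
    qed
    also have "\<dots> = heston_form_shift r \<kappa> \<theta> \<rho> \<sigma> lam \<gamma> \<O> v v"
      unfolding heston_form_shift_eq_form[OF W' assms(6) v v] form_def ..
    finally show "\<nu> * (H1_norm ?w \<O> v)\<^sup>2 \<le> heston_form_shift r \<kappa> \<theta> \<rho> \<sigma> lam \<gamma> \<O> v v" .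
  qed
  then show "\<exists>lam. coercive_shift r \<kappa> \<theta> \<rho> \<sigma> 1 lam" ..
  fix l \<gamma> \<epsilon> :: real and \<O> f \<psi>
  let ?w = "heston_weight \<kappa> \<theta> \<sigma> \<gamma>"
  assume A: "coercive_shift r \<kappa> \<theta> \<rho> \<sigma> 1 l \<and> 0 < \<gamma> \<and> \<gamma> < 1 \<and> is_domain \<O> \<and> Gamma0 \<O> \<noteq> {} \<and>
       f \<in> L2 ?w \<O> \<and> \<psi> \<in> H1 ?w \<O> \<and> (\<lambda>p. max (\<psi> p) 0) \<in> H10 ?w \<O> \<and> \<epsilon> > 0"
  then have \<gamma>: "0 < \<gamma>" "\<gamma> < 1" and O: "is_domain \<O>" "Gamma0 \<O> \<noteq> {}" and f: "f \<in> L2 ?w \<O>"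
    and \<psi>: "\<psi> \<in> H1 ?w \<O>" and \<epsilon>: "\<epsilon> > 0" and cs: "coercive_shift r \<kappa> \<theta> \<rho> \<sigma> 1 l" by blast+
  interpret weighted_domain ?w \<O> by (rule W[OF \<gamma>(1) O(1)])
  note W' = weighted_domain_axioms
  let ?B = "heston_integrand r \<kappa> \<rho> \<sigma> l \<gamma>"
  have eq: "heston_form_shift r \<kappa> \<theta> \<rho> \<sigma> l \<gamma> \<O> u v = form ?B u v" if "u \<in> H10 ?w \<O>" "v \<in> H10 ?w \<O>" for u v
    using that by (intro heston_form_shift_eq_form[OF W' assms(6)] H10_subset_H1)
  obtain C \<nu>1 where "\<nu>1 > 0" and all: "\<forall>\<gamma> \<O>. 0 < \<gamma> \<and> \<gamma> < 1 \<and> is_domain \<O> \<and> Gamma0 \<O> \<noteq> {} \<longrightarrow>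
      (\<forall>u\<in>H10 (heston_weight \<kappa> \<theta> \<sigma> \<gamma>) \<O>. \<forall>v\<in>H10 (heston_weight \<kappa> \<theta> \<sigma> \<gamma>) \<O>.
         \<bar>heston_form_shift r \<kappa> \<theta> \<rho> \<sigma> l \<gamma> \<O> u v\<bar>
           \<le> C * H1_norm (heston_weight \<kappa> \<theta> \<sigma> \<gamma>) \<O> u * H1_norm (heston_weight \<kappa> \<theta> \<sigma> \<gamma>) \<O> v) \<and>
      (\<forall>v\<in>H10 (heston_weight \<kappa> \<theta> \<sigma> \<gamma>) \<O>. heston_form_shift r \<kappa> \<theta> \<rho> \<sigma> l \<gamma> \<O> v v
           \<ge> \<nu>1 * (H1_norm (heston_weight \<kappa> \<theta> \<sigma> \<gamma>) \<O> v)\<^sup>2)"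
    using cs unfolding coercive_shift_def Let_def by (elim conjE exE)
  have \<nu>1: "\<nu>1 > 0" "\<nu>1 * (H1_norm ?w \<O> v)\<^sup>2 \<le> form ?B v v" if "v \<in> H10 ?w \<O>" for v
  proof -
    show "\<nu>1 > 0" by fact
    have "\<forall>v\<in>H10 ?w \<O>. heston_form_shift r \<kappa> \<theta> \<rho> \<sigma> l \<gamma> \<O> v v \<ge> \<nu>1 * (H1_norm ?w \<O> v)\<^sup>2"
      using all[rule_format, of \<gamma> \<O>] \<gamma> O by (intro ballI) simp
    then show "\<nu>1 * (H1_norm ?w \<O> v)\<^sup>2 \<le> form ?B v v" using that eq[OF that that] by fastforce
  qed
  have "\<exists>u\<in>H10 ?w \<O>.
    (\<forall>v\<in>H10 ?w \<O>. form ?B u v + L2_inner ?w \<O> (penalty \<psi> \<epsilon> u) v = L2_inner ?w \<O> f v) \<and>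
    (\<forall>u'\<in>H10 ?w \<O>. (\<forall>v\<in>H10 ?w \<O>. form ?B u' v + L2_inner ?w \<O> (penalty \<psi> \<epsilon> u') v = L2_inner ?w \<O> f v) \<longrightarrow>
       (AE p in lborel. p \<in> \<O> \<longrightarrow> u' p = u p))"
    by (rule penalized_equation_uniquely_solvable[OF heston_integrand_admissible[OF W' assms(6) \<gamma>] bound_pos \<open>\<nu>1 > 0\<close> \<nu>1(2) f \<psi> \<epsilon>])
  then obtain u where u: "u \<in> H10 ?w \<O>"
    and sol: "\<forall>v\<in>H10 ?w \<O>. form ?B u v + L2_inner ?w \<O> (penalty \<psi> \<epsilon> u) v = L2_inner ?w \<O> f v"
    and uniq: "\<And>u'. u' \<in> H10 ?w \<O> \<Longrightarrow>
      \<forall>v\<in>H10 ?w \<O>. form ?B u' v + L2_inner ?w \<O> (penalty \<psi> \<epsilon> u') v = L2_inner ?w \<O> f v \<Longrightarrow>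
      AE p in lborel. p \<in> \<O> \<longrightarrow> u' p = u p"
    by blast
  have solves: "solves_penalized r \<kappa> \<theta> \<rho> \<sigma> l \<gamma> \<O> f \<psi> \<epsilon> z \<longleftrightarrow> z \<in> H10 ?w \<O> \<and>
      (\<forall>v\<in>H10 ?w \<O>. form ?B z v + L2_inner ?w \<O> (penalty \<psi> \<epsilon> z) v = L2_inner ?w \<O> f v)" for z
    unfolding solves_penalized_def Let_def by (intro conj_cong ball_cong refl) (simp add: eq)
  show "\<exists>u. solves_penalized r \<kappa> \<theta> \<rho> \<sigma> l \<gamma> \<O> f \<psi> \<epsilon> u \<and>
            (\<forall>u'. solves_penalized r \<kappa> \<theta> \<rho> \<sigma> l \<gamma> \<O> f \<psi> \<epsilon> u' \<longrightarrow>
                  (AE p in lborel. p \<in> \<O> \<longrightarrow> u' p = u p))"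
    unfolding solves
    by (rule exI[of _ u], intro conjI u sol allI impI) (elim conjE, rule uniq)
qed

end
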